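(* Let $n\ge 2$, let $\mathrm A>0$, and consider the system $$\ddot r_k=(1-|\dot r_k|^2)\dot r_k-\frac{\mathrm A^2}{n}\sum_{m=1}^n (r_k-r_m),\qquad k=1,\dots,n,\quad r_k(t)\in\mathbb C .$$ Every rotating state is stable: for every $\epsilon>0$ there exists $\delta>0$ such that, given any $\mathrm R_0\in\mathbb C$ and any angles $\theta_{0,1},\dots,\theta_{0,n}$ with $\sum_{k=1}^n e^{i\theta_{0,k}}=0$, if a solution $\{r_k(t)\}$ satisfies $$\Big|r_k(0)-\big(\mathrm R_0+\tfrac1{\mathrm A}e^{i\theta_{0,k}}\big)\Big|<\delta\quad\text{and}\quad |\dot r_k(0)-ie^{i\theta_{0,k}}|<\delta\qquad\text{for all }k,$$ then for all $k$ and all $t\ge 0$ $$\Big|r_k(t)-\big(\mathrm R_0+\tfrac1{\mathrm A}e^{i\theta_{0,k}}e^{i\mathrm A t}\big)\Big|<\epsilon\quad\text{and}\quad |\dot r_k(t)-ie^{i\theta_{0,k}}e^{i\mathrm A t}|<\epsilon .$$ Furthermore, every solution that starts near a rotating state converges to a nearby rotating state: $\delta$ can be chosen so that for every such solution there exist, in addition, $\mathrm R_\infty\in\mathbb C$ and angles $\theta_{\infty,k}$ with $\sum_{k=1}^n e^{i\theta_{\infty,k}}=0$ such that for all $k$ $$\lim_{t\to\infty}\Big[r_k(t)-\big(\mathrm R_\infty+\tfrac1{\mathrm A}e^{i\theta_{\infty,k}}e^{i\mathrm A t}\big)\Big]=0\quad\text{and}\quad \lim_{t\to\infty}\big[\dot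 r_k(t)-ie^{i\theta_{\infty,k}}e^{i\mathrm A t}\big]=0 .$$
   Context: Planar vectors $r_k\in\mathbb R^2$ are identified with complex numbers. A rotating state is a solution of the form $r_k(t)=\frac1{\mathrm A}e^{i\mathrm At}e^{i\theta_{0,k}}+\mathrm R_0$ for all $t$ and $k$, where $\mathrm R_0\in\mathbb C$ is constant and the angles satisfy $\sum_{k=1}^n e^{i\theta_{0,k}}=0$. *)

theory Defs
  imports "HOL-Analysis.Analysis"
begin

text \<open>Particles are indexed by \<open>{1..n}\<close>; \<open>r k\<close> is the trajectory of particle \<open>k\<close> and \<open>v k\<close> its
  velocity, which the first conjunct determines uniquely on \<open>t \<ge> 0\<close>. Solutions live on the half-line
  \<open>{0..}\<close> (one-sided derivatives at \<open>0\<close>), since they need not extend to all negative times.\<close>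

definition swarm_solution ::
  "nat \<Rightarrow> real \<Rightarrow> (nat \<Rightarrow> real \<Rightarrow> complex) \<Rightarrow> (nat \<Rightarrow> real \<Rightarrow> complex) \<Rightarrow> bool" where
  "swarm_solution n A r v \<longleftrightarrow>
    (\<forall>k\<in>{1..n}. \<forall>t\<ge>0.
      (r k has_vector_derivative v k t) (at t within {0..}) \<and>
      (v k has_vector_derivative
        (1 - (cmod (v k t))\<^sup>2) *\<^sub>R v k t - (A\<^sup>2 / real n) *\<^sub>R (\<Sum>m=1..n. r k t - r m t))
        (at t within {0..}))"

definition balanced_angles :: "nat \<Rightarrow> (nat \<Rightarrow> real) \<Rightarrow> bool" where
  "balanced_angles n \<theta> \<longleftrightarrow> (\<Sum>k=1..n. cis (\<theta> k)) = 0"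

definition rotating_position ::
  "real \<Rightarrow> complex \<Rightarrow> (nat \<Rightarrow> real) \<Rightarrow> nat \<Rightarrow> real \<Rightarrow> complex" where
  "rotating_position A R \<theta> k t = R + (1 / A) *\<^sub>R (cis (\<theta> k) * cis (A * t))"

definition rotating_velocity ::
  "real \<Rightarrow> (nat \<Rightarrow> real) \<Rightarrow> nat \<Rightarrow> real \<Rightarrow> complex" where
  "rotating_velocity A \<theta> k t = \<i> * cis (\<theta> k) * cis (A * t)"

lemma cis_line_has_vector_derivative:
  "((\<lambda>t. cis (A * t)) has_vector_derivative A *\<^sub>R (\<i> * cis (A * t))) (at t within S)"
proof -
  have "((\<lambda>z. exp (\<i> * of_real A * z)) has_field_derivative
      of_real A * (\<i> * exp (\<i> * of_real A * of_real t))) (at (of_real t))"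
    by (auto intro!: derivative_eq_intros)
  from has_vector_derivative_real_field[OF this] show ?thesis
    by (simp add: cis_conv_exp scaleR_conv_of_real mult.assoc)
qed

lemma rotating_state_is_solution:
  assumes "n \<ge> 1" "A > 0" "balanced_angles n \<theta>"
  shows "swarm_solution n A (rotating_position A R \<theta>) (rotating_velocity A \<theta>)"
  unfolding swarm_solution_def
proof (intro ballI allI impI conjI)
  fix k t assume "k \<in> {1..n}" "(t::real) \<ge> 0"
  show "(rotating_position A R \<theta> k has_vector_derivative rotating_velocity A \<theta> k t)
      (at t within {0..})"
    unfolding rotating_position_def rotating_velocity_def
    using assms(2) by (auto intro!: derivative_eq_intros cis_line_has_vector_derivative
        simp: scaleR_conv_of_real)
  have "cmod (rotating_velocity A \<theta> k t) = 1"
    by (simp add: rotating_velocity_def norm_mult)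
  moreover have "(\<Sum>m=1..n. rotating_position A R \<theta> k t - rotating_position A R \<theta> m t)
      = (real n / A) *\<^sub>R (cis (\<theta> k) * cis (A * t))"
  proof -
    have "(\<Sum>m=1..n. rotating_position A R \<theta> k t - rotating_position A R \<theta> m t)
      = real n *\<^sub>R ((1 / A) *\<^sub>R (cis (\<theta> k) * cis (A * t)))
        - (1 / A) *\<^sub>R ((\<Sum>m=1..n. cis (\<theta> m)) * cis (A * t))"
      by (simp add: rotating_position_def sum_subtractf scaleR_right.sum[symmetric]
          sum_distrib_right[symmetric] scaleR_conv_of_real sum_divide_distrib[symmetric])
    then show ?thesis using assms(3) by (simp add: balanced_angles_def)
  qed
  moreover have "(rotating_velocity A \<theta> k has_vector_derivative
      - (A *\<^sub>R (cis (\<theta> k) * cis (A * t)))) (at t within {0..})"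
    unfolding rotating_velocity_def
    by (rule derivative_eq_intros cis_line_has_vector_derivative)+
      (simp add: complex_eq_iff algebra_simps)
  ultimately show "(rotating_velocity A \<theta> k has_vector_derivative
      (1 - (cmod (rotating_velocity A \<theta> k t))\<^sup>2) *\<^sub>R rotating_velocity A \<theta> k t
      - (A\<^sup>2 / real n) *\<^sub>R
        (\<Sum>m=1..n. rotating_position A R \<theta> k t - rotating_position A R \<theta> m t))
      (at t within {0..})"
    using assms(1,2) by (simp add: power2_eq_square)
qed

end

theory Submission
  imports Defs
begin

text \<open>In the frame rotating with angular velocity \<open>A\<close>, put \<open>z\<^sub>k = v\<^sub>k e\<^sup>-\<^sup>i\<^sup>A\<^sup>t\<close> and let \<open>d\<^sub>k\<close> measure how far
  \<open>v\<^sub>k\<close> is from \<open>i A (r\<^sub>k - R)\<close>, where \<open>R\<close> is the center of mass. Rotating states are exactly the equilibria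
  \<open>|z\<^sub>k| = 1\<close>, \<open>d\<^sub>k = 0\<close>. They do not form a manifold: collinear configurations are singular, and there the
  linearization has an additional zero eigenvalue. Therefore one argues as in the Lojasiewicz gradient
  inequality. Writing \<open>Z\<close> for the mean of the \<open>d\<^sub>k\<close> and \<open>P\<close> for the mean of the projections on the \<open>z\<^sub>k\<close>, the
  linearization is \<open>Z' = U\<close>, \<open>U' = w - 2 U\<close>, \<open>w' = i A w - 2 A\<^sup>2 (U + P Z)\<close>; it has the exact Lyapunov function
  \<open>|w|\<^sup>2/2 + A\<^sup>2 |U|\<^sup>2 + 2 A\<^sup>2 (Z \<bullet> P Z + Z \<bullet> P U)\<close>, whatever the angles are. Corrected by small multiples of two
  more quadratic forms it becomes a Lyapunov function \<open>L\<close> that is comparable to the squared distance from the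
  equilibria and satisfies \<open>L' \<le> - c G\<^sup>2\<close>, where \<open>G\<close> bounds the speed of the \<open>z\<^sub>k\<close>. Since collinearity and
  \<open>Z \<noteq> 0\<close> are incompatible, \<open>G\<^sup>2 \<ge> c L\<^sup>3\<^sup>/\<^sup>2\<close>. Hence the trajectory has length at most \<open>C L(0)\<^sup>1\<^sup>/\<^sup>4\<close>, uniformly in
  the rotating state.\<close>

subsection \<open>Domination up to a constant\<close>

text \<open>The threshold \<delta> is chosen before the angles, and the linearization with its
  kernel varies with them. So no normal form is used: every constant depends on \<open>n\<close> and
  \<open>A\<close> only and is valid on the whole set \<open>near\<close>, and
  \<open>dominated\<close> hides its value. The harder constraint concerns the remainders. The size
  \<open>N\<close> and the dissipated quantity \<open>G\<close> are tied only by
  \<open>N ^ 3 \<le> C * G\<^sup>2\<close> with a \<open>C\<close> that is not small, so a remainder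
  of order \<open>N ^ 3\<close> in the derivative of the Lyapunov function could not be absorbed.
  Remainders of order \<open>G * N\<^sup>2\<close> or \<open>N ^ 4\<close> can:
  \<open>N ^ 4 \<le> N * C * G\<^sup>2\<close> shows that \<open>N\<^sup>2\<close> is a small
  multiple of \<open>G\<close> near the equilibria. Every cubic term therefore has to exhibit a
  factor bounded by \<open>G\<close>, and most of the algebra serves this. One Lyapunov function
  suits all angles because they enter the linear equations of \<open>Z\<close>, \<open>U\<close>,
  \<open>w\<close> only through the symmetric operator \<open>P\<close>. The fourth root in the
  length bound arises because \<open>L\<close> is of order \<open>N\<^sup>2\<close>, hence
  \<open>L powr (3/2)\<close> at most of order \<open>G\<^sup>2\<close>.\<close>

definition dominated :: "'s set \<Rightarrow> ('s \<Rightarrow> 'b::real_normed_vector) \<Rightarrow> ('s \<Rightarrow> real) \<Rightarrow> bool" where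
  "dominated S f g \<longleftrightarrow> (\<exists>C\<ge>0. \<forall>s\<in>S. norm (f s) \<le> C * g s)"

lemma dominatedI:
  assumes "\<And>s. s \<in> S \<Longrightarrow> norm (f s) \<le> C * g s" "\<And>s. s \<in> S \<Longrightarrow> 0 \<le> g s"
  shows "dominated S f g"
  unfolding dominated_def
proof (intro exI[of _ "max C 0"] conjI ballI)
  fix s assume s: "s \<in> S"
  have "C * g s \<le> max C 0 * g s" using assms(2)[OF s] by (intro mult_right_mono) auto
  with assms(1)[OF s] show "norm (f s) \<le> max C 0 * g s" by linarith
qed simp

lemma dominated_add:
  assumes "dominated S f h" "dominated S g h"
  shows "dominated S (\<lambda>s. f s + g s) h"
proof -
  from assms obtain C D where "C \<ge> 0" "D \<ge> 0"
    "\<And>s. s \<in> S \<Longrightarrow> norm (f s) \<le> C * h s" "\<And>s. s \<in> S \<Longrightarrow> norm (g s) \<le> D * h s"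
    unfolding dominated_def by blast
  then have "norm (f s + g s) \<le> (C + D) * h s" if "s \<in> S" for s
    using norm_triangle_ineq[of "f s" "g s"] add_mono[of "norm (f s)" "C * h s" "norm (g s)" "D * h s"] that
    by (simp add: distrib_right)
  with \<open>C \<ge> 0\<close> \<open>D \<ge> 0\<close> show ?thesis
    unfolding dominated_def by (intro exI[of _ "C + D"]) auto
qed

lemma dominated_minus: "dominated S f h \<Longrightarrow> dominated S (\<lambda>s. - f s) h"
  by (simp add: dominated_def)

lemma dominated_diff:
  assumes "dominated S f h" "dominated S g h"
  shows "dominated S (\<lambda>s. f s - g s) h"
  using dominated_add[OF assms(1) dominated_minus[OF assms(2)]] by simp

text \<open>Orders of magnitude multiply under any bounded bilinear operation. The instances below,
  products, scalings and inner products, are the operations from which the vector field and the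
  Lyapunov function are built.\<close>

lemma dominated_bilinear:
  assumes "bounded_bilinear pr" "dominated S f h" "dominated S g k"
  shows "dominated S (\<lambda>s. pr (f s) (g s)) (\<lambda>s. h s * k s)"
proof -
  interpret bounded_bilinear pr by fact
  from nonneg_bounded obtain K where K: "K \<ge> 0" "\<And>a b. norm (pr a b) \<le> norm a * norm b * K"
    by auto
  from assms obtain C D where CD: "C \<ge> 0" "D \<ge> 0"
    "\<And>s. s \<in> S \<Longrightarrow> norm (f s) \<le> C * h s" "\<And>s. s \<in> S \<Longrightarrow> norm (g s) \<le> D * k s"
    unfolding dominated_def by blast
  have "norm (pr (f s) (g s)) \<le> (C * D * K) * (h s * k s)" if s: "s \<in> S" for s
  proof -
    have "norm (f s) * norm (g s) \<le> (C * h s) * (D * k s)"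
      using CD(3,4)[OF s] by (intro mult_mono) (auto intro: order_trans[OF norm_ge_zero CD(3)[OF s]])
    then have "norm (f s) * norm (g s) * K \<le> (C * h s) * (D * k s) * K"
      using K(1) by (rule mult_right_mono)
    with K(2)[of "f s" "g s"] show ?thesis by (simp add: mult_ac)
  qed
  with CD K show ?thesis unfolding dominated_def by (intro exI[of _ "C * D * K"]) auto
qed

lemmas dominated_mult = dominated_bilinear[OF bounded_bilinear_mult]
lemmas dominated_scaleR = dominated_bilinear[OF bounded_bilinear_scaleR]
lemmas dominated_inner = dominated_bilinear[OF bounded_bilinear_inner]

lemma dominated_const: "dominated S (\<lambda>s. c) (\<lambda>s. 1)"
  unfolding dominated_def by (intro exI[of _ "norm c"]) auto

lemma dominated_mono:
  assumes "dominated S f g" "dominated S g h"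
  shows "dominated S f h"
proof -
  from assms obtain C D where CD: "C \<ge> 0" "D \<ge> 0"
    "\<And>s. s \<in> S \<Longrightarrow> norm (f s) \<le> C * g s" "\<And>s. s \<in> S \<Longrightarrow> norm (g s) \<le> D * h s"
    unfolding dominated_def by blast
  have "norm (f s) \<le> (C * D) * h s" if s: "s \<in> S" for s
  proof -
    have "C * g s \<le> C * (D * h s)" using CD(1) CD(4)[OF s] by (intro mult_left_mono) auto
    with CD(3)[OF s] show ?thesis by (simp add: mult_ac)
  qed
  with CD show ?thesis unfolding dominated_def by (intro exI[of _ "C * D"]) auto
qed

lemma dominated_cmult:
  fixes f :: "'s \<Rightarrow> 'b::real_normed_algebra"
  shows "dominated S f g \<Longrightarrow> dominated S (\<lambda>s. c * f s) g"
  using dominated_mult[OF dominated_const, of S f g c] by simp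

lemma dominated_cscaleR: "dominated S f g \<Longrightarrow> dominated S (\<lambda>s. c *\<^sub>R f s) g"
  using dominated_scaleR[OF dominated_const, of S f g c] by simp

lemma dominated_scaleR1:
  "dominated S f h \<Longrightarrow> dominated S g (\<lambda>s. 1) \<Longrightarrow> dominated S (\<lambda>s. f s *\<^sub>R g s) h"
  using dominated_scaleR[of S f h g "\<lambda>s. 1"] by simp

lemma dominated_inner1:
  "dominated S f (\<lambda>s. 1) \<Longrightarrow> dominated S g h \<Longrightarrow> dominated S (\<lambda>s. f s \<bullet> g s) h"
  using dominated_inner[of S f "\<lambda>s. 1" g h] by simp

lemma dominated_le:
  "dominated S f g \<Longrightarrow> (\<And>s. s \<in> S \<Longrightarrow> g s \<le> h s) \<Longrightarrow> dominated S f h"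
  unfolding dominated_def by (meson mult_left_mono order_trans)

lemma dominated_ii: "dominated S f g \<Longrightarrow> dominated S (\<lambda>s. \<i> * f s) g"
  by (rule dominated_cmult)

lemma dominated_sqrt:
  assumes "dominated S f (\<lambda>s. h s * h s)" "\<And>s. s \<in> S \<Longrightarrow> 0 \<le> h s"
  shows "dominated S (\<lambda>s. sqrt (f s)) h"
proof -
  from assms(1) obtain C where C: "C \<ge> 0" "\<And>s. s \<in> S \<Longrightarrow> norm (f s) \<le> C * (h s * h s)"
    unfolding dominated_def by blast
  show ?thesis
  proof (rule dominatedI[where C = "sqrt C"])
    fix s assume s: "s \<in> S"
    have "\<bar>sqrt (f s)\<bar> = sqrt \<bar>f s\<bar>" by (simp add: real_sqrt_abs2 abs_if real_sqrt_minus)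
    also have "\<dots> \<le> sqrt (C * (h s * h s))" using C(2)[OF s] by simp
    also have "\<dots> = sqrt C * h s" using assms(2)[OF s] by (simp add: real_sqrt_mult)
    finally show "norm (sqrt (f s)) \<le> sqrt C * h s" by simp
  qed (use assms in auto)
qed

section \<open>Sums of signs, and the length of a curve under Lojasiewicz dissipation\<close>

text \<open>Rounding each \<open>t k\<close> to its sign changes the sum by at most
  \<open>sum e K\<close>. The rounded sum is an integer of modulus below 1, hence 0, and only the
  rounding error remains.\<close>

lemma sum_sign_count:
  fixes t e :: "'a \<Rightarrow> real"
  assumes "finite K" and near1: "\<And>k. k \<in> K \<Longrightarrow> \<bar>\<bar>t k\<bar> - 1\<bar> \<le> e k"
    and small: "\<bar>sum t K\<bar> + sum e K < 1"
  shows "\<bar>sum t K\<bar> \<le> sum e K"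
proof -
  define j :: "'a \<Rightarrow> int" where "j k = (if t k \<ge> 0 then 1 else - 1)" for k
  have "\<bar>sum t K - of_int (sum j K)\<bar> = \<bar>\<Sum>k\<in>K. t k - of_int (j k)\<bar>"
    by (simp add: sum_subtractf)
  also have "\<dots> \<le> (\<Sum>k\<in>K. \<bar>t k - of_int (j k)\<bar>)" by (rule sum_abs)
  also have "\<dots> \<le> sum e K"
  proof (rule sum_mono)
    fix k assume "k \<in> K"
    from near1[OF this] show "\<bar>t k - of_int (j k)\<bar> \<le> e k" by (auto simp: j_def)
  qed
  finally have close: "\<bar>sum t K - of_int (sum j K)\<bar> \<le> sum e K" .
  then have "\<bar>of_int (sum j K) :: real\<bar> < 1" using small by linarith
  then have "sum j K = 0" by linarith
  with close show ?thesis by simp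
qed

text \<open>Formally, the fourth root of \<open>l\<close> has derivative
  \<open>l' / (4 * l powr (3/4))\<close>, and \<open>l powr (3/4) \<le> sqrt K * g\<close>, so it
  decreases at least at a rate proportional to \<open>g\<close>; integration bounds the length.
  Since \<open>l\<close> may vanish, where the root need not be differentiable, the argument is run
  for a positive perturbation of \<open>l\<close>.\<close>

lemma lojasiewicz_speed:
  fixes l l' g :: "real \<Rightarrow> real" and f f' :: "real \<Rightarrow> 'b::real_normed_vector"
  assumes l: "\<And>t. t \<ge> 0 \<Longrightarrow> (l has_real_derivative l' t) (at t within {0..})"
    and l0: "\<And>t. t \<ge> 0 \<Longrightarrow> l t \<ge> 0"
    and decay: "\<And>t. t \<ge> 0 \<Longrightarrow> l' t \<le> - c * (g t)\<^sup>2"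
    and loj: "\<And>t. t \<ge> 0 \<Longrightarrow> l t * sqrt (l t) \<le> K * (g t)\<^sup>2"
    and g: "\<And>t. t \<ge> 0 \<Longrightarrow> g t \<ge> 0" and pos: "c > 0" "K > 0" "M \<ge> 0"
    and f: "\<And>t. t \<ge> 0 \<Longrightarrow> (f has_vector_derivative f' t) (at t within {0..})"
    and f': "\<And>t. t \<ge> 0 \<Longrightarrow> norm (f' t) \<le> M * g t"
    and st: "0 \<le> s" "s \<le> t"
  shows "norm (f t - f s) \<le> M * (4 * sqrt (3 * (K / c + 1) / c)) * sqrt (sqrt (l s))"
proof (cases "s = t")
  case True
  then show ?thesis using pos l0[of t] st by simp
next
  case False
  with st have lt: "s < t" by simp
  \<comment> \<open>Bounds the power 3/2 of the perturbed function: a sum is at most twice its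
    larger term, and \<open>2 * sqrt 2 \<le> 3\<close>.\<close>
  define B where "B = 3 * (K / c + 1)"
  define C where "C = 4 * sqrt (B / c)"
  have B: "B > 0" using pos by (simp add: B_def add_pos_pos)
  then have C: "C > 0" using pos by (simp add: C_def)
  have reg: "norm (f t - f s) \<le> M * C * sqrt (sqrt (l s + \<eta>))" if \<eta>: "0 < \<eta>" "\<eta> \<le> 1" for \<eta>
  proof -
    \<comment> \<open>This perturbation dissipates by the same law as \<open>l\<close>: for
      \<open>\<eta> \<le> 1\<close>, \<open>e x * sqrt (e x)\<close> is at most
      \<open>\<eta> / (1 + x) ^ 3\<close>, which is half of its rate of decrease. A constant
      perturbation would not decrease at all.\<close>
    define e where "e x = \<eta> / (1 + x)\<^sup>2" for x :: real
    define m where "m x = l x + e x" for x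
    define m' where "m' x = l' x - 2 * \<eta> / (1 + x) ^ 3" for x
    have e: "0 < e x" if "x \<ge> 0" for x using that \<eta> by (simp add: e_def)
    have m: "0 < m x" if "x \<ge> 0" for x using e[OF that] l0[OF that] by (simp add: m_def)
    have ed: "(e has_real_derivative - 2 * \<eta> / (1 + x) ^ 3) (at x within {0..})" if "x \<ge> 0" for x
      unfolding e_def[abs_def] using that
      by (auto intro!: derivative_eq_intros simp: power2_eq_square power3_eq_cube divide_simps)
    have md: "(m has_real_derivative m' x) (at x within {0..})" if "x \<ge> 0" for x
      unfolding m_def[abs_def] m'_def using DERIV_add[OF l[OF that] ed[OF that]] by simp
    have sd: "((\<lambda>x. - (M * C * sqrt (sqrt (m x)))) has_real_derivative
        M * C * (- m' x / (4 * (sqrt (m x) * sqrt (sqrt (m x)))))) (at x within {0..})" if "x \<ge> 0" for x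
      using m[OF that] by (auto intro!: derivative_eq_intros md[OF that] simp: field_simps)
    have bound: "norm (f' x) \<le> M * C * (- m' x / (4 * (sqrt (m x) * sqrt (sqrt (m x)))))" if x: "x \<ge> 0" for x
    proof -
      define q where "q = c * (g x)\<^sup>2 + 2 * \<eta> / (1 + x) ^ 3"
      have e3: "0 \<le> \<eta> / (1 + x) ^ 3" using x \<eta> by simp
      have q1: "q \<le> - m' x" using decay[OF x] by (simp add: q_def m'_def)
      have q2: "(g x)\<^sup>2 \<le> q / c" using mult_left_mono[OF e3, of 2] pos by (simp add: q_def field_simps)
      have "e x * sqrt (e x) \<le> \<eta> / (1 + x) ^ 3"
      proof -
        have "sqrt (e x) = sqrt \<eta> / (1 + x)" using x by (simp add: e_def real_sqrt_divide)
        moreover have "sqrt \<eta> \<le> 1" using \<eta> by simp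
        then have "\<eta> * sqrt \<eta> \<le> \<eta> * 1" using \<eta> by (intro mult_left_mono) auto
        then have "\<eta> * sqrt \<eta> / (1 + x) ^ 3 \<le> \<eta> / (1 + x) ^ 3" using x by (intro divide_right_mono) auto
        ultimately show ?thesis by (simp add: e_def power2_eq_square power3_eq_cube)
      qed
      then have e_le: "e x * sqrt (e x) \<le> q"
        using e3 pos by (simp add: q_def add_increasing)
      have l_le: "l x * sqrt (l x) \<le> K / c * q"
      proof -
        have "K * (g x)\<^sup>2 \<le> K * (q / c)" using pos q2 by (intro mult_left_mono) auto
        then show ?thesis using loj[OF x] by simp
      qed
      have q0: "0 \<le> q" using q2 pos by (meson order_trans zero_le_power2 zero_le_divide_iff linorder_not_le)
      have m_le: "m x * sqrt (m x) \<le> B * q"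
      proof -
        define y where "y = max (l x) (e x)"
        have y: "0 \<le> y" "m x \<le> 2 * y" using e[OF x] by (simp_all add: y_def m_def)
        have "m x * sqrt (m x) \<le> (2 * y) * sqrt (2 * y)"
          using y m[OF x] by (intro mult_mono) auto
        also have "\<dots> = 2 * sqrt 2 * (y * sqrt y)" by (simp add: real_sqrt_mult)
        also have "\<dots> \<le> 3 * (y * sqrt y)"
        proof -
          have "sqrt 2 \<le> 3/2" by (rule real_le_lsqrt) (simp_all add: power2_eq_square)
          then show ?thesis using y by (intro mult_right_mono) auto
        qed
        also have "y * sqrt y \<le> K / c * q + q"
        proof (cases "l x \<le> e x")
          case True
          have "0 \<le> K / c * q" using q0 pos by simp
          then show ?thesis using True e_le by (simp add: y_def max_def)
        next
          case False
          then show ?thesis using l_le q0 by (simp add: y_def max_def)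
        qed
        finally show ?thesis by (simp add: B_def algebra_simps)
      qed
      \<comment> \<open>The power 3/4 of \<open>m x\<close>, which appears in the denominator of the
        derivative of its fourth root.\<close>
      define p where "p = sqrt (m x) * sqrt (sqrt (m x))"
      have p: "0 < p" using m[OF x] by (simp add: p_def)
      have psq: "p\<^sup>2 = m x * sqrt (m x)" using m[OF x] by (simp add: p_def power_mult_distrib)
      \<comment> \<open>The factors \<open>(g x)\<^sup>2\<close> and \<open>p\<^sup>2\<close> are
        both at most multiples of \<open>q\<close>; the square root of the product is therefore
        linear in \<open>q\<close>, hence in the rate of decrease.\<close>
      have "(g x * p)\<^sup>2 = (g x)\<^sup>2 * (m x * sqrt (m x))" by (simp add: power_mult_distrib psq)
      also have "\<dots> \<le> (q / c) * (B * q)"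
        by (rule mult_mono[OF q2 m_le]) (use m[OF x] q0 pos in auto)
      also have "\<dots> = (sqrt (B / c) * q)\<^sup>2"
      proof -
        have "(sqrt (B / c))\<^sup>2 = B / c" using B pos by simp
        then show ?thesis unfolding power_mult_distrib by (simp add: power2_eq_square)
      qed
      finally have "g x * p \<le> sqrt (B / c) * q"
        by (rule power2_le_imp_le) (use q0 B pos in simp)
      then have "g x \<le> sqrt (B / c) * q / p" using p by (simp add: pos_le_divide_eq)
      also have "\<dots> = C * (q / (4 * p))" by (simp add: C_def)
      also have "\<dots> \<le> C * (- m' x / (4 * p))"
        using q1 p C by (intro mult_left_mono divide_right_mono) auto
      finally have "M * g x \<le> M * (C * (- m' x / (4 * p)))" using pos by (intro mult_left_mono) auto
      with f'[OF x] show ?thesis unfolding p_def by (simp only: mult.assoc)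
    qed
    have sub: "at x within {s..t} \<le> at x within {0..}" for x using st by (intro at_le) auto
    have "norm (f t - f s) \<le> - (M * C * sqrt (sqrt (m t))) - - (M * C * sqrt (sqrt (m s)))"
    proof (rule differentiable_bound_general[OF lt])
      show "continuous_on {s..t} f"
        unfolding continuous_on_eq_continuous_within
        using st f by (auto intro!: has_vector_derivative_continuous has_vector_derivative_within_subset[OF f])
      show "continuous_on {s..t} (\<lambda>x. - (M * C * sqrt (sqrt (m x))))"
        by (rule DERIV_continuous_on[OF DERIV_subset[OF sd]]) (use st in auto)
      fix x assume x: "s < x" "x < t"
      then have x0: "x > 0" using st by simp
      have at: "at x within {0..} = at x" using x0 by (intro at_within_interior) simp
      show "(f has_vector_derivative f' x) (at x)" using f[of x] x0 unfolding at by simp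
      show "((\<lambda>x. - (M * C * sqrt (sqrt (m x)))) has_vector_derivative
          M * C * (- m' x / (4 * (sqrt (m x) * sqrt (sqrt (m x)))))) (at x)"
        using sd[of x] x0 unfolding at by (simp add: has_real_derivative_iff_has_vector_derivative)
      show "norm (f' x) \<le> M * C * (- m' x / (4 * (sqrt (m x) * sqrt (sqrt (m x)))))"
        using bound x0 by simp
    qed
    also have "\<dots> \<le> M * C * sqrt (sqrt (m s))" using pos C m[of t] st by simp
    also have "\<dots> \<le> M * C * sqrt (sqrt (l s + \<eta>))"
    proof -
      have "1 \<le> (1 + s)\<^sup>2" using st by simp
      then have "e s \<le> \<eta>" using \<eta> by (simp add: e_def divide_le_eq)
      then show ?thesis using pos C by (intro mult_left_mono) (auto simp: m_def)
    qed
    finally show ?thesis .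
  qed
  \<comment> \<open>The constant does not depend on \<eta>, so the perturbation can be removed in
    the limit, also when \<open>l s\<close> is 0.\<close>
  have "((\<lambda>\<eta>. M * C * sqrt (sqrt (l s + \<eta>))) \<longlongrightarrow> M * C * sqrt (sqrt (l s + 0))) (at_right 0)"
    by (intro tendsto_intros)
  moreover have "\<forall>\<^sub>F \<eta> in at_right 0. norm (f t - f s) \<le> M * C * sqrt (sqrt (l s + \<eta>))"
    unfolding eventually_at_right_field by (intro exI[of _ 1]) (auto intro: reg)
  ultimately have "norm (f t - f s) \<le> M * C * sqrt (sqrt (l s + 0))"
    by (intro tendsto_lowerbound) auto
  then show ?thesis by (simp add: C_def B_def)
qed

subsection \<open>Lojasiewicz decay on a half-line\<close>

lemma half_line_mvt:
  fixes l l' :: "real \<Rightarrow> real"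
  assumes l: "\<And>x. a \<le> x \<Longrightarrow> x \<le> b \<Longrightarrow> (l has_real_derivative l' x) (at x within {0..})"
    and ab: "0 \<le> a" "a < b"
  shows "\<exists>x>a. x < b \<and> l b - l a = (b - a) * l' x"
proof -
  have "\<exists>x\<in>{a<..<b}. l b - l a = (\<lambda>h. l' x * h) (b - a)"
  proof (rule mvt_simple[OF ab(2)])
    fix x assume x: "a \<le> x" "x \<le> b"
    have "(l has_real_derivative l' x) (at x within {a..b})"
      by (rule DERIV_subset[OF l]) (use x ab in auto)
    then show "(l has_derivative (*) (l' x)) (at x within {a..b})"
      by (simp add: has_field_derivative_def)
  qed
  then show ?thesis by (auto simp: mult.commute)
qed

lemma half_line_decreasing:
  fixes l l' :: "real \<Rightarrow> real"
  assumes l: "\<And>x. a \<le> x \<Longrightarrow> x \<le> b \<Longrightarrow> (l has_real_derivative l' x) (at x within {0..})"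
    and neg: "\<And>x. a \<le> x \<Longrightarrow> x \<le> b \<Longrightarrow> l' x \<le> 0" and ab: "0 \<le> a" "a \<le> b"
  shows "l b \<le> l a"
proof (cases "a = b")
  case False
  with ab half_line_mvt[OF l] obtain x where x: "a < x" "x < b" "l b - l a = (b - a) * l' x"
    by (metis order_le_less)
  have "(b - a) * l' x \<le> 0" using neg[of x] x ab by (intro mult_nonneg_nonpos) auto
  with x show ?thesis by simp
qed simp

text \<open>The mean value theorem on the interval from 0 to \<open>t\<close>, together with
  monotonicity of \<open>l\<close>, gives \<open>t * (l t * sqrt (l t)) \<le> K / c * l 0\<close>.
  This rate is not the sharp one, but only the limit is needed.\<close>

lemma lojasiewicz_decay_zero:
  fixes l l' g :: "real \<Rightarrow> real"
  assumes l: "\<And>t. t \<ge> 0 \<Longrightarrow> (l has_real_derivative l' t) (at t within {0..})"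
    and l0: "\<And>t. t \<ge> 0 \<Longrightarrow> l t \<ge> 0"
    and decay: "\<And>t. t \<ge> 0 \<Longrightarrow> l' t \<le> - c * (g t)\<^sup>2"
    and loj: "\<And>t. t \<ge> 0 \<Longrightarrow> l t * sqrt (l t) \<le> K * (g t)\<^sup>2"
    and pos: "c > 0" "K > 0"
  shows "(l \<longlongrightarrow> 0) at_top"
proof -
  have l'_nonpos: "l' x \<le> 0" if "x \<ge> 0" for x
  proof -
    have "0 \<le> c * (g x)\<^sup>2" using pos by simp
    with decay[OF that] show ?thesis by simp
  qed
  have mono: "l b \<le> l a" if "0 \<le> a" "a \<le> b" for a b
    by (rule half_line_decreasing[of _ _ l l']) (use that l l'_nonpos in auto)
  have bound: "t * (l t * sqrt (l t)) \<le> K / c * l 0" if t: "t > 0" for t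
  proof -
    from half_line_mvt[of 0 t l l'] l t obtain x where x: "0 < x" "x < t" "l t - l 0 = t * l' x" by auto
    have lx: "0 \<le> l t" "l t \<le> l x" using l0 mono[of x t] x t by auto
    then have "l t * sqrt (l t) \<le> l x * sqrt (l x)" by (intro mult_mono) auto
    also have "\<dots> \<le> K * (g x)\<^sup>2" using loj[of x] x by simp
    also have "\<dots> \<le> K * (- l' x / c)"
      using decay[of x] x pos by (intro mult_left_mono) (auto simp: field_simps)
    finally have "t * (l t * sqrt (l t)) \<le> t * (K * (- l' x / c))" using t by (intro mult_left_mono) auto
    also have "\<dots> = K / c * (l 0 - l t)" using x(3) by (simp add: algebra_simps)
    also have "\<dots> \<le> K / c * l 0" using lx pos by (intro mult_left_mono) auto
    finally show ?thesis .
  qed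
  show ?thesis
  proof (rule order_tendstoI)
    fix e :: real assume e: "0 > e"
    have "\<forall>\<^sub>F t in at_top. t \<ge> (0::real)" by (rule eventually_ge_at_top)
    then show "\<forall>\<^sub>F t in at_top. e < l t" by eventually_elim (use l0 e in force)
  next
    fix e :: real assume e: "0 < e"
    define T where "T = K / c * l 0 / (e * sqrt e)"
    have "\<forall>\<^sub>F t in at_top. t > max T 0" by (rule eventually_gt_at_top)
    then show "\<forall>\<^sub>F t in at_top. l t < e"
    proof eventually_elim
      case (elim t)
      show ?case
      proof (rule ccontr)
        assume "\<not> l t < e"
        then have "e * sqrt e \<le> l t * sqrt (l t)" using e by (intro mult_mono) auto
        then have "t * (e * sqrt e) \<le> t * (l t * sqrt (l t))" using elim by (intro mult_left_mono) auto
        also have "\<dots> \<le> K / c * l 0" using bound[of t] elim by simp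
        finally have "t \<le> T" using e unfolding T_def by (subst pos_le_divide_eq) auto
        with elim show False by simp
      qed
    qed
  qed
qed

text \<open>A bound on all later increments that tends to 0 is a Cauchy criterion. Integer times
  suffice to produce the limit; letting the later time tend to infinity then bounds the distance to
  it at every real time.\<close>

lemma tendsto_of_tail_bound:
  fixes f :: "real \<Rightarrow> 'b::banach"
  assumes b: "\<And>s t. 0 \<le> s \<Longrightarrow> s \<le> t \<Longrightarrow> norm (f t - f s) \<le> h s"
    and h: "(h \<longlongrightarrow> 0) at_top"
  obtains x where "(f \<longlongrightarrow> x) at_top"
proof -
  have "Cauchy (\<lambda>n. f (real n))"
  proof (rule CauchyI)
    fix e :: real assume e: "0 < e"
    have "((\<lambda>n. h (real n)) \<longlongrightarrow> 0) sequentially"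
      by (rule filterlim_compose[OF h filterlim_real_sequentially])
    then have "\<forall>\<^sub>F n in sequentially. h (real n) < e / 2" using e by (intro order_tendstoD) auto
    then obtain k where k: "h (real k) < e / 2" by (auto simp: eventually_sequentially)
    have *: "norm (f (real m) - f (real k)) < e / 2" if "m \<ge> k" for m
      using b[of "real k" "real m"] k that by simp
    have "norm (f (real m) - f (real n)) < e" if "m \<ge> k" "n \<ge> k" for m n
      using norm_diff_triangle_less[of "f (real m)" "f (real k)" "e/2" "f (real n)" "e/2"] *[OF that(1)] *[OF that(2)]
      by (simp add: norm_minus_commute)
    then show "\<exists>M. \<forall>m\<ge>M. \<forall>n\<ge>M. norm (f (real m) - f (real n)) < e" by blast
  qed
  then obtain x where x: "(\<lambda>n. f (real n)) \<longlonglongrightarrow> x" using Cauchy_convergent convergentD by blast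
  have le: "norm (f s - x) \<le> h s" if s: "0 \<le> s" for s
  proof (rule LIMSEQ_le_const2)
    show "(\<lambda>n. norm (f s - f (real n))) \<longlonglongrightarrow> norm (f s - x)" by (intro tendsto_intros x)
    have "norm (f s - f (real n)) \<le> h s" if "n \<ge> nat \<lceil>s\<rceil>" for n
      using b[OF s, of "real n"] that by (simp add: norm_minus_commute ceiling_le_iff nat_le_iff)
    then show "\<exists>N. \<forall>n\<ge>N. norm (f s - f (real n)) \<le> h s" by blast
  qed
  have "((\<lambda>s. f s - x) \<longlongrightarrow> 0) at_top"
  proof (rule Lim_null_comparison[OF _ h])
    show "\<forall>\<^sub>F s in at_top. norm (f s - x) \<le> h s"
      using eventually_ge_at_top[of 0] by eventually_elim (rule le)
  qed
  then show ?thesis using that by (simp add: Lim_null[symmetric])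
qed

lemma dominated_norm: "dominated S f g \<Longrightarrow> dominated S (\<lambda>s. norm (f s)) g"
  by (simp add: dominated_def)

text \<open>At the first time at which \<open>f\<close> reaches \<open>j\<close> the bound still
  holds up to that time, and \<open>step\<close> makes it strict there, a contradiction. It is
  needed because the Lyapunov inequalities hold only while the configuration stays small.\<close>

lemma continuous_bootstrap:
  fixes f :: "real \<Rightarrow> real"
  assumes cont: "continuous_on {0..} f" and init: "f 0 < j"
    and step: "\<And>T. 0 \<le> T \<Longrightarrow> (\<And>t. 0 \<le> t \<Longrightarrow> t \<le> T \<Longrightarrow> f t \<le> j) \<Longrightarrow> f T < j"
    and t: "0 \<le> t"
  shows "f t < j"
proof (rule ccontr)
  assume neg: "\<not> f t < j"
  define S where "S = {0..t} \<inter> f -` {j..}"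
  have cont': "continuous_on {0..x} f" for x by (rule continuous_on_subset[OF cont]) auto
  have "closed S" unfolding S_def by (rule continuous_closed_preimage[OF cont']) simp_all
  moreover have "bounded S" by (rule bounded_subset[of "{0..t}"]) (simp_all add: S_def)
  ultimately have "compact S" by (simp add: compact_eq_bounded_closed)
  moreover have "S \<noteq> {}" using neg t unfolding S_def by fastforce
  ultimately obtain u where u: "u \<in> S" "\<And>x. x \<in> S \<Longrightarrow> u \<le> x"
    using compact_attains_inf[of S] by metis
  have u0: "0 \<le> u" "j \<le> f u" "u \<le> t" using u(1) unfolding S_def by simp_all
  have below: "f x < j" if "0 \<le> x" "x < u" for x
    using u(2)[of x] that u0 by (force simp: S_def)
  have "f u \<le> j"
  proof (rule ccontr)
    assume "\<not> f u \<le> j"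
    then obtain x where x: "0 \<le> x" "x \<le> u" "f x = j"
      using IVT'[of f 0 j u] cont' init u0 by auto
    with below[of x] \<open>\<not> f u \<le> j\<close> show False by (cases "x = u") auto
  qed
  then have "f x \<le> j" if "0 \<le> x" "x \<le> u" for x
    using below[of x] that by (cases "x = u") auto
  from step[OF u0(1) this] u0 show False by simp
qed

subsection \<open>Configurations in the rotating frame\<close>

type_synonym config = "(nat \<Rightarrow> complex) \<times> (nat \<Rightarrow> complex)"

locale swarm =
  fixes n :: nat and A :: real
  assumes n_pos: "n \<ge> 1" and A_pos: "A > 0"
begin

definition mean :: "(nat \<Rightarrow> 'a::real_vector) \<Rightarrow> 'a" where
  "mean f = (1 / real n) *\<^sub>R (\<Sum>k=1..n. f k)"

lemma mean_cong: "(\<And>k. k \<in> {1..n} \<Longrightarrow> f k = g k) \<Longrightarrow> mean f = mean g"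
  unfolding mean_def by (intro arg_cong[where f = "scaleR _"] sum.cong) auto

lemma mean_add: "mean (\<lambda>k. f k + g k) = mean f + mean g"
  by (simp add: mean_def sum.distrib scaleR_add_right)

lemma mean_diff: "mean (\<lambda>k. f k - g k) = mean f - mean g"
  by (simp add: mean_def sum_subtractf scaleR_diff_right)

lemma mean_minus: "mean (\<lambda>k. - f k) = - mean f"
  by (simp add: mean_def sum_negf)

lemma mean_mult: "mean (\<lambda>k. c * f k) = c * mean f" for c :: "'a::real_algebra"
  by (simp add: mean_def sum_distrib_left)

lemma mean_mult_right: "mean (\<lambda>k. f k * c) = mean f * c" for c :: "'a::real_algebra"
  by (simp add: mean_def sum_distrib_right)

lemma mean_scaleR: "mean (\<lambda>k. c *\<^sub>R f k) = c *\<^sub>R mean f"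
  unfolding mean_def scaleR_sum_right by (simp add: mult.commute)

lemma mean_inner: "mean (\<lambda>k. f k \<bullet> c) = mean f \<bullet> c"
  by (simp add: mean_def inner_sum_left)

lemma mean_inner_right: "mean (\<lambda>k. c \<bullet> f k) = c \<bullet> mean f"
  by (simp add: mean_def inner_sum_right)

lemma mean_const: "mean (\<lambda>k. c) = c"
  using n_pos by (simp add: mean_def sum_constant_scaleR)

lemma mean_mono: "(\<And>k. k \<in> {1..n} \<Longrightarrow> f k \<le> g k) \<Longrightarrow> mean f \<le> (mean g :: real)"
  unfolding mean_def real_scaleR_def by (intro mult_left_mono sum_mono) auto

lemma mean_nonneg: "(\<And>k. k \<in> {1..n} \<Longrightarrow> 0 \<le> f k) \<Longrightarrow> 0 \<le> (mean f :: real)"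
  unfolding mean_def real_scaleR_def by (intro mult_nonneg_nonneg sum_nonneg) auto

lemma norm_mean_le: "norm (mean f) \<le> mean (\<lambda>k. norm (f k))"
  unfolding mean_def by (simp add: divide_right_mono norm_sum)

lemma le_mean:
  assumes "k \<in> {1..n}" "\<And>j. j \<in> {1..n} \<Longrightarrow> 0 \<le> f j"
  shows "f k \<le> real n * mean f"
proof -
  have "f k \<le> sum f {1..n}" using assms by (intro member_le_sum) auto
  with n_pos show ?thesis by (simp add: mean_def)
qed

lemma dominated_mean:
  assumes "\<And>k. k \<in> {1..n} \<Longrightarrow> dominated S (\<lambda>s. f s k) g"
  shows "dominated S (\<lambda>s. mean (f s)) g"
proof -
  have "dominated S (\<lambda>s. \<Sum>k\<in>K. f s k) g" if "finite K" "K \<subseteq> {1..n}" "K \<noteq> {}" for K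
    using that(1,3,2)
  proof (induction K rule: finite_ne_induct)
    case (singleton x)
    then show ?case using assms by simp
  next
    case (insert x F)
    then have "dominated S (\<lambda>s. f s x + (\<Sum>k\<in>F. f s k)) g"
      by (intro dominated_add assms) auto
    with insert show ?case by simp
  qed
  from dominated_cscaleR[OF this[of "{1..n}"], of "1 / real n"] n_pos show ?thesis
    unfolding mean_def by auto
qed

text \<open>A configuration consists of the \<open>z\<^sub>k\<close> and the \<open>d\<^sub>k\<close>, and \<open>drift\<close> is \<open>Z\<close>. For constant \<open>Z\<close> orthogonal to \<open>z\<^sub>k\<close>
  the linearized equations of particle \<open>k\<close> have the equilibrium \<open>rho = A * Y\<close>, \<open>par = 0\<close>, \<open>perp = Y\<close>;
  \<open>sg\<close> and \<open>tau\<close> measure deviations from it. The definitions ending in \<open>dot\<close> are time derivatives.\<close>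

definition rho :: "config \<Rightarrow> nat \<Rightarrow> real" where "rho s k = (norm (fst s k))\<^sup>2 - 1"
definition drift :: "config \<Rightarrow> complex" where "drift s = mean (snd s)"
definition par :: "config \<Rightarrow> nat \<Rightarrow> real" where "par s k = fst s k \<bullet> snd s k"
definition perp :: "config \<Rightarrow> nat \<Rightarrow> real" where "perp s k = (\<i> * fst s k) \<bullet> snd s k"
definition X :: "config \<Rightarrow> nat \<Rightarrow> real" where "X s k = fst s k \<bullet> drift s"
definition Y :: "config \<Rightarrow> nat \<Rightarrow> real" where "Y s k = (\<i> * fst s k) \<bullet> drift s"
definition sg :: "config \<Rightarrow> nat \<Rightarrow> real" where "sg s k = rho s k - A * Y s k"
definition tau :: "config \<Rightarrow> nat \<Rightarrow> real" where "tau s k = perp s k - Y s k"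
definition U :: "config \<Rightarrow> complex" where
  "U s = - mean (\<lambda>k. rho s k *\<^sub>R fst s k) - \<i> * A * drift s"
text \<open>The linear part of \<open>Udot + 2 * U\<close>. With this third unknown the linearized
  equations for the means close, up to the mean of \<open>X s k *\<^sub>R fst s k\<close>, which is
  \<open>P\<close> applied to the drift.\<close>

definition w :: "config \<Rightarrow> complex" where
  "w s = 2 * mean (\<lambda>k. (rho s k - A * perp s k) *\<^sub>R fst s k) + (2 - \<i> * A) * U s"

definition zdot :: "config \<Rightarrow> nat \<Rightarrow> complex" where
  "zdot s k = - (rho s k *\<^sub>R fst s k) - \<i> * A * snd s k"
definition ddot :: "config \<Rightarrow> nat \<Rightarrow> complex" where
  "ddot s k = - (rho s k *\<^sub>R fst s k) - 2 * \<i> * A * snd s k + \<i> * A * drift s"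
definition rhodot :: "config \<Rightarrow> nat \<Rightarrow> real" where
  "rhodot s k = - 2 * rho s k - 2 * (rho s k)\<^sup>2 + 2 * A * perp s k"
definition pardot :: "config \<Rightarrow> nat \<Rightarrow> real" where
  "pardot s k = - rho s k - (rho s k)\<^sup>2 - rho s k * par s k + 2 * A * perp s k - A * Y s k"
definition perpdot :: "config \<Rightarrow> nat \<Rightarrow> real" where
  "perpdot s k = - 2 * A * par s k + A * X s k - rho s k * perp s k + A * (norm (snd s k))\<^sup>2"

text \<open>The exact second-order remainders \<open>e1\<close> and \<open>e4\<close> in the
  equations of \<open>U\<close> and \<open>w\<close>. Bounding them by \<open>N\<^sup>2\<close> is
  not enough when they are multiplied by the drift; a cancellation inside them is needed, so they
  are kept explicit.\<close>

definition e1 :: "config \<Rightarrow> complex" where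
  "e1 s = mean (\<lambda>k. (2 * (rho s k)\<^sup>2) *\<^sub>R fst s k - rho s k *\<^sub>R zdot s k)"
definition e4 :: "config \<Rightarrow> complex" where
  "e4 s = (4 * A\<^sup>2) *\<^sub>R mean (\<lambda>k. rho s k *\<^sub>R snd s k)
    - (2 * A) *\<^sub>R mean (\<lambda>k. (A * (norm (snd s k))\<^sup>2 - rho s k * perp s k) *\<^sub>R fst s k)
    - (2 * A) *\<^sub>R mean (\<lambda>k. perp s k *\<^sub>R zdot s k) - \<i> * A * e1 s"
definition Udot :: "config \<Rightarrow> complex" where "Udot s = w s - 2 * U s + e1 s"
definition wdot :: "config \<Rightarrow> complex" where
  "wdot s = \<i> * A * w s - (2 * A\<^sup>2) *\<^sub>R U s - (2 * A\<^sup>2) *\<^sub>R mean (\<lambda>k. X s k *\<^sub>R fst s k) + e4 s"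
definition Xdot :: "config \<Rightarrow> nat \<Rightarrow> real" where
  "Xdot s k = zdot s k \<bullet> drift s + fst s k \<bullet> U s"
definition Ydot :: "config \<Rightarrow> nat \<Rightarrow> real" where
  "Ydot s k = (\<i> * zdot s k) \<bullet> drift s + (\<i> * fst s k) \<bullet> U s"

text \<open>Links the two forms of the same derivative: the product rule along a trajectory yields
  the right-hand side, while the Lyapunov computation uses the linear part plus remainder in
  \<open>Udot_def\<close>.\<close>

lemma Udot_alt:
  "Udot s = - mean (\<lambda>k. rhodot s k *\<^sub>R fst s k + rho s k *\<^sub>R zdot s k) - \<i> * A * U s"
proof -
  define m where "m = mean (\<lambda>k. (rho s k - A * perp s k) *\<^sub>R fst s k)"
  have "2 * m = mean (\<lambda>k. 2 * ((rho s k - A * perp s k) *\<^sub>R fst s k))"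
    unfolding mean_mult m_def ..
  then have "2 * m + e1 s = mean (\<lambda>k. 2 * ((rho s k - A * perp s k) *\<^sub>R fst s k)
      + ((2 * (rho s k)\<^sup>2) *\<^sub>R fst s k - rho s k *\<^sub>R zdot s k))"
    unfolding e1_def mean_add by simp
  also have "\<dots> = mean (\<lambda>k. - (rhodot s k *\<^sub>R fst s k + rho s k *\<^sub>R zdot s k))"
    by (intro mean_cong) (simp add: rhodot_def scaleR_conv_of_real algebra_simps)
  finally have *: "2 * m + e1 s = - mean (\<lambda>k. rhodot s k *\<^sub>R fst s k + rho s k *\<^sub>R zdot s k)"
    unfolding mean_minus .
  have "w s = 2 * m + (2 - \<i> * A) * U s" unfolding w_def m_def ..
  then show ?thesis unfolding Udot_def *[symmetric] by (simp add: algebra_simps)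
qed

lemma complex_decomp: "(norm z)\<^sup>2 *\<^sub>R c = (z \<bullet> c) *\<^sub>R z + ((\<i> * z) \<bullet> c) *\<^sub>R (\<i> * z)" for z c :: complex
  by (simp add: complex_eq_iff inner_complex_def cmod_power2) (simp add: power2_eq_square algebra_simps)

text \<open>Differentiating the mean of \<open>perp\<close> against \<open>z\<close> brings in the
  mean of \<open>par\<close> against \<open>z\<close>. This is no new unknown: expanding each
  \<open>d\<close> in the orthogonal frame \<open>z\<close>, \<open>\<i> * z\<close> expresses it by
  the drift and the mean of \<open>perp\<close> against \<open>z\<close>, up to second order.
  Eliminating both means in favour of \<open>U\<close> and \<open>w\<close> closes the
  system.\<close>

lemma wdot_alt:
  "wdot s = 2 * mean (\<lambda>k. (rhodot s k - A * perpdot s k) *\<^sub>R fst s k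
     + (rho s k - A * perp s k) *\<^sub>R zdot s k) + (2 - \<i> * A) * Udot s"
proof -
  define a where "a = mean (\<lambda>k. rho s k *\<^sub>R fst s k)"
  define c where "c = mean (\<lambda>k. perp s k *\<^sub>R fst s k)"
  define adot where "adot = mean (\<lambda>k. rhodot s k *\<^sub>R fst s k + rho s k *\<^sub>R zdot s k)"
  define cdot where "cdot = mean (\<lambda>k. perpdot s k *\<^sub>R fst s k + perp s k *\<^sub>R zdot s k)"
  have w: "w s = 2 * (a - A * c) + (2 - \<i> * A) * U s"
    unfolding w_def a_def c_def scaleR_left_diff_distrib mean_diff scaleR_scaleR[symmetric] mean_scaleR
    by (simp add: scaleR_conv_of_real)
  have U: "U s = - a - \<i> * A * drift s" by (simp add: U_def a_def)
  have adot: "adot = - Udot s - \<i> * A * U s" using Udot_alt[of s] by (simp add: adot_def)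
  have rhs: "mean (\<lambda>k. (rhodot s k - A * perpdot s k) *\<^sub>R fst s k
     + (rho s k - A * perp s k) *\<^sub>R zdot s k) = adot - A * cdot"
    unfolding adot_def cdot_def mean_mult[symmetric] mean_diff[symmetric]
    by (intro mean_cong) (simp add: scaleR_conv_of_real algebra_simps)
  have dec: "par s k *\<^sub>R fst s k = snd s k + rho s k *\<^sub>R snd s k - \<i> * (perp s k *\<^sub>R fst s k)" for k
    using complex_decomp[of "fst s k" "snd s k"]
    by (simp add: par_def perp_def rho_def scaleR_conv_of_real algebra_simps)
  have parz: "mean (\<lambda>k. par s k *\<^sub>R fst s k) = drift s + mean (\<lambda>k. rho s k *\<^sub>R snd s k) - \<i> * c"
    unfolding dec mean_diff mean_add mean_mult c_def drift_def ..
  have "cdot = mean (\<lambda>k. (-2 * A) *\<^sub>R (par s k *\<^sub>R fst s k) + A *\<^sub>R (X s k *\<^sub>R fst s k)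
      + (A * (norm (snd s k))\<^sup>2 - rho s k * perp s k) *\<^sub>R fst s k + perp s k *\<^sub>R zdot s k)"
    unfolding cdot_def by (intro mean_cong) (simp add: perpdot_def scaleR_conv_of_real algebra_simps)
  also have "\<dots> = (-2 * A) *\<^sub>R (drift s + mean (\<lambda>k. rho s k *\<^sub>R snd s k) - \<i> * c)
      + A *\<^sub>R mean (\<lambda>k. X s k *\<^sub>R fst s k)
      + mean (\<lambda>k. (A * (norm (snd s k))\<^sup>2 - rho s k * perp s k) *\<^sub>R fst s k)
      + mean (\<lambda>k. perp s k *\<^sub>R zdot s k)"
    by (simp only: mean_add mean_scaleR parz)
  finally have cdot: "cdot = \<dots>" .
  define m1 m2 m3 m4 where "m1 = mean (\<lambda>k. rho s k *\<^sub>R snd s k)"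
    and "m2 = mean (\<lambda>k. X s k *\<^sub>R fst s k)"
    and "m3 = mean (\<lambda>k. (A * (norm (snd s k))\<^sup>2 - rho s k * perp s k) *\<^sub>R fst s k)"
    and "m4 = mean (\<lambda>k. perp s k *\<^sub>R zdot s k)"
  have e4: "e4 s = (4 * A\<^sup>2) *\<^sub>R m1 - (2 * A) *\<^sub>R m3 - (2 * A) *\<^sub>R m4 - \<i> * A * e1 s"
    unfolding e4_def m1_def m3_def m4_def ..
  have wd: "wdot s = \<i> * A * w s - (2 * A\<^sup>2) *\<^sub>R U s - (2 * A\<^sup>2) *\<^sub>R m2 + e4 s"
    unfolding wdot_def m2_def ..
  have ud: "Udot s = w s - 2 * U s + e1 s" by (simp add: Udot_def)
  define rs where "rs = 2 * (adot - A * cdot) + (2 - \<i> * A) * Udot s"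
  have cd: "cdot = (-2 * A) *\<^sub>R (drift s + m1 - \<i> * c) + A *\<^sub>R m2 + m3 + m4"
    unfolding cdot m1_def m2_def m3_def m4_def ..
  have "rs = wdot s"
    unfolding rs_def adot wd e4 cd ud w U
    by (simp add: scaleR_conv_of_real algebra_simps power2_eq_square)
  then show ?thesis unfolding rhs rs_def by simp
qed

section \<open>Size, dissipation, and orders of magnitude near the equilibria\<close>

definition dev :: "config \<Rightarrow> real" where
  "dev s = mean (\<lambda>k. (sg s k)\<^sup>2 + (par s k)\<^sup>2 + (tau s k)\<^sup>2)"
definition msX :: "config \<Rightarrow> real" where "msX s = mean (\<lambda>k. (X s k)\<^sup>2)"
text \<open>\<open>N\<close> measures the distance from the equilibria, \<open>G\<close> the square
  root of the dissipation rate. They share \<open>dev\<close>; of the drift, \<open>G\<close>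
  retains only the components along the \<open>z\<close> and the speed \<open>U\<close>, both of
  which can be small for a drift orthogonal to a collinear configuration.\<close>

definition N :: "config \<Rightarrow> real" where "N s = sqrt ((norm (drift s))\<^sup>2 + dev s)"
definition G :: "config \<Rightarrow> real" where "G s = sqrt ((norm (U s))\<^sup>2 + msX s + dev s)"
text \<open>A neighbourhood of all equilibria at once, with no reference to angles, so constants
  valid on it are uniform in the rotating state. The bound \<open>1/4\<close> keeps the squared
  lengths of the \<open>z\<close> between \<open>3/4\<close> and \<open>5/4\<close>: the lower value
  permits division, the upper one is small enough for \<open>V\<close> to stay coercive.\<close>

definition near :: "config set" where
  "near = {s. mean (fst s) = mean (snd s) \<and>
     (\<forall>k\<in>{1..n}. \<bar>rho s k\<bar> \<le> 1/4 \<and> norm (snd s k) \<le> 1/4)}"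

lemma dev_nonneg: "0 \<le> dev s"
  unfolding dev_def by (intro mean_nonneg) auto

lemma msX_nonneg: "0 \<le> msX s"
  unfolding msX_def by (intro mean_nonneg) auto

lemma N_nonneg: "0 \<le> N s" and G_nonneg: "0 \<le> G s"
  by (simp_all add: N_def G_def dev_nonneg msX_nonneg)

lemma N_sq: "(N s)\<^sup>2 = (norm (drift s))\<^sup>2 + dev s"
  and G_sq: "(G s)\<^sup>2 = (norm (U s))\<^sup>2 + msX s + dev s"
  by (simp_all add: N_def G_def dev_nonneg msX_nonneg)

text \<open>One term of a mean of nonnegative terms is at most \<open>n\<close> times the mean,
  whence the constant \<open>sqrt n\<close>.\<close>

lemma dominated_of_mean_sq:
  assumes k: "k \<in> {1..n}" and le: "\<And>s. mean (\<lambda>j. (f s j)\<^sup>2) \<le> (h s)\<^sup>2" and h: "\<And>s. 0 \<le> h s"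
  shows "dominated S (\<lambda>s. f s k :: real) h"
proof (rule dominatedI[where C = "sqrt n"])
  fix s
  have "(f s k)\<^sup>2 \<le> real n * mean (\<lambda>j. (f s j)\<^sup>2)"
    using le_mean[OF k, of "\<lambda>j. (f s j)\<^sup>2"] by simp
  also have "\<dots> \<le> real n * (h s)\<^sup>2" by (intro mult_left_mono le) auto
  also have "\<dots> = (sqrt n * h s)\<^sup>2" by (simp add: power_mult_distrib)
  finally show "norm (f s k) \<le> sqrt n * h s"
    using h[of s] by (simp add: abs_le_square_iff[symmetric])
qed (use h in auto)

lemma mean_sq_le_dev:
  "mean (\<lambda>k. (sg s k)\<^sup>2) \<le> dev s" "mean (\<lambda>k. (par s k)\<^sup>2) \<le> dev s" "mean (\<lambda>k. (tau s k)\<^sup>2) \<le> dev s"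
  unfolding dev_def by (intro mean_mono; simp)+

lemma dev_le: "dev s \<le> (N s)\<^sup>2" "dev s \<le> (G s)\<^sup>2"
  by (auto simp: N_sq G_sq msX_nonneg)

lemma dom_dev:
  assumes "k \<in> {1..n}"
  shows "dominated S (\<lambda>s. sg s k) N" "dominated S (\<lambda>s. par s k) N" "dominated S (\<lambda>s. tau s k) N"
    and "dominated S (\<lambda>s. sg s k) G" "dominated S (\<lambda>s. par s k) G" "dominated S (\<lambda>s. tau s k) G"
  by (rule dominated_of_mean_sq[OF assms], rule order_trans[OF mean_sq_le_dev(1) dev_le(1)], rule N_nonneg)
    (rule dominated_of_mean_sq[OF assms], rule order_trans[OF mean_sq_le_dev(2) dev_le(1)], rule N_nonneg,
    rule dominated_of_mean_sq[OF assms], rule order_trans[OF mean_sq_le_dev(3) dev_le(1)], rule N_nonneg,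
    rule dominated_of_mean_sq[OF assms], rule order_trans[OF mean_sq_le_dev(1) dev_le(2)], rule G_nonneg,
    rule dominated_of_mean_sq[OF assms], rule order_trans[OF mean_sq_le_dev(2) dev_le(2)], rule G_nonneg,
    rule dominated_of_mean_sq[OF assms], rule order_trans[OF mean_sq_le_dev(3) dev_le(2)], rule G_nonneg)

lemma dom_X_G: "k \<in> {1..n} \<Longrightarrow> dominated S (\<lambda>s. X s k) G"
  by (rule dominated_of_mean_sq) (auto simp: G_sq G_nonneg dev_nonneg simp flip: msX_def)

lemma dom_U_G: "dominated S U G"
  by (rule dominatedI[where C = 1])
    (auto intro!: real_le_rsqrt simp: G_def G_nonneg dev_nonneg msX_nonneg)

lemma dom_drift: "dominated S drift N"
  by (rule dominatedI[where C = 1])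
    (auto intro!: real_le_rsqrt simp: N_def N_nonneg dev_nonneg)

lemma near_norm_sq:
  assumes "s \<in> near" "k \<in> {1..n}"
  shows "3/4 \<le> (norm (fst s k))\<^sup>2" "(norm (fst s k))\<^sup>2 \<le> 5/4"
proof -
  have "\<bar>rho s k\<bar> \<le> 1/4" using assms unfolding near_def by blast
  then show "3/4 \<le> (norm (fst s k))\<^sup>2" "(norm (fst s k))\<^sup>2 \<le> 5/4"
    unfolding rho_def by linarith+
qed

lemma near_norm_le:
  assumes "s \<in> near" "k \<in> {1..n}"
  shows "norm (fst s k) \<le> 2"
proof (rule power2_le_imp_le)
  show "(norm (fst s k))\<^sup>2 \<le> 2\<^sup>2" using near_norm_sq(2)[OF assms] by simp
qed simp

lemma dom_z: "k \<in> {1..n} \<Longrightarrow> dominated near (\<lambda>s. fst s k) (\<lambda>s. 1)"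
  by (rule dominatedI[where C = 2]) (auto intro: near_norm_le)

lemma dom_near_X: "k \<in> {1..n} \<Longrightarrow> dominated near (\<lambda>s. X s k) N"
  unfolding X_def by (intro dominated_inner1 dom_z dom_drift)

lemma dom_Y: "k \<in> {1..n} \<Longrightarrow> dominated near (\<lambda>s. Y s k) N"
  unfolding Y_def by (intro dominated_inner1 dominated_ii dom_z dom_drift)

lemma dom_rho:
  assumes "k \<in> {1..n}" shows "dominated near (\<lambda>s. rho s k) N"
proof -
  have "dominated near (\<lambda>s. sg s k + A * Y s k) N"
    by (intro dominated_add dominated_cmult dom_dev dom_Y assms)
  then show ?thesis by (simp add: sg_def)
qed

lemma dom_perp:
  assumes "k \<in> {1..n}" shows "dominated near (\<lambda>s. perp s k) N"
proof -
  have "dominated near (\<lambda>s. tau s k + Y s k) N"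
    by (intro dominated_add dom_dev dom_Y assms)
  then show ?thesis by (simp add: tau_def)
qed

text \<open>The components of \<open>d\<close> along \<open>z\<close> and \<open>\<i> * z\<close>
  are of order \<open>N\<close>; since the squared length of \<open>z\<close> is at least
  \<open>3/4\<close>, they determine \<open>d\<close> with a uniform constant.\<close>

lemma dom_d:
  assumes k: "k \<in> {1..n}" shows "dominated near (\<lambda>s. snd s k) N"
proof -
  have "dominated near (\<lambda>s. par s k *\<^sub>R fst s k + perp s k *\<^sub>R (\<i> * fst s k)) N"
    by (intro dominated_add dominated_scaleR1 dominated_ii dom_z dom_dev dom_perp k)
  then have "dominated near (\<lambda>s. (norm (fst s k))\<^sup>2 *\<^sub>R snd s k) N"
    unfolding complex_decomp par_def perp_def .
  then obtain C where C: "C \<ge> 0" "\<And>s. s \<in> near \<Longrightarrow> norm ((norm (fst s k))\<^sup>2 *\<^sub>R snd s k) \<le> C * N s"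
    unfolding dominated_def by blast
  show ?thesis
  proof (rule dominatedI[where C = "4/3 * C"])
    fix s assume s: "s \<in> near"
    have "3/4 * norm (snd s k) \<le> (norm (fst s k))\<^sup>2 * norm (snd s k)"
      by (intro mult_right_mono near_norm_sq s k) auto
    also have "\<dots> \<le> C * N s" using C(2)[OF s] by simp
    finally show "norm (snd s k) \<le> 4/3 * C * N s" by simp
  qed (rule N_nonneg)
qed

lemma dom_U: "dominated near U N"
proof -
  have "dominated near (\<lambda>s. - mean (\<lambda>k. rho s k *\<^sub>R fst s k) - \<i> * A * drift s) N"
    by (intro dominated_diff dominated_minus dominated_mean dominated_scaleR1 dominated_cmult
        dom_rho dom_z dom_drift)
  then show ?thesis by (simp add: U_def[abs_def])
qed

lemma dom_G: "dominated near G N"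
proof -
  have 1: "dominated near (\<lambda>s. (norm (U s))\<^sup>2) (\<lambda>s. N s * N s)"
    using dominated_inner[OF dom_U dom_U] by (simp add: dot_square_norm)
  have 2: "dominated near (\<lambda>s. msX s + dev s) (\<lambda>s. N s * N s)"
    unfolding msX_def dev_def power2_eq_square
    by (intro dominated_add dominated_mean dominated_mult dom_near_X dom_dev)
  have "dominated near (\<lambda>s. sqrt ((norm (U s))\<^sup>2 + (msX s + dev s))) N"
    by (intro dominated_sqrt dominated_add 1 2 N_nonneg)
  then show ?thesis by (simp add: G_def[abs_def] add.assoc)
qed

text \<open>In \<open>rho - A * perp\<close> the terms in \<open>Y\<close> cancel and leave
  \<open>sg - A * tau\<close>. Hence \<open>w\<close> is of order \<open>G\<close> and not merely
  \<open>N\<close>, which supplies the dissipated factor in its product with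
  \<open>e4\<close>.\<close>

lemma dom_w: "dominated near w G"
proof -
  have *: "rho s k - A * perp s k = sg s k - A * tau s k" for s k
    by (simp add: sg_def tau_def algebra_simps)
  have "dominated near (\<lambda>s. 2 * mean (\<lambda>k. (sg s k - A * tau s k) *\<^sub>R fst s k) + (2 - \<i> * A) * U s) G"
    by (intro dominated_add dominated_cmult dominated_mean dominated_scaleR1 dominated_diff
        dom_dev dom_z dom_U_G)
  then show ?thesis by (simp add: w_def[abs_def] *)
qed

lemma dom_zdot: "k \<in> {1..n} \<Longrightarrow> dominated near (\<lambda>s. zdot s k) N"
  unfolding zdot_def
  by (intro dominated_diff dominated_minus dominated_scaleR1 dominated_cmult dom_rho dom_z dom_d)

text \<open>The slaved values \<open>sg = tau = 0\<close> cancel the first-order part of \<^const>\<open>zdot\<close> in the radial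
  direction; only the tangential forcing survives, and it is dissipated.\<close>

lemma dom_zdot_G:
  assumes k: "k \<in> {1..n}"
  shows "dominated near (\<lambda>s. zdot s k) (\<lambda>s. G s + N s * N s)"
proof -
  have rad: "fst s k \<bullet> zdot s k = - sg s k + A * tau s k - (rho s k)\<^sup>2" for s
  proof -
    have "fst s k \<bullet> zdot s k = - rho s k * (norm (fst s k))\<^sup>2 + A * perp s k"
      by (simp add: zdot_def perp_def inner_complex_def cmod_power2) (simp add: algebra_simps power2_eq_square)
    then show ?thesis by (simp add: rho_def sg_def tau_def algebra_simps power2_eq_square)
  qed
  have tan: "(\<i> * fst s k) \<bullet> zdot s k = - A * par s k" for s
    by (simp add: zdot_def par_def inner_complex_def algebra_simps)
  have le: "dominated near f (\<lambda>s. G s + N s * N s)" if "dominated near f G" for f :: "config \<Rightarrow> real"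
    using that by (rule dominated_le) simp
  have le': "dominated near f (\<lambda>s. G s + N s * N s)" if "dominated near f (\<lambda>s. N s * N s)" for f :: "config \<Rightarrow> real"
    using that by (rule dominated_le) (simp add: G_nonneg)
  have "dominated near (\<lambda>s. (- sg s k + A * tau s k - rho s k * rho s k) *\<^sub>R fst s k
      + (- A * par s k) *\<^sub>R (\<i> * fst s k)) (\<lambda>s. G s + N s * N s)"
    by (intro dominated_add dominated_diff dominated_scaleR1 dominated_cmult dominated_ii dominated_minus
        le[OF dom_dev(4)] le[OF dom_dev(5)] le[OF dom_dev(6)] le'[OF dominated_mult] dom_rho dom_z k)
  then have "dominated near (\<lambda>s. (norm (fst s k))\<^sup>2 *\<^sub>R zdot s k) (\<lambda>s. G s + N s * N s)"
    unfolding complex_decomp rad tan unfolding power2_eq_square .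
  then obtain C where C: "C \<ge> 0"
    "\<And>s. s \<in> near \<Longrightarrow> norm ((norm (fst s k))\<^sup>2 *\<^sub>R zdot s k) \<le> C * (G s + N s * N s)"
    unfolding dominated_def by blast
  show ?thesis
  proof (rule dominatedI[where C = "4/3 * C"])
    fix s assume s: "s \<in> near"
    have "3/4 * norm (zdot s k) \<le> (norm (fst s k))\<^sup>2 * norm (zdot s k)"
      by (intro mult_right_mono near_norm_sq s k) auto
    also have "\<dots> \<le> C * (G s + N s * N s)" using C(2)[OF s] by simp
    finally show "norm (zdot s k) \<le> 4/3 * C * (G s + N s * N s)" by simp
  qed (simp add: G_nonneg N_nonneg)
qed

lemma dom_e1: "dominated near e1 (\<lambda>s. N s * N s)"
proof -
  have "dominated near (\<lambda>s. mean (\<lambda>k. (2 * (rho s k * rho s k)) *\<^sub>R fst s k - rho s k *\<^sub>R zdot s k)) (\<lambda>s. N s * N s)"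
    by (intro dominated_mean dominated_diff dominated_scaleR1 dominated_cmult dominated_mult
        dominated_scaleR dom_rho dom_z dom_zdot)
  then show ?thesis by (simp add: e1_def[abs_def] power2_eq_square)
qed

lemma dom_quad:
  assumes k: "k \<in> {1..n}"
  shows "dominated near (\<lambda>s. A * (norm (snd s k))\<^sup>2 - rho s k * perp s k) (\<lambda>s. N s * N s)"
  unfolding dot_square_norm[symmetric]
  by (intro dominated_diff dominated_cmult dominated_inner dominated_mult dom_d dom_rho dom_perp k)

lemma dom_e4: "dominated near e4 (\<lambda>s. N s * N s)"
  unfolding e4_def[abs_def]
  by (intro dominated_diff dominated_cscaleR dominated_cmult dominated_mean dom_e1)
    (intro dominated_scaleR1 dominated_scaleR dom_rho dom_d dom_z dom_quad dom_perp dom_zdot; assumption)+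

subsection \<open>The Lyapunov function\<close>

definition V :: "config \<Rightarrow> real" where
  "V s = (norm (w s))\<^sup>2 / 2 + A\<^sup>2 * (norm (U s))\<^sup>2
     + 2 * A\<^sup>2 * mean (\<lambda>k. (X s k)\<^sup>2 + X s k * (fst s k \<bullet> U s))"
definition Vdot :: "config \<Rightarrow> real" where
  "Vdot s = w s \<bullet> wdot s + 2 * A\<^sup>2 * (U s \<bullet> Udot s)
     + 2 * A\<^sup>2 * mean (\<lambda>k. 2 * X s k * Xdot s k + Xdot s k * (fst s k \<bullet> U s)
         + X s k * (zdot s k \<bullet> U s + fst s k \<bullet> Udot s))"
text \<open>\<open>V\<close> bounds \<open>w\<close>, \<open>U\<close> and \<open>msX\<close> but
  not the drift itself, and its derivative dissipates only \<open>U\<close>. \<open>W\<close> adds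
  coercivity in the drift, and its derivative supplies the missing dissipation of
  \<open>msX\<close>.\<close>

definition W :: "config \<Rightarrow> real" where
  "W s = drift s \<bullet> (w s - \<i> * A * U s) + A\<^sup>2 * (norm (drift s))\<^sup>2 - 2 * A * mean (\<lambda>k. X s k * Y s k)"
definition Wdot :: "config \<Rightarrow> real" where
  "Wdot s = U s \<bullet> (w s - \<i> * A * U s) + drift s \<bullet> (wdot s - \<i> * A * Udot s)
     + 2 * A\<^sup>2 * (drift s \<bullet> U s) - 2 * A * mean (\<lambda>k. Xdot s k * Y s k + X s k * Ydot s k)"
text \<open>A single value meeting the three conditions of \<open>mu_le\<close>: \<open>9\<close>
  and \<open>16 * A\<^sup>2\<close> come from the two cross terms in the derivative of
  \<open>F\<close>, and the bound \<open>1/24\<close> needed for the coercivity of \<open>F\<close>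
  follows from them.\<close>

definition mu :: real where "mu = A / (9 + 16 * A\<^sup>2)"
definition sgdot :: "config \<Rightarrow> nat \<Rightarrow> real" where "sgdot s k = rhodot s k - A * Ydot s k"
definition taudot :: "config \<Rightarrow> nat \<Rightarrow> real" where "taudot s k = perpdot s k - Ydot s k"
text \<open>With \<open>X\<close> and \<open>U\<close> set to 0 the linear equations of one particle
  are \<open>sg' = - 2 * sg + 2 * A * tau\<close>, \<open>par' = - sg + 2 * A * tau\<close>,
  \<open>tau' = - 2 * A * par\<close>. Along them the first half of \<open>F\<close> has derivative
  \<open>- sg\<^sup>2\<close>, which leaves \<open>par\<close> and \<open>tau\<close> undamped; the
  \<open>mu\<close> term contributes \<open>- 2 * A * mu * (par\<^sup>2 + tau\<^sup>2)\<close> and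
  cross terms with \<open>sg\<close>.\<close>

definition F :: "config \<Rightarrow> nat \<Rightarrow> real" where
  "F s k = ((par s k)\<^sup>2 + (tau s k)\<^sup>2 + (par s k - sg s k)\<^sup>2) / 2 + mu * ((par s k - 2 * sg s k) * tau s k)"
definition Fdot :: "config \<Rightarrow> nat \<Rightarrow> real" where
  "Fdot s k = par s k * pardot s k + tau s k * taudot s k + (par s k - sg s k) * (pardot s k - sgdot s k)
     + mu * ((pardot s k - 2 * sgdot s k) * tau s k + (par s k - 2 * sg s k) * taudot s k)"

definition err :: "config \<Rightarrow> real" where
  "err s = G s * (N s * N s) + (N s * N s) * (N s * N s)"

lemma dom_err1: "dominated S f (\<lambda>s. G s * (N s * N s)) \<Longrightarrow> dominated S f err"
  by (erule dominated_le) (simp add: err_def N_nonneg)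

lemma dom_err2: "dominated S f (\<lambda>s. (N s * N s) * (N s * N s)) \<Longrightarrow> dominated S f err"
  by (erule dominated_le) (simp add: err_def N_nonneg G_nonneg)

lemma dom_err3: "dominated S f (\<lambda>s. (G s + N s * N s) * (N s * N s)) \<Longrightarrow> dominated S f err"
  by (erule dominated_le) (simp add: err_def distrib_right)

text \<open>The weights in \<open>V\<close> are such that the products of \<open>w\<close> with
  \<open>U\<close> and with the mean of \<open>X\<close> times \<open>z\<close> cancel between its
  summands; the products \<open>X * (z \<bullet> U)\<close> cancel between the derivatives of its
  two \<open>X\<close> terms. Besides the remainder only terms quadratic in \<open>U\<close>
  survive.\<close>

lemma Vdot_eq:
  "Vdot s = - 4 * A\<^sup>2 * (norm (U s))\<^sup>2 + 2 * A\<^sup>2 * mean (\<lambda>k. (fst s k \<bullet> U s)\<^sup>2)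
    + (w s \<bullet> e4 s + 2 * A\<^sup>2 * (U s \<bullet> e1 s)
      + 2 * A\<^sup>2 * mean (\<lambda>k. 2 * X s k * (zdot s k \<bullet> drift s) + (fst s k \<bullet> U s) * (zdot s k \<bullet> drift s)
          + X s k * (zdot s k \<bullet> U s) + X s k * (fst s k \<bullet> e1 s)))"
proof -
  define er where "er = mean (\<lambda>k. 2 * X s k * (zdot s k \<bullet> drift s) + (fst s k \<bullet> U s) * (zdot s k \<bullet> drift s)
          + X s k * (zdot s k \<bullet> U s) + X s k * (fst s k \<bullet> e1 s))"
  define m where "m = mean (\<lambda>k. X s k *\<^sub>R fst s k)"
  have zU: "fst s k \<bullet> Udot s = fst s k \<bullet> w s - 2 * (fst s k \<bullet> U s) + fst s k \<bullet> e1 s" for k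
    unfolding Udot_def by (simp add: inner_complex_def algebra_simps)
  have "mean (\<lambda>k. 2 * X s k * Xdot s k + Xdot s k * (fst s k \<bullet> U s)
         + X s k * (zdot s k \<bullet> U s + fst s k \<bullet> Udot s))
      = mean (\<lambda>k. (2 * X s k * (zdot s k \<bullet> drift s) + (fst s k \<bullet> U s) * (zdot s k \<bullet> drift s)
          + X s k * (zdot s k \<bullet> U s) + X s k * (fst s k \<bullet> e1 s)) + (fst s k \<bullet> U s)\<^sup>2 + (X s k *\<^sub>R fst s k) \<bullet> w s)"
    unfolding zU Xdot_def by (intro mean_cong) (simp add: power2_eq_square algebra_simps)
  also have "\<dots> = er + mean (\<lambda>k. (fst s k \<bullet> U s)\<^sup>2) + m \<bullet> w s"
    unfolding mean_add[where g = "\<lambda>k. (X s k *\<^sub>R fst s k) \<bullet> w s"] mean_add[where g = "\<lambda>k. (fst s k \<bullet> U s)\<^sup>2"]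
      mean_inner er_def m_def ..
  finally have mm: "mean (\<lambda>k. 2 * X s k * Xdot s k + Xdot s k * (fst s k \<bullet> U s)
         + X s k * (zdot s k \<bullet> U s + fst s k \<bullet> Udot s)) = er + mean (\<lambda>k. (fst s k \<bullet> U s)\<^sup>2) + m \<bullet> w s" .
  have 1: "w s \<bullet> wdot s = - 2 * A\<^sup>2 * (w s \<bullet> U s) - 2 * A\<^sup>2 * (w s \<bullet> m) + w s \<bullet> e4 s"
    unfolding wdot_def m_def[symmetric]
    by (simp add: inner_complex_def algebra_simps)
  have 2: "U s \<bullet> Udot s = U s \<bullet> w s - 2 * (norm (U s))\<^sup>2 + U s \<bullet> e1 s"
    unfolding Udot_def dot_square_norm[symmetric] by (simp add: inner_complex_def algebra_simps)
  show ?thesis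
    unfolding Vdot_def mm er_def[symmetric] 1 2
    by (simp add: inner_commute algebra_simps)
qed

text \<open>Each summand pairs one factor of order \<open>G\<close>, namely \<open>w\<close>,
  \<open>U\<close> or \<open>X\<close>, with a factor of order \<open>N\<^sup>2\<close>.\<close>

lemma Vdot_err:
  "dominated near (\<lambda>s. w s \<bullet> e4 s + 2 * A\<^sup>2 * (U s \<bullet> e1 s)
      + 2 * A\<^sup>2 * mean (\<lambda>k. 2 * X s k * (zdot s k \<bullet> drift s) + (fst s k \<bullet> U s) * (zdot s k \<bullet> drift s)
          + X s k * (zdot s k \<bullet> U s) + X s k * (fst s k \<bullet> e1 s))) err"
  by (rule dom_err1)
    (intro dominated_add dominated_cmult dominated_mean dominated_mult[where h = G and k = "\<lambda>s. N s * N s"]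
      dominated_inner[OF dom_w dom_e4] dominated_inner[OF dom_U_G dom_e1]
      dom_X_G dominated_inner[OF dom_zdot dom_drift] dominated_inner1[OF dom_z dom_U_G]
      dominated_inner[OF dom_zdot dom_U] dominated_inner1[OF dom_z dom_e1]; assumption)

text \<open>Products of the drift with \<open>U\<close> or \<open>w\<close> are not controlled by
  \<open>G\<^sup>2\<close> and have to cancel. The term \<open>- \<i> * A * U\<close> in
  \<open>W\<close> removes the product with \<open>w\<close>, the squared drift removes
  \<open>drift \<bullet> U\<close>, and the mean of \<open>X * Y\<close> removes
  \<open>drift \<bullet> (\<i> * U)\<close>: the two halves of its derivative differ by this
  quantity, because \<open>z\<close> and \<open>\<i> * z\<close> form an orthogonal frame of squared
  length \<open>1 + rho\<close>.\<close>

lemma Wdot_eq: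
  assumes s: "s \<in> near"
  shows "Wdot s = U s \<bullet> w s - 2 * A\<^sup>2 * msX s - 4 * A * mean (\<lambda>k. X s k * ((\<i> * fst s k) \<bullet> U s))
    + (drift s \<bullet> (e4 s - \<i> * A * e1 s) - 2 * A * (mean (rho s) * (drift s \<bullet> (\<i> * U s)))
      - 2 * A * mean (\<lambda>k. (zdot s k \<bullet> drift s) * Y s k + X s k * ((\<i> * zdot s k) \<bullet> drift s)))"
proof -
  define er where "er = mean (\<lambda>k. (zdot s k \<bullet> drift s) * Y s k + X s k * ((\<i> * zdot s k) \<bullet> drift s))"
  define m where "m = mean (\<lambda>k. X s k *\<^sub>R fst s k)"
  define xu where "xu = mean (\<lambda>k. X s k * ((\<i> * fst s k) \<bullet> U s))"
  define yu where "yu = mean (\<lambda>k. (fst s k \<bullet> U s) * Y s k)"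
  have m: "drift s \<bullet> m = msX s"
    unfolding m_def msX_def mean_inner_right[symmetric]
    by (intro mean_cong) (simp add: X_def inner_commute power2_eq_square)
  have "mean (\<lambda>k. Xdot s k * Y s k + X s k * Ydot s k)
    = mean (\<lambda>k. ((zdot s k \<bullet> drift s) * Y s k + X s k * ((\<i> * zdot s k) \<bullet> drift s))
      + (fst s k \<bullet> U s) * Y s k + X s k * ((\<i> * fst s k) \<bullet> U s))"
    by (intro mean_cong) (simp add: Xdot_def Ydot_def algebra_simps)
  then have 1: "mean (\<lambda>k. Xdot s k * Y s k + X s k * Ydot s k) = er + yu + xu"
    unfolding er_def xu_def yu_def mean_add by simp
  have "mean (\<lambda>k. (fst s k \<bullet> U s) * Y s k - X s k * ((\<i> * fst s k) \<bullet> U s))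
      = mean (\<lambda>k. drift s \<bullet> (\<i> * U s) + rho s k * (drift s \<bullet> (\<i> * U s)))"
    by (intro mean_cong)
      (simp add: X_def Y_def rho_def inner_complex_def cmod_power2, simp add: algebra_simps power2_eq_square)
  then have 2: "yu - xu = drift s \<bullet> (\<i> * U s) + mean (rho s) * (drift s \<bullet> (\<i> * U s))"
    unfolding mean_diff mean_add mean_mult_right mean_const yu_def xu_def .
  have "drift s \<bullet> (wdot s - \<i> * A * Udot s) = - 2 * A\<^sup>2 * (drift s \<bullet> U s) - 2 * A\<^sup>2 * (drift s \<bullet> m)
      + 2 * A * (drift s \<bullet> (\<i> * U s)) + drift s \<bullet> (e4 s - \<i> * A * e1 s)"
    unfolding wdot_def Udot_def m_def[symmetric] by (simp add: inner_complex_def algebra_simps)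
  moreover have "U s \<bullet> (w s - \<i> * A * U s) = U s \<bullet> w s"
    by (simp add: inner_complex_def algebra_simps)
  ultimately show ?thesis
    unfolding Wdot_def 1 er_def[symmetric] xu_def[symmetric] using m 2 by (simp add: algebra_simps)
qed

text \<open>The two contributions that are cubic in \<^const>\<open>Y\<close> cancel to leading order; all other terms carry a
  dissipated factor.\<close>

lemma drift_e4:
  "drift s \<bullet> (e4 s - \<i> * A * e1 s)
   = 4 * A * mean (\<lambda>k. rho s k * (A * (X s k * par s k) + A * (Y s k * tau s k) - Y s k * sg s k)
        - A * ((rho s k * rho s k) * (drift s \<bullet> snd s k)))
     - 2 * A * mean (\<lambda>k. X s k * (A * (norm (snd s k))\<^sup>2 - rho s k * perp s k))
     - 2 * A * mean (\<lambda>k. zdot s k \<bullet> drift s * perp s k)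
     + 2 * A * mean (\<lambda>k. ((\<i> * zdot s k) \<bullet> drift s) * rho s k)"
proof -
  have e1: "drift s \<bullet> (\<i> * e1 s) = mean (\<lambda>k. 2 * (rho s k)\<^sup>2 * Y s k - ((\<i> * zdot s k) \<bullet> drift s) * rho s k)"
  proof -
    have "drift s \<bullet> (\<i> * e1 s) = (- \<i> * drift s) \<bullet> e1 s" by (simp add: inner_complex_def algebra_simps)
    also have "\<dots> = mean (\<lambda>k. (- \<i> * drift s) \<bullet> ((2 * (rho s k)\<^sup>2) *\<^sub>R fst s k - rho s k *\<^sub>R zdot s k))"
      unfolding e1_def mean_inner_right ..
    also have "\<dots> = mean (\<lambda>k. 2 * (rho s k)\<^sup>2 * Y s k - ((\<i> * zdot s k) \<bullet> drift s) * rho s k)"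
      by (intro mean_cong) (simp add: Y_def inner_complex_def algebra_simps)
    finally show ?thesis .
  qed
  define m1 where "m1 = mean (\<lambda>k. rho s k *\<^sub>R snd s k)"
  define m2 where "m2 = mean (\<lambda>k. (A * (norm (snd s k))\<^sup>2 - rho s k * perp s k) *\<^sub>R fst s k)"
  define m3 where "m3 = mean (\<lambda>k. perp s k *\<^sub>R zdot s k)"
  have m2: "drift s \<bullet> m2 = mean (\<lambda>k. X s k * (A * (norm (snd s k))\<^sup>2 - rho s k * perp s k))"
    unfolding m2_def mean_inner_right[symmetric] by (intro mean_cong) (simp add: X_def inner_commute)
  have m3: "drift s \<bullet> m3 = mean (\<lambda>k. zdot s k \<bullet> drift s * perp s k)"
    unfolding m3_def mean_inner_right[symmetric] by (intro mean_cong) (simp add: inner_commute)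
  have m1: "drift s \<bullet> m1 = mean (\<lambda>k. rho s k * (drift s \<bullet> snd s k))"
    unfolding m1_def mean_inner_right[symmetric] by (intro mean_cong) simp
  \<comment> \<open>Expanding in the frame \<open>z\<close>, \<open>\<i> * z\<close> and inserting
    \<open>perp = tau + Y\<close> and \<open>A * Y = rho - sg\<close> isolates
    \<open>rho * Y\<close>, the one term without a dissipated or an extra small factor; it cancels
    against the contribution of \<open>e1\<close>.\<close>
  have ptw: "A * (drift s \<bullet> snd s k) = rho s k * Y s k + A * (X s k * par s k) + A * (Y s k * tau s k)
      - Y s k * sg s k - A * (rho s k * (drift s \<bullet> snd s k))" for k
  proof -
    have "X s k * par s k + Y s k * perp s k = (1 + rho s k) * (drift s \<bullet> snd s k)"
      by (simp add: X_def Y_def par_def perp_def rho_def inner_complex_def cmod_power2)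
        (simp add: algebra_simps power2_eq_square)
    then have "A * (X s k * par s k + Y s k * perp s k) = A * ((1 + rho s k) * (drift s \<bullet> snd s k))"
      by simp
    then show ?thesis by (simp add: sg_def tau_def algebra_simps)
  qed
  have "A * (drift s \<bullet> m1) - mean (\<lambda>k. rho s k * (rho s k * Y s k)) =
     mean (\<lambda>k. rho s k * (A * (drift s \<bullet> snd s k)) - rho s k * (rho s k * Y s k))"
    unfolding m1 mean_mult[symmetric] mean_diff by (simp add: mult_ac)
  also have "\<dots> = mean (\<lambda>k. rho s k * (A * (X s k * par s k) + A * (Y s k * tau s k) - Y s k * sg s k)
        - A * ((rho s k * rho s k) * (drift s \<bullet> snd s k)))"
    by (intro mean_cong, subst ptw) (simp add: algebra_simps)
  finally have 1: "A * (drift s \<bullet> m1) - mean (\<lambda>k. rho s k * (rho s k * Y s k)) = \<dots>" .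
  have 2: "mean (\<lambda>k. 2 * (rho s k)\<^sup>2 * Y s k) = 2 * mean (\<lambda>k. rho s k * (rho s k * Y s k))"
    unfolding mean_mult[symmetric] by (simp add: power2_eq_square mult_ac)
  have "drift s \<bullet> (e4 s - \<i> * A * e1 s) = 4 * A\<^sup>2 * (drift s \<bullet> m1) - 2 * A * (drift s \<bullet> m2)
      - 2 * A * (drift s \<bullet> m3) - 2 * A * (drift s \<bullet> (\<i> * e1 s))"
    unfolding e4_def m1_def[symmetric] m2_def[symmetric] m3_def[symmetric]
    by (simp add: inner_complex_def algebra_simps)
  also have "\<dots> = 4 * A * (A * (drift s \<bullet> m1) - mean (\<lambda>k. rho s k * (rho s k * Y s k)))
     - 2 * A * (drift s \<bullet> m2) - 2 * A * (drift s \<bullet> m3)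
     + 2 * A * mean (\<lambda>k. ((\<i> * zdot s k) \<bullet> drift s) * rho s k)"
    unfolding e1 mean_diff 2 by (simp add: algebra_simps power2_eq_square)
  finally show ?thesis unfolding 1 m2 m3 .
qed

text \<open>The bound \<open>N\<close> for \<open>zdot\<close> would only give \<open>N ^ 3\<close>.
  The sharper order \<open>G + N\<^sup>2\<close>, multiplied by two factors of order
  \<open>N\<close>, is exactly \<open>err\<close>.\<close>

lemma inner_drift_zdot:
  assumes "k \<in> {1..n}" "dominated near f N"
  shows "dominated near (\<lambda>s. zdot s k \<bullet> drift s * f s) err"
    and "dominated near (\<lambda>s. (\<i> * zdot s k) \<bullet> drift s * f s) err"
proof -
  have 1: "dominated near (\<lambda>s. zdot s k \<bullet> drift s * f s) (\<lambda>s. (G s + N s * N s) * N s * N s)"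
    "dominated near (\<lambda>s. (\<i> * zdot s k) \<bullet> drift s * f s) (\<lambda>s. (G s + N s * N s) * N s * N s)"
    by (intro dominated_mult dominated_inner dominated_ii dom_zdot_G dom_drift assms)+
  show "dominated near (\<lambda>s. zdot s k \<bullet> drift s * f s) err"
    by (rule dom_err3, rule dominated_le[OF 1(1)]) (simp add: mult_ac)
  show "dominated near (\<lambda>s. (\<i> * zdot s k) \<bullet> drift s * f s) err"
    by (rule dom_err3, rule dominated_le[OF 1(2)]) (simp add: mult_ac)
qed

lemma dom_drift_e4: "dominated near (\<lambda>s. drift s \<bullet> (e4 s - \<i> * A * e1 s)) err"
proof -
  have a: "dominated near (\<lambda>s. rho s k * f s) err" if k: "k \<in> {1..n}" and "dominated near f (\<lambda>s. N s * G s)" for k f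
    using dominated_mult[OF dom_rho[OF k] that(2)] by (intro dom_err1) (simp add: mult_ac)
  have b: "dominated near (\<lambda>s. (rho s k * rho s k) * (drift s \<bullet> snd s k)) err" if k: "k \<in> {1..n}" for k
    by (intro dom_err2 dominated_mult dom_rho dominated_inner dom_drift dom_d k)
  have c: "dominated near (\<lambda>s. X s k * (A * (norm (snd s k))\<^sup>2 - rho s k * perp s k)) err" if k: "k \<in> {1..n}" for k
    by (intro dom_err1 dominated_mult dom_X_G dom_quad k)
  have d: "dominated near (\<lambda>s. X s k * par s k) (\<lambda>s. N s * G s)" if k: "k \<in> {1..n}" for k
    by (intro dominated_mult dom_near_X dom_dev k)
  have e: "dominated near (\<lambda>s. Y s k * tau s k) (\<lambda>s. N s * G s)" if k: "k \<in> {1..n}" for k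
    by (intro dominated_mult dom_Y dom_dev k)
  have f: "dominated near (\<lambda>s. Y s k * sg s k) (\<lambda>s. N s * G s)" if k: "k \<in> {1..n}" for k
    by (intro dominated_mult dom_Y dom_dev k)
  show ?thesis
    unfolding drift_e4
    by (intro dominated_add[where h = err] dominated_diff[where h = err] dominated_cmult[where g = err] dominated_mean
        inner_drift_zdot a b c dom_perp dom_rho; (assumption | intro dominated_add dominated_diff dominated_cmult d e f))
qed

lemma Wdot_err:
  "dominated near (\<lambda>s. drift s \<bullet> (e4 s - \<i> * A * e1 s) - 2 * A * (mean (rho s) * (drift s \<bullet> (\<i> * U s)))
      - 2 * A * mean (\<lambda>k. (zdot s k \<bullet> drift s) * Y s k + X s k * ((\<i> * zdot s k) \<bullet> drift s))) err"
proof -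
  have a: "dominated near (\<lambda>s. X s k * ((\<i> * zdot s k) \<bullet> drift s)) err" if k: "k \<in> {1..n}" for k
    by (intro dom_err1 dominated_mult dom_X_G dominated_inner dominated_ii dom_zdot dom_drift k)
  have b: "dominated near (\<lambda>s. mean (rho s) * (drift s \<bullet> (\<i> * U s))) err"
  proof (intro dom_err1)
    have "dominated near (\<lambda>s. mean (rho s) * (drift s \<bullet> (\<i> * U s))) (\<lambda>s. N s * (N s * G s))"
      by (intro dominated_mult dominated_mean dom_rho dominated_inner dom_drift dominated_ii dom_U_G)
    then show "dominated near (\<lambda>s. mean (rho s) * (drift s \<bullet> (\<i> * U s))) (\<lambda>s. G s * (N s * N s))"
      by (simp add: mult_ac)
  qed
  show ?thesis
    by (intro dominated_add dominated_diff dominated_cmult dominated_mean dom_drift_e4 a b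
        inner_drift_zdot(1) dom_Y; assumption)
qed

text \<open>In terms of \<open>sg\<close>, \<open>par\<close>, \<open>tau\<close> the variable
  \<open>Y\<close> drops out of the linear equations, since it describes their equilibrium; what
  remains is forcing by \<open>X\<close> and \<open>U\<close>. The three \<epsilon> are the
  nonlinear parts of \<open>pardot\<close>, \<open>sgdot\<close> and \<open>taudot\<close>.\<close>

lemma Fdot_eq:
  fixes s k
  defines "\<epsilon>p \<equiv> - rho s k * rho s k - rho s k * par s k"
  defines "\<epsilon>s \<equiv> - 2 * (rho s k * rho s k) - A * ((\<i> * zdot s k) \<bullet> drift s)"
  defines "\<epsilon>t \<equiv> A * (norm (snd s k))\<^sup>2 - rho s k * perp s k - (\<i> * zdot s k) \<bullet> drift s"
  defines "Uy \<equiv> (\<i> * fst s k) \<bullet> U s"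
  shows "Fdot s k = - (sg s k)\<^sup>2 + mu * (3 * sg s k * tau s k + 4 * A * sg s k * par s k)
      - 2 * A * mu * ((par s k)\<^sup>2 + (tau s k)\<^sup>2)
      + (tau s k * (A * X s k - Uy) + (par s k - sg s k) * (A * Uy)
        + mu * (2 * A * Uy * tau s k + (par s k - 2 * sg s k) * (A * X s k - Uy)))
      + (par s k * \<epsilon>p + tau s k * \<epsilon>t + (par s k - sg s k) * (\<epsilon>p - \<epsilon>s)
        + mu * (tau s k * (\<epsilon>p - 2 * \<epsilon>s) + (par s k - 2 * sg s k) * \<epsilon>t))"
proof -
  define y where "y = (\<i> * zdot s k) \<bullet> drift s"
  have Yd: "Ydot s k = y + Uy" by (simp add: Ydot_def y_def Uy_def)
  have r: "rho s k = sg s k + A * Y s k" and q: "perp s k = tau s k + Y s k"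
    by (simp_all add: sg_def tau_def)
  have p: "pardot s k = - sg s k + 2 * A * tau s k + \<epsilon>p"
    unfolding pardot_def \<epsilon>p_def by (simp add: r q algebra_simps power2_eq_square)
  have s: "sgdot s k = - 2 * sg s k + 2 * A * tau s k - A * Uy + \<epsilon>s"
    unfolding sgdot_def rhodot_def \<epsilon>s_def Yd y_def[symmetric] by (simp add: r q algebra_simps power2_eq_square)
  have t: "taudot s k = - 2 * A * par s k + A * X s k - Uy + \<epsilon>t"
    unfolding taudot_def perpdot_def \<epsilon>t_def Yd y_def[symmetric] by (simp add: algebra_simps)
  show ?thesis unfolding Fdot_def p s t by (simp add: algebra_simps power2_eq_square)
qed

subsection \<open>The Lojasiewicz inequality\<close>

text \<open>Nonnegativity of the variance of the absolute values.\<close>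

lemma mean_abs_sq_le: "(mean (\<lambda>k. \<bar>f k\<bar>))\<^sup>2 \<le> mean (\<lambda>k. (f k)\<^sup>2)" for f :: "nat \<Rightarrow> real"
proof -
  define m where "m = mean (\<lambda>k. \<bar>f k\<bar>)"
  have "0 \<le> mean (\<lambda>k. (\<bar>f k\<bar> - m)\<^sup>2)" by (rule mean_nonneg) simp
  also have "\<dots> = mean (\<lambda>k. (f k)\<^sup>2 - (2 * m) * \<bar>f k\<bar> + m\<^sup>2)"
    by (intro mean_cong) (simp add: power2_diff mult_ac)
  also have "\<dots> = mean (\<lambda>k. (f k)\<^sup>2) - 2 * m * m + m\<^sup>2"
    unfolding mean_add mean_diff mean_mult mean_const m_def ..
  finally show ?thesis unfolding m_def[symmetric] by (simp add: power2_eq_square)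
qed

lemma mean_Y: "s \<in> near \<Longrightarrow> mean (Y s) = 0"
proof -
  assume "s \<in> near"
  then have d: "mean (fst s) = drift s" by (simp add: near_def drift_def)
  have "mean (Y s) = mean (\<lambda>k. \<i> * fst s k) \<bullet> drift s"
    unfolding mean_inner[symmetric] by (intro mean_cong) (simp add: Y_def)
  also have "\<dots> = 0" unfolding mean_mult d by (simp add: inner_complex_def)
  finally show ?thesis .
qed

lemma X_sq_Y_sq: "(X s k)\<^sup>2 + (Y s k)\<^sup>2 = (1 + rho s k) * (norm (drift s))\<^sup>2"
  by (simp add: X_def Y_def rho_def inner_complex_def cmod_power2) (simp add: algebra_simps power2_eq_square)

text \<open>If all \<open>z\<^sub>k\<close> were orthogonal to \<open>drift s \<noteq> 0\<close>, equally many would point to either side, because their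
  lengths are close to \<open>1\<close> and they sum to \<open>0\<close> in that direction; but \<open>rho = A * Y\<close> makes those on one side
  longer and those on the other shorter. So the drift is at most of the order of the deviation from this.\<close>

lemma drift_le_noncollinear:
  assumes s: "s \<in> near" and small: "A * norm (drift s) \<le> 1 / real n"
  shows "A * norm (drift s) ^ 3 \<le> 4 * ((norm (drift s))\<^sup>2 * mean (\<lambda>k. \<bar>sg s k\<bar>) + msX s)"
proof (cases "drift s = 0")
  case True
  then show ?thesis by (simp add: msX_nonneg)
next
  case False
  define z where "z = norm (drift s)"
  have z: "z > 0" using False by (simp add: z_def)
  \<comment> \<open>Dividing by \<open>z\<close>, the squared sum of \<open>X\<close> and
    \<open>Y\<close> reads \<open>(Y / z)\<^sup>2 = 1 + rho - (X / z)\<^sup>2\<close>. With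
    \<open>rho = sg + 2 * w0 * (Y / z)\<close>, completing the square in \<open>Y / z\<close> puts
    \<open>t\<close> near \<open>1\<close> or \<open>-1\<close>, while the shift by
    \<open>w0\<close> makes the sum of the \<open>t\<close> equal to \<open>- (real n * w0)\<close>,
    as the \<open>Y\<close> have mean 0.\<close>
  define w0 where "w0 = A * z / 2"
  define t where "t k = Y s k / z - w0" for k
  define e where "e k = \<bar>sg s k\<bar> + (X s k / z)\<^sup>2 + w0\<^sup>2" for k
  have w0: "0 < w0" "w0 \<le> 1 / (2 * real n)"
    using z small A_pos by (simp_all add: w0_def z_def)
  have n1: "real n \<ge> 1" using n_pos by simp
  have "1 / (2 * real n) \<le> 1/2" using n1 by (simp add: field_simps)
  with w0 have w0h: "w0 \<le> 1/2" by linarith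
  have tsq: "(t k)\<^sup>2 = 1 + sg s k - (X s k / z)\<^sup>2 + w0\<^sup>2" for k
  proof -
    have "(Y s k / z)\<^sup>2 = 1 + rho s k - (X s k / z)\<^sup>2"
      using X_sq_Y_sq[of s k] z unfolding z_def[symmetric] by (simp add: field_simps power2_eq_square)
    moreover have "2 * w0 * (Y s k / z) = A * Y s k" using z by (simp add: w0_def)
    ultimately show ?thesis by (simp add: t_def power2_diff sg_def mult_ac)
  qed
  have near1: "\<bar>\<bar>t k\<bar> - 1\<bar> \<le> e k" for k
  proof -
    have "\<bar>\<bar>t k\<bar> - 1\<bar> \<le> \<bar>\<bar>t k\<bar> - 1\<bar> * (\<bar>t k\<bar> + 1)" using mult_left_mono[of 1 "\<bar>t k\<bar> + 1" "\<bar>\<bar>t k\<bar> - 1\<bar>"] by simp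
    also have "\<dots> = \<bar>(t k)\<^sup>2 - 1\<bar>"
    proof -
      have "(\<bar>t k\<bar> - 1) * (\<bar>t k\<bar> + 1) = (t k)\<^sup>2 - 1"
        by (simp add: algebra_simps power2_eq_square)
      then have "\<bar>\<bar>t k\<bar> - 1\<bar> * \<bar>\<bar>t k\<bar> + 1\<bar> = \<bar>(t k)\<^sup>2 - 1\<bar>" unfolding abs_mult[symmetric] by simp
      then show ?thesis by simp
    qed
    also have "\<dots> \<le> e k"
    proof -
      have "0 \<le> (X s k / z)\<^sup>2" "0 \<le> w0\<^sup>2" by simp_all
      then show ?thesis unfolding tsq e_def by linarith
    qed
    finally show ?thesis .
  qed
  have sumt: "sum t {1..n} = - (real n * w0)"
  proof -
    have "(\<Sum>k=1..n. Y s k) = 0" using mean_Y[OF s] n_pos by (simp add: mean_def)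
    then show ?thesis by (simp add: t_def sum_subtractf sum_divide_distrib[symmetric])
  qed
  define q where "q = mean (\<lambda>k. \<bar>sg s k\<bar>) + msX s / z\<^sup>2"
  have sume: "sum e {1..n} = real n * (q + w0\<^sup>2)"
  proof -
    have "mean e = mean (\<lambda>k. \<bar>sg s k\<bar> + (1 / z\<^sup>2) * (X s k)\<^sup>2 + w0\<^sup>2)"
      by (intro mean_cong) (simp add: e_def power_divide)
    also have "\<dots> = q + w0\<^sup>2" unfolding mean_add mean_mult mean_const q_def msX_def by simp
    finally show ?thesis using n1 by (simp add: mean_def field_simps)
  qed
  have w0sq: "w0\<^sup>2 \<le> w0 / 2"
    using mult_left_mono[OF w0h, of w0] w0 by (simp add: power2_eq_square)
  have "w0 \<le> 2 * q"
  proof (cases "real n * w0 + sum e {1..n} < 1")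
    case True
    then have "\<bar>sum t {1..n}\<bar> \<le> sum e {1..n}"
      using near1 w0 sumt by (intro sum_sign_count) auto
    then have "real n * w0 \<le> real n * (q + w0\<^sup>2)" using w0 unfolding sumt sume by simp
    then have "w0 \<le> q + w0\<^sup>2" using n1 by simp
    with w0sq show ?thesis by linarith
  next
    case False
    \<comment> \<open>When counting does not apply, the total error is already large. Since
      \<open>w0\<close> is at most \<open>1 / (2 * real n)\<close> by the smallness of the drift,
      the same inequality \<open>w0 \<le> q + w0\<^sup>2\<close> results.\<close>
    then have "real n * (w0 + q + w0\<^sup>2) \<ge> 1" unfolding sume by (simp add: algebra_simps)
    then have "w0 + q + w0\<^sup>2 \<ge> 1 / real n" using n1 by (simp add: field_simps)
    moreover have "1 / real n = 2 * (1 / (2 * real n))" by simp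
    ultimately show ?thesis using w0 w0sq by linarith
  qed
  then have "z\<^sup>2 * w0 \<le> z\<^sup>2 * (2 * q)" by (intro mult_left_mono) auto
  moreover have "z\<^sup>2 * q = z\<^sup>2 * mean (\<lambda>k. \<bar>sg s k\<bar>) + msX s"
    using z by (simp add: q_def distrib_left)
  ultimately show ?thesis
    unfolding z_def[symmetric] w0_def by (simp add: power2_eq_square power3_eq_cube algebra_simps)
qed

text \<open>If \<open>G\<close> is small compared with the drift, the noncollinearity estimate
  absorbs its \<open>sg\<close> term and bounds the cube of the drift by \<open>G\<^sup>2\<close>.
  Otherwise the drift itself is at most a multiple of \<open>G\<close>, and below 1 the cube is
  smaller than the square. The remaining part \<open>dev\<close> of \<open>N\<close> belongs to
  \<open>G\<close>.\<close>

lemma N_cube_le: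
  obtains C \<eta> where "C > 0" "\<eta> > 0" "\<And>s. s \<in> near \<Longrightarrow> N s \<le> \<eta> \<Longrightarrow> N s ^ 3 \<le> C * (G s)\<^sup>2"
proof -
  define \<eta> where "\<eta> = min 1 (1 / (A * real n))"
  have \<eta>: "\<eta> > 0" "\<eta> \<le> 1" using A_pos n_pos by (simp_all add: \<eta>_def)
  \<comment> \<open>One summand for each of the two cases, which are separated at
    \<open>8 * G s = A * z\<close>.\<close>
  define C1 where "C1 = 8 / A + 64 / A\<^sup>2"
  have "N s ^ 3 \<le> (4 * (C1 + 1)) * (G s)\<^sup>2" if s: "s \<in> near" and N: "N s \<le> \<eta>" for s
  proof -
    define z b where "z = norm (drift s)" and "b = sqrt (dev s)"
    have z0: "z \<ge> 0" and b0: "b \<ge> 0" by (simp_all add: z_def b_def dev_nonneg)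
    have Nsq: "(N s)\<^sup>2 = z\<^sup>2 + b\<^sup>2" by (simp add: N_sq z_def b_def dev_nonneg)
    have zN: "z \<le> N s" and bN: "b \<le> N s"
      by (rule power2_le_imp_le[OF _ N_nonneg], simp add: Nsq)+
    have z1: "z \<le> 1" and b1: "b \<le> 1" using zN bN N \<eta> by linarith+
    have "z \<le> 1 / (A * real n)" using zN N by (simp add: \<eta>_def)
    then have "A * z \<le> 1 / real n" using A_pos n_pos by (simp add: field_simps)
    from drift_le_noncollinear[OF s] this
    have main: "A * z ^ 3 \<le> 4 * (z\<^sup>2 * mean (\<lambda>k. \<bar>sg s k\<bar>) + msX s)" by (simp add: z_def)
    have bG: "b\<^sup>2 \<le> (G s)\<^sup>2" by (simp add: b_def dev_nonneg dev_le)
    have XG: "msX s \<le> (G s)\<^sup>2" by (simp add: G_sq dev_nonneg)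
    have "(mean (\<lambda>k. \<bar>sg s k\<bar>))\<^sup>2 \<le> (G s)\<^sup>2"
      by (rule order_trans[OF mean_abs_sq_le order_trans[OF mean_sq_le_dev(1) dev_le(2)]])
    then have mG: "mean (\<lambda>k. \<bar>sg s k\<bar>) \<le> G s" by (rule power2_le_imp_le[OF _ G_nonneg])
    have zz: "z ^ 3 \<le> C1 * (G s)\<^sup>2"
    proof (cases "8 * G s \<le> A * z")
      case True
      have "z\<^sup>2 * mean (\<lambda>k. \<bar>sg s k\<bar>) \<le> z\<^sup>2 * (A * z / 8)"
        using mG True by (intro mult_left_mono) auto
      then have "A * z ^ 3 \<le> 8 * (G s)\<^sup>2" using main XG by (simp add: power2_eq_square power3_eq_cube algebra_simps)
      then have "z ^ 3 \<le> 8 / A * (G s)\<^sup>2" using A_pos by (simp add: field_simps)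
      also have "\<dots> \<le> C1 * (G s)\<^sup>2" by (intro mult_right_mono) (simp_all add: C1_def)
      finally show ?thesis .
    next
      case False
      then have "(A * z)\<^sup>2 \<le> (8 * G s)\<^sup>2" using A_pos z0 by (intro power_mono) auto
      then have "z\<^sup>2 \<le> 64 / A\<^sup>2 * (G s)\<^sup>2" using A_pos by (simp add: power_mult_distrib field_simps)
      moreover have "z ^ 3 \<le> z\<^sup>2" using z0 z1 by (intro power_decreasing) auto
      moreover have "64 / A\<^sup>2 * (G s)\<^sup>2 \<le> C1 * (G s)\<^sup>2"
        using A_pos by (intro mult_right_mono) (simp_all add: C1_def)
      ultimately show ?thesis by linarith
    qed
    have "b ^ 3 \<le> b\<^sup>2" using b0 b1 by (intro power_decreasing) auto
    with bG zz have zb: "z ^ 3 + b ^ 3 \<le> (C1 + 1) * (G s)\<^sup>2" by (simp add: distrib_right)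
    have "(N s)\<^sup>2 \<le> (z + b)\<^sup>2" unfolding Nsq using z0 b0 by (simp add: power2_sum)
    then have "N s \<le> z + b" by (rule power2_le_imp_le) (use z0 b0 in simp)
    then have "N s ^ 3 \<le> (z + b) ^ 3" by (intro power_mono N_nonneg)
    also have "\<dots> \<le> 4 * (z ^ 3 + b ^ 3)"
    proof -
      have "4 * (z ^ 3 + b ^ 3) - (z + b) ^ 3 = 3 * ((z + b) * (z - b)\<^sup>2)"
        by (simp add: power2_eq_square power3_eq_cube algebra_simps)
      moreover have "0 \<le> (z + b) * (z - b)\<^sup>2" using z0 b0 by simp
      ultimately show ?thesis by linarith
    qed
    also have "\<dots> \<le> 4 * ((C1 + 1) * (G s)\<^sup>2)" using zb by simp
    finally show ?thesis by (simp only: mult.assoc)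
  qed
  moreover have "4 * (C1 + 1) > 0" using A_pos by (simp add: C1_def add_pos_pos)
  ultimately show ?thesis using \<eta>(1) that by blast
qed

subsection \<open>Dissipation of the Lyapunov function\<close>

lemma near_inner_sq_le:
  assumes "s \<in> near" "k \<in> {1..n}"
  shows "(fst s k \<bullet> u)\<^sup>2 \<le> 5/4 * (norm u)\<^sup>2" "((\<i> * fst s k) \<bullet> u)\<^sup>2 \<le> 5/4 * (norm u)\<^sup>2"
proof -
  have "(norm (fst s k))\<^sup>2 * (norm u)\<^sup>2 \<le> 5/4 * (norm u)\<^sup>2"
    by (intro mult_right_mono near_norm_sq assms) simp
  moreover have "(fst s k \<bullet> u)\<^sup>2 \<le> (norm (fst s k))\<^sup>2 * (norm u)\<^sup>2"
    using Cauchy_Schwarz_ineq[of "fst s k" u] by (simp add: dot_square_norm)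
  moreover have "((\<i> * fst s k) \<bullet> u)\<^sup>2 \<le> (norm (fst s k))\<^sup>2 * (norm u)\<^sup>2"
    using Cauchy_Schwarz_ineq[of "\<i> * fst s k" u] by (simp add: dot_square_norm norm_mult)
  ultimately show "(fst s k \<bullet> u)\<^sup>2 \<le> 5/4 * (norm u)\<^sup>2" "((\<i> * fst s k) \<bullet> u)\<^sup>2 \<le> 5/4 * (norm u)\<^sup>2"
    by linarith+
qed

lemma mean_inner_sq_le:
  assumes "s \<in> near"
  shows "mean (\<lambda>k. (fst s k \<bullet> u)\<^sup>2) \<le> 5/4 * (norm u)\<^sup>2"
    "mean (\<lambda>k. ((\<i> * fst s k) \<bullet> u)\<^sup>2) \<le> 5/4 * (norm u)\<^sup>2"
  using mean_mono[of "\<lambda>k. (fst s k \<bullet> u)\<^sup>2" "\<lambda>k. 5/4 * (norm u)\<^sup>2"]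
    mean_mono[of "\<lambda>k. ((\<i> * fst s k) \<bullet> u)\<^sup>2" "\<lambda>k. 5/4 * (norm u)\<^sup>2"]
    near_inner_sq_le[OF assms] unfolding mean_const by blast+

text \<open>The mixed term is split with weights \<open>3/4\<close> on \<open>X\<^sup>2\<close> and
  \<open>1/3\<close> on \<open>(z \<bullet> U)\<^sup>2\<close>. As squared lengths are at most
  \<open>5/4\<close>, the latter costs \<open>5/6\<close> of
  \<open>A\<^sup>2 * (norm U)\<^sup>2\<close>, and one sixth survives.\<close>

lemma V_lower:
  assumes s: "s \<in> near"
  shows "(norm (w s))\<^sup>2 / 2 + A\<^sup>2 / 6 * (norm (U s))\<^sup>2 + A\<^sup>2 / 2 * msX s \<le> V s"
proof -
  have "mean (\<lambda>k. (1/4) * (X s k)\<^sup>2 - (1/3) * (fst s k \<bullet> U s)\<^sup>2)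
      \<le> mean (\<lambda>k. (X s k)\<^sup>2 + X s k * (fst s k \<bullet> U s))"
  proof (rule mean_mono)
    fix k
    have "0 \<le> (3 * X s k + 2 * (fst s k \<bullet> U s))\<^sup>2" by simp
    then show "(1/4) * (X s k)\<^sup>2 - (1/3) * (fst s k \<bullet> U s)\<^sup>2 \<le> (X s k)\<^sup>2 + X s k * (fst s k \<bullet> U s)"
      by (simp add: power2_eq_square algebra_simps)
  qed
  then have "(1/4) * msX s - (1/3) * mean (\<lambda>k. (fst s k \<bullet> U s)\<^sup>2)
      \<le> mean (\<lambda>k. (X s k)\<^sup>2 + X s k * (fst s k \<bullet> U s))"
    unfolding mean_diff mean_mult msX_def .
  with mean_inner_sq_le(1)[OF s, of "U s"]
  have "msX s / 4 - 5/12 * (norm (U s))\<^sup>2 \<le> mean (\<lambda>k. (X s k)\<^sup>2 + X s k * (fst s k \<bullet> U s))" by linarith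
  then have "2 * A\<^sup>2 * (msX s / 4 - 5/12 * (norm (U s))\<^sup>2)
      \<le> 2 * A\<^sup>2 * mean (\<lambda>k. (X s k)\<^sup>2 + X s k * (fst s k \<bullet> U s))"
    by (intro mult_left_mono) auto
  then show ?thesis unfolding V_def by (simp add: algebra_simps)
qed

text \<open>Of the coefficient \<open>A\<^sup>2\<close> of the squared drift, a quarter is spent on
  \<open>X * Y\<close> and an eighth each on the products with \<open>w\<close> and
  \<open>U\<close>; half of it remains. The negative terms are those that \<open>V\<close>
  controls.\<close>

lemma W_lower:
  assumes s: "s \<in> near"
  shows "A\<^sup>2 / 2 * (norm (drift s))\<^sup>2 - 2 / A\<^sup>2 * (norm (w s))\<^sup>2 - 2 * (norm (U s))\<^sup>2 - 5 * msX s \<le> W s"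
proof -
  define z where "z = norm (drift s)"
  have "mean (\<lambda>k. 2 * A * (X s k * Y s k)) \<le> mean (\<lambda>k. A\<^sup>2 / 5 * (Y s k)\<^sup>2 + 5 * (X s k)\<^sup>2)"
  proof (rule mean_mono)
    fix k
    have "0 \<le> (A * Y s k - 5 * X s k)\<^sup>2" by simp
    then show "2 * A * (X s k * Y s k) \<le> A\<^sup>2 / 5 * (Y s k)\<^sup>2 + 5 * (X s k)\<^sup>2"
      by (simp add: power2_eq_square algebra_simps)
  qed
  then have "2 * A * mean (\<lambda>k. X s k * Y s k) \<le> A\<^sup>2 / 5 * mean (\<lambda>k. (Y s k)\<^sup>2) + 5 * msX s"
    unfolding mean_add mean_mult msX_def .
  also have "A\<^sup>2 / 5 * mean (\<lambda>k. (Y s k)\<^sup>2) \<le> A\<^sup>2 / 5 * (5/4 * z\<^sup>2)"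
    unfolding Y_def z_def by (intro mult_left_mono mean_inner_sq_le s) simp
  finally have XY: "2 * A * mean (\<lambda>k. X s k * Y s k) \<le> A\<^sup>2 / 4 * z\<^sup>2 + 5 * msX s" by simp
  have "- (drift s \<bullet> w s) \<le> z * norm (w s)"
    using Cauchy_Schwarz_ineq2[of "drift s" "w s"] by (simp add: z_def abs_le_iff)
  also have "\<dots> \<le> A\<^sup>2 / 8 * z\<^sup>2 + 2 / A\<^sup>2 * (norm (w s))\<^sup>2"
  proof -
    have "0 \<le> (A * z - 4 / A * norm (w s))\<^sup>2" by simp
    then show ?thesis using A_pos by (simp add: power2_eq_square field_simps)
  qed
  finally have Zw: "- (drift s \<bullet> w s) \<le> A\<^sup>2 / 8 * z\<^sup>2 + 2 / A\<^sup>2 * (norm (w s))\<^sup>2" .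
  have "drift s \<bullet> (\<i> * A * U s) \<le> z * (A * norm (U s))"
    using Cauchy_Schwarz_ineq2[of "drift s" "\<i> * A * U s"] A_pos by (simp add: z_def abs_le_iff norm_mult)
  also have "\<dots> \<le> A\<^sup>2 / 8 * z\<^sup>2 + 2 * (norm (U s))\<^sup>2"
  proof -
    have "0 \<le> (A * z - 4 * norm (U s))\<^sup>2" by simp
    then show ?thesis by (simp add: power2_eq_square algebra_simps)
  qed
  finally show ?thesis
    unfolding W_def inner_diff_right using XY Zw unfolding z_def[symmetric] by (simp add: algebra_simps)
qed

lemma mu_pos: "0 < mu" and mu_le: "9 * mu \<le> A" "16 * A * mu \<le> 1" "mu \<le> 1/24"
proof -
  have p: "9 + 16 * A\<^sup>2 > 0" by (simp add: add_pos_nonneg)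
  show "0 < mu" using A_pos p by (simp add: mu_def)
  have "9 * A \<le> A * (9 + 16 * A\<^sup>2)" using A_pos by (simp add: algebra_simps)
  then show "9 * mu \<le> A" using p by (simp add: mu_def divide_le_eq)
  show "16 * A * mu \<le> 1" using p by (simp add: mu_def divide_le_eq power2_eq_square)
  \<comment> \<open>The inequality of means: \<open>9 + 16 * A\<^sup>2 \<ge> 24 * A\<close>.\<close>
  have "0 \<le> (4 * A - 3)\<^sup>2" by simp
  then show "mu \<le> 1/24" using p by (simp add: mu_def divide_le_eq power2_eq_square algebra_simps)
qed

text \<open>The first half of \<open>F\<close> is coercive because \<open>par\<close> and
  \<open>par - sg\<close> together control \<open>sg\<close>. Writing \<open>par - 2 * sg\<close> as
  \<open>2 * (par - sg) - par\<close> bounds the \<open>mu\<close> term by the same squares with the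
  small factor \<open>1/24\<close>.\<close>

lemma F_lower: "((sg s k)\<^sup>2 + (par s k)\<^sup>2 + (tau s k)\<^sup>2) / 16 \<le> F s k"
proof -
  define a b c where "a = sg s k" and "b = par s k" and "c = tau s k"
  have "mu * (- ((b - 2 * a) * c)) \<le> 1/24 * \<bar>(b - 2 * a) * c\<bar>"
  proof -
    have "mu * (- ((b - 2 * a) * c)) \<le> mu * \<bar>(b - 2 * a) * c\<bar>"
      using mu_pos by (intro mult_left_mono) auto
    also have "\<dots> \<le> 1/24 * \<bar>(b - 2 * a) * c\<bar>" by (intro mult_right_mono mu_le) simp
    finally show ?thesis .
  qed
  also have "\<bar>(b - 2 * a) * c\<bar> \<le> (2 * \<bar>b - a\<bar> + \<bar>b\<bar>) * \<bar>c\<bar>"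
    unfolding abs_mult by (rule mult_right_mono) (simp_all add: abs_if)
  also have "\<dots> \<le> (b - a)\<^sup>2 + c\<^sup>2 + (b\<^sup>2 + c\<^sup>2) / 2"
  proof -
    have "2 * \<bar>b - a\<bar> * \<bar>c\<bar> \<le> (b - a)\<^sup>2 + c\<^sup>2" "2 * \<bar>b\<bar> * \<bar>c\<bar> \<le> b\<^sup>2 + c\<^sup>2"
      using sum_squares_bound[of "\<bar>b - a\<bar>" "\<bar>c\<bar>"] sum_squares_bound[of "\<bar>b\<bar>" "\<bar>c\<bar>"] by simp_all
    then show ?thesis unfolding distrib_right by argo
  qed
  finally have 1: "- (mu * ((b - 2 * a) * c)) \<le> ((b - a)\<^sup>2 + c\<^sup>2 + (b\<^sup>2 + c\<^sup>2) / 2) / 24" by simp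
  have "0 \<le> (a - 2 * b)\<^sup>2" by simp
  then have 2: "a\<^sup>2 / 2 \<le> b\<^sup>2 + (b - a)\<^sup>2"
    by (simp add: power2_eq_square algebra_simps)
  have "0 \<le> a\<^sup>2" "0 \<le> b\<^sup>2" "0 \<le> c\<^sup>2" "0 \<le> (b - a)\<^sup>2" by simp_all
  with 1 2 show ?thesis
    unfolding F_def a_def[symmetric] b_def[symmetric] c_def[symmetric] by argo
qed

lemma mean_F_lower: "dev s / 16 \<le> mean (F s)"
proof -
  have "dev s / 16 = mean (\<lambda>k. (1/16) * ((sg s k)\<^sup>2 + (par s k)\<^sup>2 + (tau s k)\<^sup>2))"
    unfolding mean_mult dev_def by simp
  also have "\<dots> \<le> mean (F s)" by (intro mean_mono order_trans[OF _ F_lower]) simp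
  finally show ?thesis .
qed

lemma Vdot_le:
  obtains C where "C \<ge> 0" "\<And>s. s \<in> near \<Longrightarrow> Vdot s \<le> - A\<^sup>2 * (norm (U s))\<^sup>2 + C * err s"
proof -
  obtain C where C: "C \<ge> 0" and le: "\<And>s. s \<in> near \<Longrightarrow>
      Vdot s - (- 4 * A\<^sup>2 * (norm (U s))\<^sup>2 + 2 * A\<^sup>2 * mean (\<lambda>k. (fst s k \<bullet> U s)\<^sup>2)) \<le> C * err s"
    using Vdot_err unfolding dominated_def Vdot_eq by fastforce
  have "Vdot s \<le> - A\<^sup>2 * (norm (U s))\<^sup>2 + C * err s" if s: "s \<in> near" for s
  proof -
    have "2 * A\<^sup>2 * mean (\<lambda>k. (fst s k \<bullet> U s)\<^sup>2) \<le> 2 * A\<^sup>2 * (5/4 * (norm (U s))\<^sup>2)"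
      by (intro mult_left_mono mean_inner_sq_le s) simp
    moreover have "0 \<le> A\<^sup>2 * (norm (U s))\<^sup>2" by simp
    ultimately show ?thesis using le[OF s] by argo
  qed
  with C that show ?thesis by blast
qed

text \<open>The product of \<open>U\<close> and \<open>w\<close> is kept as
  \<open>norm U * G\<close>: it is later split by Young's inequality into a fraction of the total
  dissipation and a multiple of \<open>(norm U)\<^sup>2\<close>, which \<open>V\<close> pays
  for.\<close>

lemma Wdot_le:
  obtains C D where "C \<ge> 0" "D \<ge> 0"
    "\<And>s. s \<in> near \<Longrightarrow> Wdot s \<le> - A\<^sup>2 * msX s + 5 * (norm (U s))\<^sup>2 + D * (norm (U s) * G s) + C * err s"
proof -
  obtain D where D: "D \<ge> 0" and w: "\<And>s. s \<in> near \<Longrightarrow> norm (w s) \<le> D * G s"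
    using dom_w unfolding dominated_def by blast
  obtain C where C: "C \<ge> 0" and le: "\<And>s. s \<in> near \<Longrightarrow>
      Wdot s - (U s \<bullet> w s - 2 * A\<^sup>2 * msX s - 4 * A * mean (\<lambda>k. X s k * ((\<i> * fst s k) \<bullet> U s))) \<le> C * err s"
    using Wdot_err Wdot_eq unfolding dominated_def by fastforce
  have "Wdot s \<le> - A\<^sup>2 * msX s + 5 * (norm (U s))\<^sup>2 + D * (norm (U s) * G s) + C * err s"
    if s: "s \<in> near" for s
  proof -
    have "mean (\<lambda>k. (- 4 * A) * (X s k * ((\<i> * fst s k) \<bullet> U s)))
        \<le> mean (\<lambda>k. A\<^sup>2 * (X s k)\<^sup>2 + 4 * ((\<i> * fst s k) \<bullet> U s)\<^sup>2)"
    proof (rule mean_mono)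
      fix k
      have "0 \<le> (A * X s k + 2 * ((\<i> * fst s k) \<bullet> U s))\<^sup>2" by simp
      then show "(- 4 * A) * (X s k * ((\<i> * fst s k) \<bullet> U s)) \<le> A\<^sup>2 * (X s k)\<^sup>2 + 4 * ((\<i> * fst s k) \<bullet> U s)\<^sup>2"
        by (simp add: power2_eq_square algebra_simps)
    qed
    then have "(- 4 * A) * mean (\<lambda>k. X s k * ((\<i> * fst s k) \<bullet> U s))
        \<le> A\<^sup>2 * msX s + 4 * mean (\<lambda>k. ((\<i> * fst s k) \<bullet> U s)\<^sup>2)"
      unfolding mean_add mean_mult msX_def .
    moreover note mean_inner_sq_le(2)[OF s, of "U s"]
    moreover have "U s \<bullet> w s \<le> D * (norm (U s) * G s)"
    proof -
      have "U s \<bullet> w s \<le> norm (U s) * norm (w s)" by (rule norm_cauchy_schwarz)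
      also have "\<dots> \<le> norm (U s) * (D * G s)" by (intro mult_left_mono w s) simp
      finally show ?thesis by (simp add: mult_ac)
    qed
    ultimately show ?thesis using le[OF s] by linarith
  qed
  with C D that show ?thesis by blast
qed

lemma Fdot_err:
  fixes k
  defines "\<epsilon>p \<equiv> \<lambda>s. - rho s k * rho s k - rho s k * par s k"
  defines "\<epsilon>s \<equiv> \<lambda>s. - 2 * (rho s k * rho s k) - A * ((\<i> * zdot s k) \<bullet> drift s)"
  defines "\<epsilon>t \<equiv> \<lambda>s. A * (norm (snd s k))\<^sup>2 - rho s k * perp s k - (\<i> * zdot s k) \<bullet> drift s"
  assumes k: "k \<in> {1..n}"
  shows "dominated near (\<lambda>s. par s k * \<epsilon>p s + tau s k * \<epsilon>t s + (par s k - sg s k) * (\<epsilon>p s - \<epsilon>s s)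
        + mu * (tau s k * (\<epsilon>p s - 2 * \<epsilon>s s) + (par s k - 2 * sg s k) * \<epsilon>t s)) err"
proof -
  have p: "dominated near \<epsilon>p (\<lambda>s. N s * N s)"
    unfolding \<epsilon>p_def by (intro dominated_diff dominated_minus dominated_mult dom_rho dom_dev k)
  have s: "dominated near \<epsilon>s (\<lambda>s. N s * N s)"
    unfolding \<epsilon>s_def
    by (intro dominated_diff dominated_cmult dominated_mult dominated_inner dominated_ii dom_rho dom_zdot dom_drift k)
  have t: "dominated near \<epsilon>t (\<lambda>s. N s * N s)"
    unfolding \<epsilon>t_def
    by (intro dominated_diff[OF dom_quad] dominated_inner dominated_ii dom_zdot dom_drift k)
  show ?thesis
    by (intro dom_err1 dominated_add dominated_cmult dominated_mult[where h = G and k = "\<lambda>s. N s * N s"]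
        dominated_diff dom_dev p s t k)
qed

text \<open>The quadratic part in \<open>sg\<close>, \<open>par\<close>, \<open>tau\<close>
  dissipates \<open>dev\<close>; half of this pays for the forcing by \<open>X\<close> and
  \<open>U\<close>, which is thereby turned into the \<open>K\<close> term.\<close>

lemma Fdot_le:
  obtains c K C where "c > 0" "K \<ge> 0" "C \<ge> 0"
    "\<And>s. s \<in> near \<Longrightarrow> mean (Fdot s) \<le> - c * dev s + K * (msX s + (norm (U s))\<^sup>2) + C * err s"
proof -
  define lin where "lin s k = tau s k * (A * X s k - (\<i> * fst s k) \<bullet> U s) + (par s k - sg s k) * (A * ((\<i> * fst s k) \<bullet> U s))
        + mu * (2 * A * ((\<i> * fst s k) \<bullet> U s) * tau s k + (par s k - 2 * sg s k) * (A * X s k - (\<i> * fst s k) \<bullet> U s))" for s k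
  define quad where "quad s k = - (sg s k)\<^sup>2 + mu * (3 * sg s k * tau s k + 4 * A * sg s k * par s k)
      - 2 * A * mu * ((par s k)\<^sup>2 + (tau s k)\<^sup>2)" for s k
  define sz where "sz s k = (sg s k)\<^sup>2 + (par s k)\<^sup>2 + (tau s k)\<^sup>2" for s k
  define c where "c = min (1/2) (A * mu)"
  have c: "c > 0" using A_pos mu_pos by (simp add: c_def)
  have "dominated near (\<lambda>s. mean (\<lambda>k. Fdot s k - quad s k - lin s k)) err"
  proof (rule dominated_mean)
    fix k assume "k \<in> {1..n}"
    from Fdot_err[OF this] show "dominated near (\<lambda>s. Fdot s k - quad s k - lin s k) err"
      unfolding quad_def lin_def Fdot_eq by (simp add: algebra_simps)
  qed
  then obtain C where C: "C \<ge> 0" "\<And>s. s \<in> near \<Longrightarrow> mean (\<lambda>k. Fdot s k - quad s k - lin s k) \<le> C * err s"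
    unfolding dominated_def by fastforce
  have q: "quad s k \<le> - c * sz s k" for s k
  proof -
    define a b d where "a = sg s k" and "b = par s k" and "d = tau s k"
    have "3 * mu * (a * d) \<le> a\<^sup>2 / 4 + 9 * mu * mu * d\<^sup>2"
    proof -
      have "0 \<le> (a / 2 - 3 * mu * d)\<^sup>2" by simp
      then show ?thesis by (simp add: power2_eq_square algebra_simps)
    qed
    also have "9 * mu * mu * d\<^sup>2 \<le> A * mu * d\<^sup>2"
      by (intro mult_right_mono mu_le) (use mu_pos in auto)
    finally have 1: "3 * mu * (a * d) \<le> a\<^sup>2 / 4 + A * mu * d\<^sup>2" by simp
    have "4 * A * mu * (a * b) \<le> a\<^sup>2 / 4 + (16 * A * mu) * (A * mu * b\<^sup>2)"
    proof -
      have "0 \<le> (a / 2 - 4 * A * mu * b)\<^sup>2" by simp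
      then show ?thesis by (simp add: power2_eq_square algebra_simps)
    qed
    also have "(16 * A * mu) * (A * mu * b\<^sup>2) \<le> 1 * (A * mu * b\<^sup>2)"
      by (intro mult_right_mono mu_le) (use mu_pos A_pos in auto)
    finally have 2: "4 * A * mu * (a * b) \<le> a\<^sup>2 / 4 + A * mu * b\<^sup>2" by simp
    have 3: "c * a\<^sup>2 \<le> 1/2 * a\<^sup>2" "c * b\<^sup>2 \<le> A * mu * b\<^sup>2" "c * d\<^sup>2 \<le> A * mu * d\<^sup>2"
      by (intro mult_right_mono; simp add: c_def)+
    show ?thesis
      unfolding quad_def sz_def a_def[symmetric] b_def[symmetric] d_def[symmetric]
      using 1 2 3 by (simp add: algebra_simps)
  qed
  \<comment> \<open>Young's inequality
    \<open>6 * (m * r) \<le> c / 6 * m\<^sup>2 + 54 / c * r\<^sup>2\<close>, and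
    \<open>108 = 54 * 2\<close> because the squared forcing satisfies \<open>r\<^sup>2 \<le> 2 * (1
    + A)\<^sup>2 * (x\<^sup>2 + y\<^sup>2)\<close>.\<close>
  define K where "K = 108 * (1 + A)\<^sup>2 / c"
  have K: "K \<ge> 0" using c by (simp add: K_def)
  have l: "lin s k \<le> c / 2 * sz s k + K * ((X s k)\<^sup>2 + ((\<i> * fst s k) \<bullet> U s)\<^sup>2)" for s k
  proof -
    define a b d x y where "a = sg s k" and "b = par s k" and "d = tau s k" and "x = X s k"
      and "y = (\<i> * fst s k) \<bullet> U s"
    define m r where "m = \<bar>a\<bar> + \<bar>b\<bar> + \<bar>d\<bar>" and "r = (1 + A) * (\<bar>x\<bar> + \<bar>y\<bar>)"
    have m0: "0 \<le> m" "0 \<le> r" using A_pos by (simp_all add: m_def r_def)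
    have r1: "\<bar>A * x - y\<bar> \<le> r"
    proof -
      have "\<bar>A * x - y\<bar> \<le> A * \<bar>x\<bar> + \<bar>y\<bar>" using abs_triangle_ineq4[of "A * x" y] A_pos by (simp add: abs_mult)
      also have "\<dots> \<le> r" using A_pos by (simp add: r_def algebra_simps)
      finally show ?thesis .
    qed
    have r2: "\<bar>A * y\<bar> \<le> r" using A_pos by (simp add: r_def abs_mult algebra_simps)
    have pr: "u * v \<le> j * (m * r)" if "\<bar>u\<bar> \<le> j * m" "\<bar>v\<bar> \<le> r" for u v j
    proof -
      have "u * v \<le> \<bar>u\<bar> * \<bar>v\<bar>" by (metis abs_ge_self abs_mult)
      also have "\<dots> \<le> (j * m) * r" using that by (intro mult_mono) auto
      finally show ?thesis by simp
    qed
    have "lin s k = d * (A * x - y) + (b - a) * (A * y) + mu * ((2 * d) * (A * y) + (b - 2 * a) * (A * x - y))"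
      by (simp add: lin_def a_def b_def d_def x_def y_def algebra_simps)
    also have "\<dots> \<le> 1 * (m * r) + 1 * (m * r) + mu * (2 * (m * r) + 2 * (m * r))"
      by (intro add_mono mult_left_mono pr r1 r2) (use mu_pos in \<open>auto simp: m_def\<close>)
    also have "\<dots> \<le> 6 * (m * r)"
    proof -
      have "mu * (2 * (m * r) + 2 * (m * r)) \<le> 1 * (2 * (m * r) + 2 * (m * r))"
        by (intro mult_right_mono) (use mu_le m0 in auto)
      then show ?thesis by simp
    qed
    also have "\<dots> \<le> c / 6 * m\<^sup>2 + 54 / c * r\<^sup>2"
    proof -
      have "0 \<le> (c * m - 18 * r)\<^sup>2" by simp
      then show ?thesis using c by (simp add: power2_eq_square field_simps)
    qed
    finally have 1: "lin s k \<le> c / 6 * m\<^sup>2 + 54 / c * r\<^sup>2" .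
    have "m\<^sup>2 \<le> 3 * sz s k"
    proof -
      have "0 \<le> (\<bar>a\<bar> - \<bar>b\<bar>)\<^sup>2" "0 \<le> (\<bar>a\<bar> - \<bar>d\<bar>)\<^sup>2" "0 \<le> (\<bar>b\<bar> - \<bar>d\<bar>)\<^sup>2" by simp_all
      then show ?thesis
        unfolding sz_def a_def[symmetric] b_def[symmetric] d_def[symmetric] m_def power2_diff power2_sum power2_abs
        by (simp add: algebra_simps)
    qed
    then have 2: "c / 6 * m\<^sup>2 \<le> c / 6 * (3 * sz s k)" using c by (intro mult_left_mono) auto
    have "r\<^sup>2 \<le> (1 + A)\<^sup>2 * (2 * (x\<^sup>2 + y\<^sup>2))"
    proof -
      have "0 \<le> (\<bar>x\<bar> - \<bar>y\<bar>)\<^sup>2" by simp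
      then have "(\<bar>x\<bar> + \<bar>y\<bar>)\<^sup>2 \<le> 2 * (x\<^sup>2 + y\<^sup>2)" unfolding power2_diff power2_sum power2_abs by simp
      then show ?thesis unfolding r_def power_mult_distrib by (intro mult_left_mono) auto
    qed
    then have "54 / c * r\<^sup>2 \<le> 54 / c * ((1 + A)\<^sup>2 * (2 * (x\<^sup>2 + y\<^sup>2)))" using c by (intro mult_left_mono) auto
    also have "\<dots> = K * (x\<^sup>2 + y\<^sup>2)" by (simp add: K_def)
    finally have 3: "54 / c * r\<^sup>2 \<le> K * (x\<^sup>2 + y\<^sup>2)" .
    show ?thesis using 1 2 3 unfolding x_def y_def by linarith
  qed
  have "mean (Fdot s) \<le> - (c / 2) * dev s + (2 * K) * (msX s + (norm (U s))\<^sup>2) + C * err s"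
    if s: "s \<in> near" for s
  proof -
    have "mean (Fdot s) = mean (\<lambda>k. (quad s k + lin s k) + (Fdot s k - quad s k - lin s k))"
      by (rule arg_cong[where f = mean]) auto
    also have "\<dots> = mean (\<lambda>k. quad s k + lin s k) + mean (\<lambda>k. Fdot s k - quad s k - lin s k)"
      by (rule mean_add)
    also have "mean (\<lambda>k. quad s k + lin s k) \<le> mean (\<lambda>k. (- (c / 2)) * ((sg s k)\<^sup>2 + (par s k)\<^sup>2 + (tau s k)\<^sup>2)
        + K * ((X s k)\<^sup>2 + ((\<i> * fst s k) \<bullet> U s)\<^sup>2))"
    proof (rule mean_mono)
      fix k
      show "quad s k + lin s k \<le> (- (c / 2)) * ((sg s k)\<^sup>2 + (par s k)\<^sup>2 + (tau s k)\<^sup>2)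
        + K * ((X s k)\<^sup>2 + ((\<i> * fst s k) \<bullet> U s)\<^sup>2)"
        using q[of s k] l[of s k] unfolding sz_def by argo
    qed
    also have "\<dots> = - (c / 2) * dev s + K * (msX s + mean (\<lambda>k. ((\<i> * fst s k) \<bullet> U s)\<^sup>2))"
      unfolding mean_mult mean_add dev_def msX_def ..
    also have "\<dots> \<le> - (c / 2) * dev s + K * (2 * (msX s + (norm (U s))\<^sup>2))"
    proof -
      have "0 \<le> (norm (U s))\<^sup>2" by simp
      then have "msX s + mean (\<lambda>k. ((\<i> * fst s k) \<bullet> U s)\<^sup>2) \<le> 2 * (msX s + (norm (U s))\<^sup>2)"
        using mean_inner_sq_le(2)[OF s, of "U s"] msX_nonneg[of s] by argo
      with K show ?thesis by (intro add_left_mono mult_left_mono)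
    qed
    also have "mean (\<lambda>k. Fdot s k - quad s k - lin s k) \<le> C * err s" by (rule C(2)[OF s])
    finally show ?thesis by (simp add: algebra_simps)
  qed
  with c K C that[of "c / 2" "2 * K" C] show ?thesis by simp
qed

section \<open>Coercivity and decay of the combined Lyapunov function\<close>

definition L :: "real \<Rightarrow> real \<Rightarrow> config \<Rightarrow> real" where
  "L a b s = V s + a * W s + b * mean (F s)"
definition Ldot :: "real \<Rightarrow> real \<Rightarrow> config \<Rightarrow> real" where
  "Ldot a b s = Vdot s + a * Wdot s + b * mean (Fdot s)"

text \<open>The factor \<open>12\<close> comes from the \<open>U\<close> terms: the loss
  \<open>2 * a\<close> in \<open>a * W\<close> must not exceed the \<open>A\<^sup>2 / 6\<close>
  provided by \<open>V\<close>. The losses in \<open>w\<close> and \<open>msX\<close> are then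
  covered as well.\<close>

lemma L_lower:
  assumes a: "0 < a" "12 * a \<le> A\<^sup>2" and b: "0 < b" and s: "s \<in> near"
  shows "min (a * A\<^sup>2 / 2) (b / 16) * (N s)\<^sup>2 \<le> L a b s"
proof -
  define v u h where "v = (norm (w s))\<^sup>2" and "u = (norm (U s))\<^sup>2" and "h = msX s"
  have nn: "0 \<le> v" "0 \<le> u" "0 \<le> h" by (simp_all add: v_def u_def h_def msX_nonneg)
  have "a * (A\<^sup>2 / 2 * (norm (drift s))\<^sup>2 - 2 / A\<^sup>2 * v - 2 * u - 5 * h) \<le> a * W s"
    unfolding v_def u_def h_def by (intro mult_left_mono W_lower s) (use a in simp)
  moreover have "a * (2 / A\<^sup>2 * v) \<le> v / 2"
  proof -
    have "a * 2 / A\<^sup>2 \<le> 1/2" using a A_pos by (simp add: field_simps)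
    then show ?thesis using mult_right_mono[of "a * 2 / A\<^sup>2" "1/2" v] nn by simp
  qed
  moreover have "(12 * a) * u \<le> A\<^sup>2 * u" "(12 * a) * h \<le> A\<^sup>2 * h"
    using a nn by (simp_all add: mult_right_mono)
  moreover have "0 \<le> a * h" using a nn by simp
  moreover have "v / 2 + A\<^sup>2 / 6 * u + A\<^sup>2 / 2 * h \<le> V s"
    using V_lower[OF s] by (simp add: v_def u_def h_def)
  moreover have "b * (dev s / 16) \<le> b * mean (F s)"
    by (intro mult_left_mono mean_F_lower) (use b in simp)
  ultimately have "a * A\<^sup>2 / 2 * (norm (drift s))\<^sup>2 + b / 16 * dev s \<le> L a b s"
    unfolding L_def by (simp add: algebra_simps)
  moreover have "min (a * A\<^sup>2 / 2) (b / 16) * (norm (drift s))\<^sup>2 \<le> a * A\<^sup>2 / 2 * (norm (drift s))\<^sup>2"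
    "min (a * A\<^sup>2 / 2) (b / 16) * dev s \<le> b / 16 * dev s"
    by (intro mult_right_mono; simp add: dev_nonneg)+
  ultimately show ?thesis unfolding N_sq distrib_left by linarith
qed

lemma L_upper: "dominated near (L a b) (\<lambda>s. N s * N s)"
proof -
  have w: "dominated near w N" using dom_w dom_G by (rule dominated_mono)
  have Ux: "dominated near (\<lambda>s. fst s k \<bullet> U s) N" if "k \<in> {1..n}" for k
    by (rule dominated_inner1[OF dom_z[OF that] dom_U])
  have V: "dominated near V (\<lambda>s. N s * N s)"
  proof -
    have "dominated near (\<lambda>s. (1/2) * (w s \<bullet> w s) + A\<^sup>2 * (U s \<bullet> U s)
      + 2 * A\<^sup>2 * mean (\<lambda>k. X s k * X s k + X s k * (fst s k \<bullet> U s))) (\<lambda>s. N s * N s)"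
      by (intro dominated_add dominated_cmult dominated_mean dominated_mult[where h = N and k = N]
          dominated_inner[where h = N and k = N] w dom_U dom_near_X Ux)
    then show ?thesis unfolding V_def[abs_def] dot_square_norm power2_eq_square by simp
  qed
  have W: "dominated near W (\<lambda>s. N s * N s)"
    unfolding W_def[abs_def] dot_square_norm[symmetric]
    by (intro dominated_add dominated_diff dominated_cmult dominated_mean dominated_mult[where h = N and k = N]
        dominated_inner[where h = N and k = N] w dom_U dom_near_X dom_Y dom_drift)
  have F: "dominated near (\<lambda>s. F s k) (\<lambda>s. N s * N s)" if k: "k \<in> {1..n}" for k
  proof -
    have "dominated near (\<lambda>s. (1/2) * (par s k * par s k + tau s k * tau s k + (par s k - sg s k) * (par s k - sg s k))
        + mu * ((par s k - 2 * sg s k) * tau s k)) (\<lambda>s. N s * N s)"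
      by (intro dominated_add dominated_cmult dominated_mult[where h = N and k = N] dominated_diff dom_dev k)
    then show ?thesis unfolding F_def power2_eq_square by simp
  qed
  show ?thesis
    unfolding L_def[abs_def] by (intro dominated_add dominated_cmult dominated_mean V W F)
qed

text \<open>The dissipations form a hierarchy: \<open>F\<close> damps \<open>dev\<close> at the cost
  of \<open>msX\<close> and \<open>U\<close>, \<open>W\<close> damps \<open>msX\<close> at the cost
  of \<open>U\<close>, and \<open>V\<close> damps \<open>U\<close>. Each form thus gets a small
  weight relative to the one that pays for it.\<close>

lemma Ldot_le:
  obtains a b c C where "0 < a" "12 * a \<le> A\<^sup>2" "0 < b" "0 < c" "0 \<le> C"
    "\<And>s. s \<in> near \<Longrightarrow> Ldot a b s \<le> - c * (G s)\<^sup>2 + C * err s"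
proof -
  obtain CV where CV: "CV \<ge> 0" "\<And>s. s \<in> near \<Longrightarrow> Vdot s \<le> - A\<^sup>2 * (norm (U s))\<^sup>2 + CV * err s"
    by (rule Vdot_le) auto
  obtain CW D where CW: "CW \<ge> 0" "D \<ge> 0" "\<And>s. s \<in> near \<Longrightarrow>
      Wdot s \<le> - A\<^sup>2 * msX s + 5 * (norm (U s))\<^sup>2 + D * (norm (U s) * G s) + CW * err s"
    by (rule Wdot_le) auto
  obtain c K CF where CF: "c > 0" "K \<ge> 0" "CF \<ge> 0" "\<And>s. s \<in> near \<Longrightarrow>
      mean (Fdot s) \<le> - c * dev s + K * (msX s + (norm (U s))\<^sup>2) + CF * err s"
    by (rule Fdot_le) auto
  \<comment> \<open>Weight of \<open>F\<close> relative to \<open>W\<close>, so small that the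
    \<open>msX\<close> forcing costs at most half of the damping in \<open>W\<close>.\<close>
  define \<kappa> where "\<kappa> = A\<^sup>2 / (2 * (K + 1))"
  have \<kappa>: "\<kappa> > 0" "\<kappa> * K \<le> A\<^sup>2 / 2" using A_pos CF by (simp_all add: \<kappa>_def field_simps)
  define \<gamma> where "\<gamma> = min (A\<^sup>2 / 2) (\<kappa> * c)"
  have \<gamma>: "\<gamma> > 0" "\<gamma> \<le> A\<^sup>2 / 2" "\<gamma> \<le> \<kappa> * c" using A_pos \<kappa> CF by (simp_all add: \<gamma>_def)
  \<comment> \<open>The total coefficient of \<open>(norm U)\<^sup>2\<close> produced by
    \<open>W\<close>, by \<open>F\<close> and by Young's inequality; it fixes how small
    \<open>a\<close> must be.\<close>
  define M where "M = 5 + \<kappa> * K + \<gamma> + D\<^sup>2 / (2 * \<gamma>)"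
  have M: "M \<ge> 5" using \<kappa> \<gamma> CF by (simp add: M_def)
  define a where "a = A\<^sup>2 / (12 + M)"
  have a: "0 < a" "12 * a \<le> A\<^sup>2" "a * M \<le> A\<^sup>2" using M A_pos by (simp_all add: a_def field_simps)
  have "Ldot a (a * \<kappa>) s \<le> - (a * \<gamma> / 2) * (G s)\<^sup>2 + (CV + a * CW + a * \<kappa> * CF) * err s"
    if s: "s \<in> near" for s
  proof -
    define u h b g where "u = norm (U s)" and "h = msX s" and "b = dev s" and "g = G s"
    have nn: "0 \<le> h" "0 \<le> b" by (simp_all add: h_def b_def msX_nonneg dev_nonneg)
    have g: "g\<^sup>2 = u\<^sup>2 + h + b" by (simp add: g_def u_def h_def b_def G_sq)
    have ug: "D * (u * g) \<le> \<gamma> / 2 * g\<^sup>2 + D\<^sup>2 / (2 * \<gamma>) * u\<^sup>2"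
    proof -
      have "0 \<le> (\<gamma> * g - D * u)\<^sup>2" by simp
      then show ?thesis using \<gamma>(1) by (simp add: power2_eq_square field_simps)
    qed
    have 1: "\<kappa> * K * h \<le> A\<^sup>2 / 2 * h" "\<gamma> * h \<le> A\<^sup>2 / 2 * h" "\<gamma> * b \<le> \<kappa> * c * b"
      by (intro mult_right_mono \<kappa> \<gamma> nn)+
    have "- A\<^sup>2 * h + 5 * u\<^sup>2 + D * (u * g) + \<kappa> * (- c * b + K * (h + u\<^sup>2))
       \<le> M * u\<^sup>2 - \<gamma> / 2 * g\<^sup>2"
      using ug 1 unfolding M_def g by (simp add: algebra_simps)
    then have "a * (- A\<^sup>2 * h + 5 * u\<^sup>2 + D * (u * g) + \<kappa> * (- c * b + K * (h + u\<^sup>2)))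
       \<le> a * (M * u\<^sup>2 - \<gamma> / 2 * g\<^sup>2)"
      using a by (intro mult_left_mono) auto
    moreover have "a * M * u\<^sup>2 \<le> A\<^sup>2 * u\<^sup>2" using a by (intro mult_right_mono) auto
    moreover have "Vdot s \<le> - A\<^sup>2 * u\<^sup>2 + CV * err s" using CV(2)[OF s] by (simp add: u_def)
    moreover have "a * Wdot s \<le> a * (- A\<^sup>2 * h + 5 * u\<^sup>2 + D * (u * g) + CW * err s)"
      using CW(3)[OF s] a by (simp add: u_def h_def g_def)
    moreover have "a * \<kappa> * mean (Fdot s) \<le> a * \<kappa> * (- c * b + K * (h + u\<^sup>2) + CF * err s)"
      using CF(4)[OF s] a \<kappa> by (simp add: u_def h_def b_def)
    ultimately show ?thesis
      unfolding Ldot_def g_def[symmetric] by (simp add: algebra_simps)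
  qed
  moreover have "0 < a * \<kappa>" "0 < a * \<gamma> / 2" "0 \<le> CV + a * CW + a * \<kappa> * CF"
    using a \<kappa> \<gamma> CV CW CF by simp_all
  ultimately show ?thesis using that a by blast
qed

text \<open>A distance from the equilibria comparable to \<open>N\<close> on \<open>near\<close>. It
  bounds each \<open>rho\<close> and \<open>d\<close> without presupposing \<open>near\<close>, so
  smallness of \<open>J\<close> with equal means implies membership in \<open>near\<close> and can
  be propagated in time.\<close>

definition J :: "config \<Rightarrow> real" where "J s = mean (\<lambda>k. \<bar>rho s k\<bar> + norm (snd s k))"

lemma J_nonneg: "0 \<le> J s"
  unfolding J_def by (rule mean_nonneg) simp

lemma le_J:
  assumes "k \<in> {1..n}"
  shows "\<bar>rho s k\<bar> + norm (snd s k) \<le> real n * J s"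
  unfolding J_def using le_mean[OF assms, of "\<lambda>k. \<bar>rho s k\<bar> + norm (snd s k)"] by simp

lemma dom_J_N: "dominated near J N"
  unfolding J_def[abs_def] real_norm_def[symmetric]
  by (intro dominated_mean dominated_add dominated_norm dom_rho dom_d)

lemma dom_N_J: "dominated near N J"
proof -
  have r: "dominated near (\<lambda>s. rho s k) J" if k: "k \<in> {1..n}" for k
  proof (rule dominatedI[where C = n])
    show "norm (rho s k) \<le> real n * J s" for s
      using le_J[OF k, of s] norm_ge_zero[of "snd s k"] unfolding real_norm_def by linarith
  qed (rule J_nonneg)
  have d: "dominated near (\<lambda>s. snd s k) J" if k: "k \<in> {1..n}" for k
  proof (rule dominatedI[where C = n])
    show "norm (snd s k) \<le> real n * J s" for s
      using le_J[OF k, of s] abs_ge_zero[of "rho s k"] by linarith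
  qed (rule J_nonneg)
  have dr: "dominated near drift J"
    unfolding drift_def[abs_def] by (intro dominated_mean d)
  have y: "dominated near (\<lambda>s. Y s k) J" if k: "k \<in> {1..n}" for k
    unfolding Y_def by (intro dominated_inner1 dominated_ii dom_z dr k)
  have p: "dominated near (\<lambda>s. par s k) J" if k: "k \<in> {1..n}" for k
    unfolding par_def by (intro dominated_inner1 dom_z d k)
  have s: "dominated near (\<lambda>s. sg s k) J" if k: "k \<in> {1..n}" for k
    unfolding sg_def by (intro dominated_diff dominated_cmult r y k)
  have t: "dominated near (\<lambda>s. tau s k) J" if k: "k \<in> {1..n}" for k
    unfolding tau_def perp_def by (intro dominated_diff dominated_inner1 dominated_ii dom_z d y k)
  have "dominated near (\<lambda>s. sqrt (drift s \<bullet> drift s + mean (\<lambda>k. sg s k * sg s k + par s k * par s k + tau s k * tau s k))) J"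
    by (intro dominated_sqrt dominated_add dominated_mean dominated_mult[where h = J and k = J] dominated_inner[where h = J and k = J]
        dr p s t J_nonneg)
  then show ?thesis
    unfolding N_def[abs_def] dev_def dot_square_norm power2_eq_square .
qed

text \<open>Removes \<open>err\<close> and \<open>near\<close> from all inequalities: smallness of
  \<open>J\<close> is the only localization left, in the form required by the decay and length
  lemmas.\<close>

lemma lyapunov:
  obtains j a b c K where "j > 0" "c > 0" "K > 0"
    "\<And>s. mean (fst s) = mean (snd s) \<Longrightarrow> J s \<le> j \<Longrightarrow>
       0 \<le> L a b s \<and> c * (J s)\<^sup>2 \<le> L a b s \<and> L a b s \<le> K * (J s)\<^sup>2 \<and> Ldot a b s \<le> - c * (G s)\<^sup>2 \<and>
       L a b s * sqrt (L a b s) \<le> K * (G s)\<^sup>2 \<and> (\<forall>k\<in>{1..n}. norm (zdot s k) \<le> K * G s)"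
proof -
  obtain a b c C where ab: "0 < a" "12 * a \<le> A\<^sup>2" "0 < b" and c: "0 < c" and C: "0 \<le> C"
    and Ld: "\<And>s. s \<in> near \<Longrightarrow> Ldot a b s \<le> - c * (G s)\<^sup>2 + C * err s"
    by (rule Ldot_le) auto
  define c1 where "c1 = min (a * A\<^sup>2 / 2) (b / 16)"
  have c1: "c1 > 0" using ab A_pos by (simp add: c1_def)
  have Llow: "c1 * (N s)\<^sup>2 \<le> L a b s" if "s \<in> near" for s
    unfolding c1_def by (rule L_lower[OF ab that])
  obtain K1 where K1: "K1 \<ge> 0" "\<And>s. s \<in> near \<Longrightarrow> norm (L a b s) \<le> K1 * (N s * N s)"
    using L_upper[of a b] unfolding dominated_def by blast
  obtain CN \<eta> where CN: "CN > 0" "\<eta> > 0" "\<And>s. s \<in> near \<Longrightarrow> N s \<le> \<eta> \<Longrightarrow> N s ^ 3 \<le> CN * (G s)\<^sup>2"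
    by (rule N_cube_le) auto
  obtain K2 where K2: "K2 \<ge> 0" "\<And>s. s \<in> near \<Longrightarrow> J s \<le> K2 * N s"
    using dom_J_N unfolding dominated_def real_norm_def by (meson abs_le_D1)
  obtain K3 where K3: "K3 \<ge> 0" "\<And>s. s \<in> near \<Longrightarrow> N s \<le> K3 * J s"
    using dom_N_J unfolding dominated_def real_norm_def by (meson abs_le_D1)
  have "dominated near (\<lambda>s. mean (\<lambda>k. norm (zdot s k))) (\<lambda>s. G s + N s * N s)"
    by (intro dominated_mean dominated_norm dom_zdot_G)
  then obtain K4 where K4: "K4 \<ge> 0" "\<And>s. s \<in> near \<Longrightarrow> mean (\<lambda>k. norm (zdot s k)) \<le> K4 * (G s + N s * N s)"
    unfolding dominated_def real_norm_def by (meson abs_le_D1)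
  have z_le: "norm (zdot s k) \<le> real n * K4 * (G s + N s * N s)" if "s \<in> near" "k \<in> {1..n}" for s k
  proof -
    have "norm (zdot s k) \<le> real n * mean (\<lambda>k. norm (zdot s k))"
      by (rule le_mean[OF that(2)]) simp
    also have "\<dots> \<le> real n * (K4 * (G s + N s * N s))" using K4(2)[OF that(1)] by (intro mult_left_mono) auto
    finally show ?thesis by simp
  qed
  \<comment> \<open>The factor in \<open>N\<^sup>2 \<le> x * G\<close>. It gives
    \<open>C * err \<le> 2 * C * x * G\<^sup>2\<close>, so \<open>4 * C * x \<le> c\<close> leaves
    half of the dissipation.\<close>
  define x where "x = min 1 (c / (4 * C + 1))"
  have x: "0 < x" "x \<le> 1" using c C by (simp_all add: x_def)
  have "(4 * C) * x \<le> (4 * C + 1) * (c / (4 * C + 1))"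
    using c C by (intro mult_mono) (auto simp: x_def)
  also have "\<dots> = c" using C by simp
  finally have Cx: "4 * C * x \<le> c" .
  define \<eta>' where "\<eta>' = min \<eta> (x\<^sup>2 / CN)"
  have \<eta>': "\<eta>' > 0" "\<eta>' \<le> \<eta>" "CN * \<eta>' \<le> x\<^sup>2" using CN x by (auto simp: \<eta>'_def min_def field_simps)
  \<comment> \<open>Of \<open>N ^ 4\<close>, three factors are bounded by
    \<open>CN * G\<^sup>2\<close>; the spare factor \<open>N\<close> makes the constant
    small.\<close>
  have NN: "N s * N s \<le> x * G s" if s: "s \<in> near" "N s \<le> \<eta>'" for s
  proof -
    have "(N s * N s)\<^sup>2 = N s * N s ^ 3" by (simp add: power2_eq_square power3_eq_cube)
    also have "\<dots> \<le> \<eta>' * (CN * (G s)\<^sup>2)"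
      using s \<eta>' CN(3)[OF s(1)] N_nonneg by (intro mult_mono) auto
    also have "\<dots> = (CN * \<eta>') * (G s)\<^sup>2" by simp
    also have "\<dots> \<le> x\<^sup>2 * (G s)\<^sup>2" using \<eta>' by (intro mult_right_mono) auto
    finally have "(N s * N s)\<^sup>2 \<le> (x * G s)\<^sup>2" by (simp add: power_mult_distrib)
    then show ?thesis by (rule power2_le_imp_le) (use x G_nonneg in simp)
  qed
  define j where "j = min (1 / (4 * real n)) (\<eta>' / (K3 + 1))"
  have n0: "real n > 0" using n_pos by simp
  have j: "j > 0" using \<eta>' K3 n0 by (simp add: j_def)
  define c2 where "c2 = min (c / 2) (c1 / (K2 + 1)\<^sup>2)"
  have c2: "c2 > 0" using c c1 K2 by (simp add: c2_def)
  define K where "K = max 1 (max (K1 * K3\<^sup>2) (max (K1 * sqrt K1 * CN) (2 * (real n * K4))))"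
  have K: "K > 0" by (simp add: K_def)
  show ?thesis
  proof (rule that[OF j c2 K, of a b])
    fix s assume bal: "mean (fst s) = mean (snd s)" and Jj: "J s \<le> j"
    have nJ: "real n * J s \<le> 1/4"
    proof -
      have "real n * J s \<le> real n * (1 / (4 * real n))"
        using Jj by (intro mult_left_mono) (auto simp: j_def)
      then show ?thesis using n0 by simp
    qed
    have s: "s \<in> near"
    proof -
      have "\<bar>rho s k\<bar> \<le> 1/4 \<and> norm (snd s k) \<le> 1/4" if "k \<in> {1..n}" for k
        using le_J[OF that, of s] nJ by (smt (verit) norm_ge_zero)
      with bal show ?thesis unfolding near_def by blast
    qed
    have Ns: "N s \<le> \<eta>'"
    proof -
      have "N s \<le> K3 * J s" by (rule K3(2)[OF s])
      also have "\<dots> \<le> (K3 + 1) * j" using K3 Jj J_nonneg[of s] j by (intro mult_mono) auto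
      also have "\<dots> \<le> (K3 + 1) * (\<eta>' / (K3 + 1))" using K3 by (intro mult_left_mono) (auto simp: j_def)
      also have "\<dots> = \<eta>'" using K3 by simp
      finally show ?thesis .
    qed
    have L0: "0 \<le> L a b s" using Llow[OF s] c1 by (meson order_trans mult_nonneg_nonneg less_imp_le zero_le_power2)
    have "(J s)\<^sup>2 \<le> ((K2 + 1) * N s)\<^sup>2"
      using K2 s N_nonneg[of s] J_nonneg[of s] by (intro power_mono order_trans[OF K2(2)[OF s]] mult_right_mono) auto
    then have "c2 * (J s)\<^sup>2 \<le> c1 / (K2 + 1)\<^sup>2 * ((K2 + 1)\<^sup>2 * (N s)\<^sup>2)"
      using c2 K2 c1 by (intro mult_mono) (auto simp: c2_def power_mult_distrib)
    also have "\<dots> = c1 * (N s)\<^sup>2" using K2 by simp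
    also note Llow[OF s]
    finally have LJ: "c2 * (J s)\<^sup>2 \<le> L a b s" .
    have LN: "L a b s \<le> K1 * (N s)\<^sup>2" using K1(2)[OF s] by (simp add: power2_eq_square)
    also have "\<dots> \<le> K1 * (K3 * J s)\<^sup>2"
      using K1 K3(2)[OF s] N_nonneg[of s] by (intro mult_left_mono power_mono) auto
    also have "\<dots> = (K1 * K3\<^sup>2) * (J s)\<^sup>2" by (simp add: power_mult_distrib)
    also have "\<dots> \<le> K * (J s)\<^sup>2" by (intro mult_right_mono) (simp_all add: K_def)
    finally have LJ2: "L a b s \<le> K * (J s)\<^sup>2" .
    have "err s = (G s + N s * N s) * (N s * N s)" by (simp add: err_def distrib_right)
    also have "\<dots> \<le> (2 * G s) * (x * G s)"
    proof (rule mult_mono[OF _ NN[OF s Ns]])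
      have "x * G s \<le> 1 * G s" using x G_nonneg by (intro mult_right_mono) auto
      then show "G s + N s * N s \<le> 2 * G s" using NN[OF s Ns] by simp
    qed (simp_all add: G_nonneg N_nonneg)
    finally have "C * err s \<le> C * ((2 * G s) * (x * G s))" using C by (intro mult_left_mono)
    also have "\<dots> = 4 * C * x * ((G s)\<^sup>2 / 2)" by (simp add: power2_eq_square)
    also have "\<dots> \<le> c * ((G s)\<^sup>2 / 2)" using Cx by (intro mult_right_mono) auto
    finally have "Ldot a b s \<le> - (c / 2) * (G s)\<^sup>2" using Ld[OF s] by simp
    moreover have "c2 * (G s)\<^sup>2 \<le> c / 2 * (G s)\<^sup>2"
      unfolding c2_def by (rule mult_right_mono[OF min.cobounded1]) simp
    ultimately have LD: "Ldot a b s \<le> - c2 * (G s)\<^sup>2" by simp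
    have "L a b s * sqrt (L a b s) \<le> (K1 * (N s)\<^sup>2) * sqrt (K1 * (N s)\<^sup>2)"
      using LN L0 K1 by (intro mult_mono) auto
    also have "\<dots> = K1 * sqrt K1 * N s ^ 3"
      using N_nonneg[of s] by (simp add: real_sqrt_mult power2_eq_square power3_eq_cube)
    also have "\<dots> \<le> K1 * sqrt K1 * (CN * (G s)\<^sup>2)"
      using K1 CN(3)[OF s] Ns \<eta>' by (intro mult_left_mono) auto
    also have "\<dots> = (K1 * sqrt K1 * CN) * (G s)\<^sup>2" by simp
    also have "\<dots> \<le> K * (G s)\<^sup>2" by (intro mult_right_mono) (simp_all add: K_def)
    finally have LG: "L a b s * sqrt (L a b s) \<le> K * (G s)\<^sup>2" .
    have zd: "norm (zdot s k) \<le> K * G s" if k: "k \<in> {1..n}" for k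
    proof -
      have "x * G s \<le> 1 * G s" using x G_nonneg by (intro mult_right_mono) auto
      then have "real n * K4 * (G s + N s * N s) \<le> real n * K4 * (2 * G s)"
        using NN[OF s Ns] K4 by (intro mult_left_mono) auto
      also have "\<dots> = (2 * (real n * K4)) * G s" by simp
      also have "\<dots> \<le> K * G s" using G_nonneg[of s] by (intro mult_right_mono) (simp_all add: K_def)
      finally show ?thesis using z_le[OF s k] by simp
    qed
    show "0 \<le> L a b s \<and> c2 * (J s)\<^sup>2 \<le> L a b s \<and> L a b s \<le> K * (J s)\<^sup>2 \<and> Ldot a b s \<le> - c2 * (G s)\<^sup>2 \<and>
       L a b s * sqrt (L a b s) \<le> K * (G s)\<^sup>2 \<and> (\<forall>k\<in>{1..n}. norm (zdot s k) \<le> K * G s)"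
      using L0 LJ LJ2 LD LG zd by blast
  qed
qed

subsection \<open>Trajectories\<close>

lemma mean_has_vector_derivative:
  assumes "\<And>k. k \<in> {1..n} \<Longrightarrow> (f k has_vector_derivative f' k) net"
  shows "((\<lambda>t. mean (\<lambda>k. f k t)) has_vector_derivative mean f') net"
  unfolding mean_def
  by (intro bounded_linear.has_vector_derivative[OF bounded_linear_scaleR_right] has_vector_derivative_sum assms)

lemmas inner_has_vector_derivative = bounded_bilinear.has_vector_derivative[OF bounded_bilinear_inner]
lemmas mult_has_vector_derivative = bounded_bilinear.has_vector_derivative[OF bounded_bilinear_mult]
lemmas scaleR_has_vector_derivative = bounded_bilinear.has_vector_derivative[OF bounded_bilinear_scaleR]

definition trajectory :: "(real \<Rightarrow> config) \<Rightarrow> bool" where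
  "trajectory c \<longleftrightarrow> (\<forall>t\<ge>0. mean (fst (c t)) = mean (snd (c t)) \<and> (\<forall>k\<in>{1..n}.
     ((\<lambda>t. fst (c t) k) has_vector_derivative zdot (c t) k) (at t within {0..}) \<and>
     ((\<lambda>t. snd (c t) k) has_vector_derivative ddot (c t) k) (at t within {0..})))"

context
  fixes c :: "real \<Rightarrow> config" and t :: real
  assumes c: "trajectory c" and t: "t \<ge> 0"
begin

abbreviation hasd :: "(real \<Rightarrow> 'b::real_normed_vector) \<Rightarrow> 'b \<Rightarrow> bool" where
  "hasd f y \<equiv> (f has_vector_derivative y) (at t within {0..})"

lemma z_deriv: "k \<in> {1..n} \<Longrightarrow> hasd (\<lambda>t. fst (c t) k) (zdot (c t) k)"
  and d_deriv: "k \<in> {1..n} \<Longrightarrow> hasd (\<lambda>t. snd (c t) k) (ddot (c t) k)"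
  using c t unfolding trajectory_def by blast+

lemma drift_deriv: "hasd (\<lambda>t. drift (c t)) (U (c t))"
proof -
  have "hasd (\<lambda>t. drift (c t)) (mean (ddot (c t)))"
    unfolding drift_def by (intro mean_has_vector_derivative d_deriv)
  moreover have "mean (ddot (c t)) = U (c t)"
  proof -
    have "mean (ddot (c t)) = - mean (\<lambda>k. rho (c t) k *\<^sub>R fst (c t) k) - 2 * \<i> * A * drift (c t) + \<i> * A * drift (c t)"
      unfolding ddot_def[abs_def] mean_add mean_diff mean_minus mean_mult mean_const drift_def ..
    then show ?thesis by (simp add: U_def)
  qed
  ultimately show ?thesis by simp
qed

lemma cmult_deriv: "hasd f y \<Longrightarrow> hasd (\<lambda>t. x * f t) (x * y)" for f :: "real \<Rightarrow> 'b::real_normed_algebra"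
  by (rule bounded_linear.has_vector_derivative[OF bounded_linear_mult_right])

lemma rho_deriv:
  assumes k: "k \<in> {1..n}" shows "hasd (\<lambda>t. rho (c t) k) (rhodot (c t) k)"
proof -
  have "hasd (\<lambda>t. fst (c t) k \<bullet> fst (c t) k - 1)
      (fst (c t) k \<bullet> zdot (c t) k + zdot (c t) k \<bullet> fst (c t) k - 0)"
    by (intro has_vector_derivative_diff has_vector_derivative_const inner_has_vector_derivative z_deriv k)
  moreover have "fst (c t) k \<bullet> zdot (c t) k + zdot (c t) k \<bullet> fst (c t) k - 0 = rhodot (c t) k"
  proof -
    have "fst (c t) k \<bullet> zdot (c t) k = - rho (c t) k * (norm (fst (c t) k))\<^sup>2 + A * perp (c t) k"
      by (simp add: zdot_def perp_def inner_complex_def cmod_power2) (simp add: algebra_simps power2_eq_square)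
    then show ?thesis by (simp add: inner_commute rhodot_def rho_def algebra_simps power2_eq_square)
  qed
  ultimately show ?thesis by (simp add: rho_def dot_square_norm)
qed

lemma par_deriv:
  assumes k: "k \<in> {1..n}" shows "hasd (\<lambda>t. par (c t) k) (pardot (c t) k)"
proof -
  have "hasd (\<lambda>t. par (c t) k) (fst (c t) k \<bullet> ddot (c t) k + zdot (c t) k \<bullet> snd (c t) k)"
    unfolding par_def by (intro inner_has_vector_derivative z_deriv d_deriv k)
  moreover have "fst (c t) k \<bullet> ddot (c t) k + zdot (c t) k \<bullet> snd (c t) k
     = - rho (c t) k * (norm (fst (c t) k))\<^sup>2 + 2 * A * perp (c t) k - A * Y (c t) k - rho (c t) k * par (c t) k"
    by (simp add: zdot_def ddot_def perp_def par_def Y_def inner_complex_def cmod_power2)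
      (simp add: algebra_simps power2_eq_square)
  moreover have "\<dots> = pardot (c t) k" by (simp add: pardot_def rho_def algebra_simps power2_eq_square)
  ultimately show ?thesis by simp
qed

lemma perp_deriv:
  assumes k: "k \<in> {1..n}" shows "hasd (\<lambda>t. perp (c t) k) (perpdot (c t) k)"
proof -
  have "hasd (\<lambda>t. perp (c t) k) ((\<i> * fst (c t) k) \<bullet> ddot (c t) k + (\<i> * zdot (c t) k) \<bullet> snd (c t) k)"
    unfolding perp_def by (intro inner_has_vector_derivative cmult_deriv z_deriv d_deriv k)
  moreover have "(\<i> * fst (c t) k) \<bullet> ddot (c t) k + (\<i> * zdot (c t) k) \<bullet> snd (c t) k = perpdot (c t) k"
    by (simp add: zdot_def ddot_def perpdot_def perp_def par_def X_def inner_complex_def cmod_power2)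
      (simp add: algebra_simps power2_eq_square)
  ultimately show ?thesis by simp
qed

lemma X_deriv:
  assumes k: "k \<in> {1..n}" shows "hasd (\<lambda>t. X (c t) k) (Xdot (c t) k)"
proof -
  have "hasd (\<lambda>t. X (c t) k) (fst (c t) k \<bullet> U (c t) + zdot (c t) k \<bullet> drift (c t))"
    unfolding X_def by (intro inner_has_vector_derivative z_deriv drift_deriv k)
  then show ?thesis by (simp add: Xdot_def add.commute)
qed

lemma Y_deriv:
  assumes k: "k \<in> {1..n}" shows "hasd (\<lambda>t. Y (c t) k) (Ydot (c t) k)"
proof -
  have "hasd (\<lambda>t. Y (c t) k) ((\<i> * fst (c t) k) \<bullet> U (c t) + (\<i> * zdot (c t) k) \<bullet> drift (c t))"
    unfolding Y_def by (intro inner_has_vector_derivative cmult_deriv z_deriv drift_deriv k)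
  then show ?thesis by (simp add: Ydot_def add.commute)
qed

lemma U_deriv: "hasd (\<lambda>t. U (c t)) (Udot (c t))"
proof -
  have "hasd (\<lambda>t. U (c t)) (- mean (\<lambda>k. rho (c t) k *\<^sub>R zdot (c t) k + rhodot (c t) k *\<^sub>R fst (c t) k)
      - \<i> * A * U (c t))"
    unfolding U_def[of "c _"]
    by (intro has_vector_derivative_diff has_vector_derivative_minus mean_has_vector_derivative
        scaleR_has_vector_derivative cmult_deriv rho_deriv z_deriv drift_deriv[unfolded U_def])
  then show ?thesis unfolding Udot_alt by (simp add: add.commute)
qed

lemma w_deriv: "hasd (\<lambda>t. w (c t)) (wdot (c t))"
proof -
  have "hasd (\<lambda>t. w (c t)) (2 * mean (\<lambda>k. (rho (c t) k - A * perp (c t) k) *\<^sub>R zdot (c t) k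
      + (rhodot (c t) k - A * perpdot (c t) k) *\<^sub>R fst (c t) k) + (2 - \<i> * A) * Udot (c t))"
    unfolding w_def
    by (intro has_vector_derivative_add has_vector_derivative_diff mean_has_vector_derivative
        scaleR_has_vector_derivative cmult_deriv rho_deriv perp_deriv z_deriv U_deriv)
  then show ?thesis unfolding wdot_alt by (simp add: add.commute)
qed

lemma V_deriv: "hasd (\<lambda>t. V (c t)) (Vdot (c t))"
proof -
  have "hasd (\<lambda>t. (1/2) * (w (c t) \<bullet> w (c t)) + A\<^sup>2 * (U (c t) \<bullet> U (c t))
        + 2 * A\<^sup>2 * mean (\<lambda>k. X (c t) k * X (c t) k + X (c t) k * (fst (c t) k \<bullet> U (c t))))
     ((1/2) * (w (c t) \<bullet> wdot (c t) + wdot (c t) \<bullet> w (c t)) + A\<^sup>2 * (U (c t) \<bullet> Udot (c t) + Udot (c t) \<bullet> U (c t))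
        + 2 * A\<^sup>2 * mean (\<lambda>k. (X (c t) k * Xdot (c t) k + Xdot (c t) k * X (c t) k)
          + (X (c t) k * (fst (c t) k \<bullet> Udot (c t) + zdot (c t) k \<bullet> U (c t)) + Xdot (c t) k * (fst (c t) k \<bullet> U (c t)))))"
    by (intro has_vector_derivative_add cmult_deriv inner_has_vector_derivative mult_has_vector_derivative
        mean_has_vector_derivative w_deriv U_deriv X_deriv z_deriv)
  then have "hasd (\<lambda>t. V (c t))
     ((1/2) * (w (c t) \<bullet> wdot (c t) + wdot (c t) \<bullet> w (c t)) + A\<^sup>2 * (U (c t) \<bullet> Udot (c t) + Udot (c t) \<bullet> U (c t))
        + 2 * A\<^sup>2 * mean (\<lambda>k. (X (c t) k * Xdot (c t) k + Xdot (c t) k * X (c t) k)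
          + (X (c t) k * (fst (c t) k \<bullet> Udot (c t) + zdot (c t) k \<bullet> U (c t)) + Xdot (c t) k * (fst (c t) k \<bullet> U (c t)))))"
    unfolding V_def dot_square_norm power2_eq_square by simp
  moreover have "(1/2) * (w (c t) \<bullet> wdot (c t) + wdot (c t) \<bullet> w (c t)) + A\<^sup>2 * (U (c t) \<bullet> Udot (c t) + Udot (c t) \<bullet> U (c t))
        + 2 * A\<^sup>2 * mean (\<lambda>k. (X (c t) k * Xdot (c t) k + Xdot (c t) k * X (c t) k)
          + (X (c t) k * (fst (c t) k \<bullet> Udot (c t) + zdot (c t) k \<bullet> U (c t)) + Xdot (c t) k * (fst (c t) k \<bullet> U (c t))))
     = Vdot (c t)"
    unfolding Vdot_def by (simp add: inner_commute algebra_simps)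
  ultimately show ?thesis by simp
qed

lemma W_deriv: "hasd (\<lambda>t. W (c t)) (Wdot (c t))"
proof -
  have "hasd (\<lambda>t. drift (c t) \<bullet> (w (c t) - \<i> * A * U (c t)) + A\<^sup>2 * (drift (c t) \<bullet> drift (c t))
        - 2 * A * mean (\<lambda>k. X (c t) k * Y (c t) k))
     ((drift (c t) \<bullet> (wdot (c t) - \<i> * A * Udot (c t)) + U (c t) \<bullet> (w (c t) - \<i> * A * U (c t)))
      + A\<^sup>2 * (drift (c t) \<bullet> U (c t) + U (c t) \<bullet> drift (c t))
      - 2 * A * mean (\<lambda>k. X (c t) k * Ydot (c t) k + Xdot (c t) k * Y (c t) k))"
    by (intro has_vector_derivative_add has_vector_derivative_diff cmult_deriv inner_has_vector_derivative
        mult_has_vector_derivative mean_has_vector_derivative w_deriv U_deriv X_deriv Y_deriv drift_deriv)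
  then have "hasd (\<lambda>t. W (c t)) ((drift (c t) \<bullet> (wdot (c t) - \<i> * A * Udot (c t)) + U (c t) \<bullet> (w (c t) - \<i> * A * U (c t)))
      + A\<^sup>2 * (drift (c t) \<bullet> U (c t) + U (c t) \<bullet> drift (c t))
      - 2 * A * mean (\<lambda>k. X (c t) k * Ydot (c t) k + Xdot (c t) k * Y (c t) k))"
    unfolding W_def dot_square_norm .
  moreover have "(drift (c t) \<bullet> (wdot (c t) - \<i> * A * Udot (c t)) + U (c t) \<bullet> (w (c t) - \<i> * A * U (c t)))
      + A\<^sup>2 * (drift (c t) \<bullet> U (c t) + U (c t) \<bullet> drift (c t))
      - 2 * A * mean (\<lambda>k. X (c t) k * Ydot (c t) k + Xdot (c t) k * Y (c t) k) = Wdot (c t)"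
    unfolding Wdot_def by (simp add: inner_commute algebra_simps)
  ultimately show ?thesis by simp
qed

lemma F_deriv:
  assumes k: "k \<in> {1..n}" shows "hasd (\<lambda>t. F (c t) k) (Fdot (c t) k)"
proof -
  have s: "hasd (\<lambda>t. sg (c t) k) (sgdot (c t) k)"
    unfolding sg_def sgdot_def by (intro has_vector_derivative_diff cmult_deriv rho_deriv Y_deriv k)
  have ta: "hasd (\<lambda>t. tau (c t) k) (taudot (c t) k)"
    unfolding tau_def taudot_def by (intro has_vector_derivative_diff perp_deriv Y_deriv k)
  have "hasd (\<lambda>t. (1/2) * (par (c t) k * par (c t) k + tau (c t) k * tau (c t) k
        + (par (c t) k - sg (c t) k) * (par (c t) k - sg (c t) k)) + mu * ((par (c t) k - 2 * sg (c t) k) * tau (c t) k))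
     ((1/2) * ((par (c t) k * pardot (c t) k + pardot (c t) k * par (c t) k)
        + (tau (c t) k * taudot (c t) k + taudot (c t) k * tau (c t) k)
        + ((par (c t) k - sg (c t) k) * (pardot (c t) k - sgdot (c t) k) + (pardot (c t) k - sgdot (c t) k) * (par (c t) k - sg (c t) k)))
      + mu * ((par (c t) k - 2 * sg (c t) k) * taudot (c t) k + (pardot (c t) k - 2 * sgdot (c t) k) * tau (c t) k))"
    by (intro has_vector_derivative_add has_vector_derivative_diff cmult_deriv mult_has_vector_derivative
        par_deriv s ta k)
  then show ?thesis unfolding F_def Fdot_def power2_eq_square
    by (simp add: add_divide_distrib mult.commute[of "pardot (c t) k" "par (c t) k"]
        mult.commute[of "taudot (c t) k" "tau (c t) k"]
        mult.commute[of "pardot (c t) k - sgdot (c t) k" "par (c t) k - sg (c t) k"] add.commute)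
qed

lemma L_deriv: "((\<lambda>t. L a b (c t)) has_real_derivative Ldot a b (c t)) (at t within {0..})"
  unfolding has_real_derivative_iff_has_vector_derivative L_def Ldot_def
  by (intro has_vector_derivative_add cmult_deriv mean_has_vector_derivative V_deriv W_deriv F_deriv)

end

lemma J_continuous:
  assumes c: "trajectory c"
  shows "continuous_on {0..} (\<lambda>t. J (c t))"
proof -
  have r: "continuous_on {0..} (\<lambda>t. rho (c t) k)" if k: "k \<in> {1..n}" for k
    unfolding continuous_on_eq_continuous_within
    using has_vector_derivative_continuous[OF rho_deriv[OF c _ k]] by auto
  have d: "continuous_on {0..} (\<lambda>t. snd (c t) k)" if k: "k \<in> {1..n}" for k
    unfolding continuous_on_eq_continuous_within
    using has_vector_derivative_continuous[OF d_deriv[OF c _ k]] by auto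
  show ?thesis
    unfolding J_def mean_def by (intro continuous_intros r d)
qed

lemma norm_U_le_G: "norm (U s) \<le> G s"
  unfolding G_def by (rule real_le_rsqrt) (simp add: msX_nonneg dev_nonneg)

section \<open>Uniform estimates along trajectories\<close>

text \<open>The function \<open>h\<close> is a multiple of the fourth root of \<open>L\<close> along
  the trajectory. Bounding all increments after time \<open>s\<close>, it yields closeness to the
  initial values at \<open>s = 0\<close> and convergence for large \<open>s\<close>. The clause on
  arbitrary \<open>f\<close> with speed at most \<open>norm U / A\<close> is meant for the averaged
  center of mass.\<close>

lemma trajectory_estimates:
  obtains j M where "j > 0" "M > 0"
    "\<And>c. trajectory c \<Longrightarrow> J (c 0) < j \<Longrightarrow>
      \<exists>h. (h \<longlongrightarrow> 0) at_top \<and> h 0 \<le> M * sqrt (J (c 0)) \<and> (\<forall>t\<ge>0. J (c t) \<le> M * J (c 0)) \<and>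
        ((\<lambda>t. J (c t)) \<longlongrightarrow> 0) at_top \<and>
        (\<forall>s t. 0 \<le> s \<longrightarrow> s \<le> t \<longrightarrow> (\<forall>k\<in>{1..n}. norm (fst (c t) k - fst (c s) k) \<le> h s)) \<and>
        (\<forall>f f'. (\<forall>t\<ge>0. (f has_vector_derivative f' t) (at t within {0..}) \<and> norm (f' t) \<le> norm (U (c t)) / A)
           \<longrightarrow> (\<forall>s t. 0 \<le> s \<longrightarrow> s \<le> t \<longrightarrow> norm (f t - f s :: complex) \<le> h s))"
proof -
  obtain j a b c0 K where j: "j > 0" and c0: "c0 > 0" and K: "K > 0" and lyap:
    "\<And>s. mean (fst s) = mean (snd s) \<Longrightarrow> J s \<le> j \<Longrightarrow>
       0 \<le> L a b s \<and> c0 * (J s)\<^sup>2 \<le> L a b s \<and> L a b s \<le> K * (J s)\<^sup>2 \<and> Ldot a b s \<le> - c0 * (G s)\<^sup>2 \<and>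
       L a b s * sqrt (L a b s) \<le> K * (G s)\<^sup>2 \<and> (\<forall>k\<in>{1..n}. norm (zdot s k) \<le> K * G s)"
    by (rule lyapunov) blast
  \<comment> \<open>\<open>L\<close> lies between multiples of \<open>J\<^sup>2\<close>, so while
    \<open>L\<close> decreases \<open>J\<close> exceeds its initial value at most by this
    factor.\<close>
  define T where "T = sqrt (K / c0)"
  have T: "T > 0" using K c0 by (simp add: T_def)
  \<comment> \<open>Starting below \<open>j / T\<close> keeps \<open>J\<close> strictly below
    \<open>j\<close>, which closes the continuity argument.\<close>
  define j1 where "j1 = min j (j / T)"
  have j1: "j1 > 0" "j1 \<le> j" "T * j1 \<le> j" using j T by (auto simp: j1_def min_def field_simps)
  define P where "P = 4 * sqrt (3 * (K / c0 + 1) / c0)"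
  have P: "P > 0" using K c0 by (simp add: P_def add_pos_pos)
  define Q where "Q = max K (1 / A)"
  have Q: "Q > 0" "K \<le> Q" "1 / A \<le> Q" using K by (simp_all add: Q_def)
  define M where "M = max T (Q * P * sqrt (sqrt K))"
  have M: "M > 0" using T by (simp add: M_def)
  show ?thesis
  proof (rule that[OF j1(1) M])
    fix c assume c: "trajectory c" and init: "J (c 0) < j1"
    have bal: "mean (fst (c t)) = mean (snd (c t))" if "t \<ge> 0" for t
      using c that unfolding trajectory_def by blast
    define l where "l t = L a b (c t)" for t
    have ld: "(l has_real_derivative Ldot a b (c t)) (at t within {0..})" if "t \<ge> 0" for t
      unfolding l_def[abs_def] by (rule L_deriv[OF c that])
    have sq: "J (c t) \<le> T * J (c 0)" if "c0 * (J (c t))\<^sup>2 \<le> K * (J (c 0))\<^sup>2" for t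
    proof -
      have "(J (c t))\<^sup>2 \<le> (T * J (c 0))\<^sup>2"
        using that c0 K by (simp add: T_def power_mult_distrib field_simps)
      then show ?thesis by (rule power2_le_imp_le) (use T J_nonneg in simp)
    qed
    have dec: "J (c t) \<le> T * J (c 0)" if t: "0 \<le> t" and le: "\<And>x. 0 \<le> x \<Longrightarrow> x \<le> t \<Longrightarrow> J (c x) \<le> j" for t
    proof (rule sq)
      have "l t \<le> l 0"
      proof (rule half_line_decreasing[OF ld])
        fix x assume x: "0 \<le> x" "x \<le> t"
        then have "Ldot a b (c x) \<le> - c0 * (G (c x))\<^sup>2" using lyap[OF bal le] by blast
        moreover have "0 \<le> c0 * (G (c x))\<^sup>2" using c0 by simp
        ultimately show "Ldot a b (c x) \<le> 0" by simp
      qed (use t in auto)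
      moreover have "c0 * (J (c t))\<^sup>2 \<le> l t" "l 0 \<le> K * (J (c 0))\<^sup>2"
        using lyap[OF bal le] t by (auto simp: l_def)
      ultimately show "c0 * (J (c t))\<^sup>2 \<le> K * (J (c 0))\<^sup>2" by simp
    qed
    have Jj: "J (c t) < j" if "t \<ge> 0" for t
    proof (rule continuous_bootstrap[OF J_continuous[OF c] _ _ that])
      show "J (c 0) < j" using init j1 by simp
      fix t assume "0 \<le> t" "\<And>x. 0 \<le> x \<Longrightarrow> x \<le> t \<Longrightarrow> J (c x) \<le> j"
      then have "J (c t) \<le> T * J (c 0)" by (rule dec)
      also have "\<dots> < T * j1" using init T by simp
      finally show "J (c t) < j" using j1 by simp
    qed
    have JT: "J (c t) \<le> T * J (c 0)" if "t \<ge> 0" for t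
      using Jj by (intro dec[OF that]) (auto intro: less_imp_le)
    note ly = lyap[OF bal less_imp_le[OF Jj]]
    have speed: "norm (f t - f s) \<le> Q * P * sqrt (sqrt (l s))"
      if f: "\<And>t. t \<ge> 0 \<Longrightarrow> (f has_vector_derivative f' t) (at t within {0..})"
        "\<And>t. t \<ge> 0 \<Longrightarrow> norm (f' t) \<le> Q * G (c t)" and st: "0 \<le> s" "s \<le> t" for f f' :: "real \<Rightarrow> complex" and s t
      unfolding P_def
      by (rule lojasiewicz_speed[where l' = "\<lambda>t. Ldot a b (c t)" and g = "\<lambda>t. G (c t)" and c = c0 and K = K and M = Q, OF ld _ _ _ _ _ _ _ f st])
        (use ly c0 K Q G_nonneg in \<open>auto simp: l_def\<close>)
    have l0: "(l \<longlongrightarrow> 0) at_top"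
      by (rule lojasiewicz_decay_zero[where l' = "\<lambda>t. Ldot a b (c t)" and g = "\<lambda>t. G (c t)" and c = c0 and K = K, OF ld])
        (use ly c0 K in \<open>auto simp: l_def\<close>)
    define h where "h s = Q * P * sqrt (sqrt (l s))" for s
    have "(h \<longlongrightarrow> Q * P * sqrt (sqrt 0)) at_top"
      unfolding h_def[abs_def] by (intro tendsto_intros l0)
    then have h1: "(h \<longlongrightarrow> 0) at_top" by simp
    have h2: "h 0 \<le> M * sqrt (J (c 0))"
    proof -
      have "l 0 \<le> K * (J (c 0))\<^sup>2" using ly[of 0] by (simp add: l_def)
      then have "sqrt (sqrt (l 0)) \<le> sqrt (sqrt (K * (J (c 0))\<^sup>2))" by simp
      also have "\<dots> = sqrt (sqrt K) * sqrt (J (c 0))" using J_nonneg[of "c 0"] by (simp add: real_sqrt_mult)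
      finally have "h 0 \<le> Q * P * (sqrt (sqrt K) * sqrt (J (c 0)))"
        unfolding h_def using Q P by (intro mult_left_mono) auto
      also have "\<dots> = (Q * P * sqrt (sqrt K)) * sqrt (J (c 0))" by simp
      also have "\<dots> \<le> M * sqrt (J (c 0))" by (intro mult_right_mono) (simp_all add: M_def J_nonneg)
      finally show ?thesis .
    qed
    have h3: "J (c t) \<le> M * J (c 0)" if "t \<ge> 0" for t
      using JT[OF that] mult_right_mono[of T M "J (c 0)"] by (simp add: M_def J_nonneg)
    have h4: "((\<lambda>t. J (c t)) \<longlongrightarrow> 0) at_top"
    proof (rule Lim_null_comparison)
      show "((\<lambda>t. sqrt (l t / c0)) \<longlongrightarrow> 0) at_top"
        using tendsto_real_sqrt[OF tendsto_divide[OF l0 tendsto_const[of c0]]] c0 by simp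
      show "\<forall>\<^sub>F t in at_top. norm (J (c t)) \<le> sqrt (l t / c0)"
        using eventually_ge_at_top[of 0]
      proof eventually_elim
        case (elim t)
        then have "c0 * (J (c t))\<^sup>2 \<le> l t" using ly[of t] by (simp add: l_def)
        then have "(J (c t))\<^sup>2 \<le> l t / c0" using c0 by (simp add: field_simps)
        then show ?case using J_nonneg by (simp add: real_le_rsqrt)
      qed
    qed
    have h5: "norm (fst (c t) k - fst (c s) k) \<le> h s" if "0 \<le> s" "s \<le> t" "k \<in> {1..n}" for s t k
      unfolding h_def
    proof (rule speed[OF z_deriv[OF c _ that(3)] _ that(1,2)])
      fix t :: real assume t: "0 \<le> t"
      have "norm (zdot (c t) k) \<le> K * G (c t)" using ly[OF t t] that(3) by blast
      also have "\<dots> \<le> Q * G (c t)" using Q G_nonneg by (intro mult_right_mono) auto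
      finally show "norm (zdot (c t) k) \<le> Q * G (c t)" .
    qed
    have h6: "norm (f t - f s) \<le> h s"
      if f: "\<forall>t\<ge>0. (f has_vector_derivative f' t) (at t within {0..}) \<and> norm (f' t) \<le> norm (U (c t)) / A"
        and st: "0 \<le> s" "s \<le> t" for f f' :: "real \<Rightarrow> complex" and s t
      unfolding h_def
    proof (rule speed[OF _ _ st])
      fix t :: real assume t: "0 \<le> t"
      then show "(f has_vector_derivative f' t) (at t within {0..})" using f by blast
      have "norm (f' t) \<le> norm (U (c t)) / A" using f t by blast
      also have "\<dots> \<le> (1 / A) * G (c t)" using norm_U_le_G A_pos by (simp add: divide_right_mono)
      also have "\<dots> \<le> Q * G (c t)" using Q G_nonneg by (intro mult_right_mono) auto
      finally show "norm (f' t) \<le> Q * G (c t)" .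
    qed
    show "\<exists>h. (h \<longlongrightarrow> 0) at_top \<and> h 0 \<le> M * sqrt (J (c 0)) \<and> (\<forall>t\<ge>0. J (c t) \<le> M * J (c 0)) \<and>
        ((\<lambda>t. J (c t)) \<longlongrightarrow> 0) at_top \<and>
        (\<forall>s t. 0 \<le> s \<longrightarrow> s \<le> t \<longrightarrow> (\<forall>k\<in>{1..n}. norm (fst (c t) k - fst (c s) k) \<le> h s)) \<and>
        (\<forall>f f'. (\<forall>t\<ge>0. (f has_vector_derivative f' t) (at t within {0..}) \<and> norm (f' t) \<le> norm (U (c t)) / A)
           \<longrightarrow> (\<forall>s t. 0 \<le> s \<longrightarrow> s \<le> t \<longrightarrow> norm (f t - f s :: complex) \<le> h s))"
      by (intro exI[of _ h] conjI h1 h2 h4 allI impI ballI; (rule h3 h5 h6; assumption))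
  qed
qed

subsection \<open>Solutions of the swarm equations\<close>

definition center :: "(nat \<Rightarrow> real \<Rightarrow> complex) \<Rightarrow> real \<Rightarrow> complex" where
  "center r t = mean (\<lambda>k. r k t)"
definition co_rotating :: "(nat \<Rightarrow> real \<Rightarrow> complex) \<Rightarrow> (nat \<Rightarrow> real \<Rightarrow> complex) \<Rightarrow> real \<Rightarrow> config" where
  "co_rotating r v t = (\<lambda>k. cis (- A * t) * v k t,
     \<lambda>k. cis (- A * t) * (v k t - \<i> * A * (r k t - center r t)))"

lemma cis_inverse: "cis (A * t) * (cis (- A * t) * x) = x"
  by (simp add: cis_mult mult.assoc[symmetric])

lemma solutionD:
  assumes "swarm_solution n A r v" "k \<in> {1..n}" "t \<ge> 0"
  shows "(r k has_vector_derivative v k t) (at t within {0..})"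
    and "(v k has_vector_derivative (1 - (cmod (v k t))\<^sup>2) *\<^sub>R v k t - A\<^sup>2 *\<^sub>R (r k t - center r t)) (at t within {0..})"
proof -
  show "(r k has_vector_derivative v k t) (at t within {0..})"
    using assms unfolding swarm_solution_def by blast
  have "(A\<^sup>2 / real n) *\<^sub>R (\<Sum>m=1..n. r k t - r m t) = A\<^sup>2 *\<^sub>R (r k t - center r t)"
  proof -
    have "A\<^sup>2 *\<^sub>R (r k t - center r t) = A\<^sup>2 *\<^sub>R mean (\<lambda>m. r k t - r m t)"
      unfolding mean_diff mean_const center_def ..
    then show ?thesis by (simp add: mean_def)
  qed
  moreover have "(v k has_vector_derivative
      (1 - (cmod (v k t))\<^sup>2) *\<^sub>R v k t - (A\<^sup>2 / real n) *\<^sub>R (\<Sum>m=1..n. r k t - r m t)) (at t within {0..})"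
    using assms unfolding swarm_solution_def by blast
  ultimately show "(v k has_vector_derivative (1 - (cmod (v k t))\<^sup>2) *\<^sub>R v k t - A\<^sup>2 *\<^sub>R (r k t - center r t)) (at t within {0..})"
    by simp
qed

lemma center_deriv:
  assumes "swarm_solution n A r v" "t \<ge> 0"
  shows "(center r has_vector_derivative mean (\<lambda>k. v k t)) (at t within {0..})"
  unfolding center_def[abs_def]
  by (rule mean_has_vector_derivative) (rule solutionD(1)[OF assms(1) _ assms(2)])

lemma mean_offset: "mean (\<lambda>k. x * (v k t - \<i> * A * (r k t - center r t))) = x * mean (\<lambda>k. v k t)"
  unfolding mean_mult mean_diff mean_const center_def by simp

lemma co_rotating_drift: "drift (co_rotating r v t) = cis (- A * t) * mean (\<lambda>k. v k t)"
  unfolding drift_def co_rotating_def snd_conv by (rule mean_offset)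

lemma co_rotating_trajectory:
  assumes sol: "swarm_solution n A r v"
  shows "trajectory (co_rotating r v)"
  unfolding trajectory_def
proof (intro allI impI conjI ballI)
  fix t :: real assume t: "t \<ge> 0"
  show "mean (fst (co_rotating r v t)) = mean (snd (co_rotating r v t))"
    unfolding co_rotating_def fst_conv snd_conv mean_offset mean_mult ..
  fix k assume k: "k \<in> {1..n}"
  define e where "e = cis (- A * t)"
  define x where "x = r k t - center r t"
  define a where "a = (1 - (cmod (v k t))\<^sup>2) *\<^sub>R v k t - A\<^sup>2 *\<^sub>R x"
  have ed: "((\<lambda>t. cis (- A * t)) has_vector_derivative (- A) *\<^sub>R (\<i> * e)) (at t within {0..})"
    unfolding e_def by (rule cis_line_has_vector_derivative)
  have vd: "(v k has_vector_derivative a) (at t within {0..})"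
    unfolding a_def x_def by (rule solutionD(2)[OF sol k t])
  have fs: "fst (co_rotating r v t) k = e * v k t" and sn: "snd (co_rotating r v t) k = e * (v k t - \<i> * A * x)"
    by (simp_all add: co_rotating_def e_def x_def)
  have dr: "drift (co_rotating r v t) = e * mean (\<lambda>k. v k t)"
    unfolding e_def by (rule co_rotating_drift)
  have rho: "rho (co_rotating r v t) k = (cmod (v k t))\<^sup>2 - 1"
    by (simp add: rho_def co_rotating_def norm_mult)
  have "((\<lambda>t. cis (- A * t) * v k t) has_vector_derivative e * a + (- A) *\<^sub>R (\<i> * e) * v k t) (at t within {0..})"
    unfolding e_def by (rule mult_has_vector_derivative[OF ed[unfolded e_def] vd])
  moreover have "e * a + (- A) *\<^sub>R (\<i> * e) * v k t = zdot (co_rotating r v t) k"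
    unfolding zdot_def rho fs sn a_def by (simp add: scaleR_conv_of_real algebra_simps power2_eq_square)
  ultimately show "((\<lambda>t. fst (co_rotating r v t) k) has_vector_derivative zdot (co_rotating r v t) k) (at t within {0..})"
    by (simp add: co_rotating_def)
  have "((\<lambda>t. cis (- A * t) * (v k t - \<i> * A * (r k t - center r t))) has_vector_derivative
      e * (a - \<i> * A * (v k t - mean (\<lambda>k. v k t))) + (- A) *\<^sub>R (\<i> * e) * (v k t - \<i> * A * x)) (at t within {0..})"
    unfolding e_def x_def
    by (intro mult_has_vector_derivative[OF ed[unfolded e_def]] has_vector_derivative_diff vd
        bounded_linear.has_vector_derivative[OF bounded_linear_mult_right] solutionD(1)[OF sol k t] center_deriv[OF sol t])
  moreover have "e * (a - \<i> * A * (v k t - mean (\<lambda>k. v k t))) + (- A) *\<^sub>R (\<i> * e) * (v k t - \<i> * A * x)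
      = ddot (co_rotating r v t) k"
    unfolding ddot_def rho fs sn dr a_def by (simp add: scaleR_conv_of_real algebra_simps power2_eq_square)
  ultimately show "((\<lambda>t. snd (co_rotating r v t) k) has_vector_derivative ddot (co_rotating r v t) k) (at t within {0..})"
    by (simp add: co_rotating_def)
qed

text \<open>The center of mass oscillates with frequency \<open>A\<close> as long as the drift is nonzero; removing this
  oscillation leaves a quantity whose speed \<open>norm U / A\<close> is dissipated.\<close>

definition smooth_center :: "(nat \<Rightarrow> real \<Rightarrow> complex) \<Rightarrow> (nat \<Rightarrow> real \<Rightarrow> complex) \<Rightarrow> real \<Rightarrow> complex" where
  "smooth_center r v t = center r t + (\<i> / A) * (cis (A * t) * drift (co_rotating r v t))"

text \<open>Differentiating the factor \<open>cis (A * t)\<close> produces minus the velocity of the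
  center of mass, which cancels; only the change of the drift in the rotating frame is left.\<close>

lemma smooth_center_deriv:
  assumes sol: "swarm_solution n A r v" and t: "t \<ge> 0"
  shows "(smooth_center r v has_vector_derivative (\<i> / A) * (cis (A * t) * U (co_rotating r v t))) (at t within {0..})"
proof -
  have "(smooth_center r v has_vector_derivative mean (\<lambda>k. v k t) + (\<i> / A) * (cis (A * t) * U (co_rotating r v t)
      + A *\<^sub>R (\<i> * cis (A * t)) * drift (co_rotating r v t))) (at t within {0..})"
    unfolding smooth_center_def[abs_def]
    by (intro has_vector_derivative_add mult_has_vector_derivative center_deriv[OF sol t]
        bounded_linear.has_vector_derivative[OF bounded_linear_mult_right] cis_line_has_vector_derivative
        drift_deriv[OF co_rotating_trajectory[OF sol] t])
  moreover have "(\<i> / A) * (A *\<^sub>R (\<i> * cis (A * t)) * drift (co_rotating r v t)) = - mean (\<lambda>k. v k t)"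
    unfolding co_rotating_drift using A_pos cis_inverse[of t "mean (\<lambda>k. v k t)"]
    by (simp add: scaleR_conv_of_real mult_ac)
  ultimately show ?thesis by (simp add: distrib_left)
qed

lemma velocity_eq: "v k t = cis (A * t) * fst (co_rotating r v t) k"
  unfolding co_rotating_def fst_conv cis_inverse ..

text \<open>Solving the definition of \<open>d\<close> for the offset from the center shows that
  positions are determined by the smoothed center, \<open>z\<close> and \<open>d\<close>, so limits
  and bounds for these carry over.\<close>

lemma position_eq:
  "r k t = smooth_center r v t - (\<i> / A) * (cis (A * t) *
     (drift (co_rotating r v t) + fst (co_rotating r v t) k - snd (co_rotating r v t) k))"
proof -
  have "cis (A * t) * (fst (co_rotating r v t) k - snd (co_rotating r v t) k) = \<i> * A * (r k t - center r t)"
    unfolding co_rotating_def fst_conv snd_conv right_diff_distrib[symmetric] cis_inverse by simp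
  then have "(\<i> / A) * (cis (A * t) * (fst (co_rotating r v t) k - snd (co_rotating r v t) k)) = - (r k t - center r t)"
    using A_pos by simp
  then show ?thesis unfolding smooth_center_def by (simp add: algebra_simps)
qed

lemma norm_snd_le_J: "k \<in> {1..n} \<Longrightarrow> norm (snd s k) \<le> real n * J s"
  and rho_le_J: "k \<in> {1..n} \<Longrightarrow> \<bar>rho s k\<bar> \<le> real n * J s"
  using le_J[of k s] norm_ge_zero[of "snd s k"] abs_ge_zero[of "rho s k"] by linarith+

lemma norm_drift_le_J: "norm (drift s) \<le> J s"
  unfolding drift_def J_def by (rule order_trans[OF norm_mean_le mean_mono]) simp

text \<open>For an exact rotating state \<open>rho\<close> and \<open>d\<close> vanish and the
  smoothed center is \<open>R\<close>, so only the deviations \<open>er\<close> and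
  \<open>ev\<close> survive. The constant \<open>4 + 2 * A\<close> is \<open>3\<close> for
  \<open>rho\<close>, using \<open>\<delta> \<le> 1\<close> in \<open>(m - 1) * (m + 1)\<close>,
  plus \<open>1 + 2 * A\<close> for \<open>d\<close>.\<close>

lemma initial_bounds:
  assumes bal: "balanced_angles n \<theta>" and \<delta>: "0 < \<delta>" "\<delta> \<le> 1"
    and r: "\<And>k. k \<in> {1..n} \<Longrightarrow> cmod (r k 0 - rotating_position A R \<theta> k 0) < \<delta>"
    and v: "\<And>k. k \<in> {1..n} \<Longrightarrow> cmod (v k 0 - rotating_velocity A \<theta> k 0) < \<delta>"
  shows "J (co_rotating r v 0) \<le> (4 + 2 * A) * \<delta>"
    and "norm (smooth_center r v 0 - R) \<le> (1 + (4 + 2 * A) / A) * \<delta>"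
    and "\<And>k. k \<in> {1..n} \<Longrightarrow> norm (fst (co_rotating r v 0) k - \<i> * cis (\<theta> k)) \<le> \<delta>"
proof -
  define er where "er k = r k 0 - rotating_position A R \<theta> k 0" for k
  define ev where "ev k = v k 0 - rotating_velocity A \<theta> k 0" for k
  have er: "norm (er k) \<le> \<delta>" and ev: "norm (ev k) \<le> \<delta>" if "k \<in> {1..n}" for k
    using r[OF that] v[OF that] by (simp_all add: er_def ev_def)
  have rk: "r k 0 = R + (1 / A) *\<^sub>R cis (\<theta> k) + er k" and vk: "v k 0 = \<i> * cis (\<theta> k) + ev k" for k
    by (simp_all add: er_def ev_def rotating_position_def rotating_velocity_def)
  have "mean (\<lambda>k. cis (\<theta> k)) = 0" using bal by (simp add: mean_def balanced_angles_def)
  then have ctr: "center r 0 = R + mean er"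
    unfolding center_def rk mean_add mean_const mean_scaleR by simp
  have mer: "norm (mean er) \<le> \<delta>"
    using order_trans[OF norm_mean_le mean_mono[of "\<lambda>k. norm (er k)" "\<lambda>k. \<delta>"]] er by (simp add: mean_const)
  show z: "norm (fst (co_rotating r v 0) k - \<i> * cis (\<theta> k)) \<le> \<delta>" if "k \<in> {1..n}" for k
    using ev[OF that] by (simp add: co_rotating_def vk)
  have d: "norm (snd (co_rotating r v 0) k) \<le> \<delta> + 2 * A * \<delta>" if k: "k \<in> {1..n}" for k
  proof -
    have "snd (co_rotating r v 0) k = ev k - \<i> * A * (er k - mean er)"
      using A_pos by (simp add: co_rotating_def vk rk ctr scaleR_conv_of_real algebra_simps)
    then have "norm (snd (co_rotating r v 0) k) \<le> norm (ev k) + norm (\<i> * A * (er k - mean er))"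
      by (simp only: norm_triangle_ineq4)
    also have "norm (\<i> * A * (er k - mean er)) = A * norm (er k - mean er)" using A_pos by (simp add: norm_mult)
    also have "\<dots> \<le> A * (\<delta> + \<delta>)"
      using norm_triangle_ineq4[of "er k" "mean er"] er[OF k] mer A_pos by (intro mult_left_mono) auto
    finally show ?thesis using ev[OF k] by simp
  qed
  have rh: "\<bar>rho (co_rotating r v 0) k\<bar> \<le> 3 * \<delta>" if k: "k \<in> {1..n}" for k
  proof -
    define m where "m = norm (fst (co_rotating r v 0) k)"
    have m: "\<bar>m - 1\<bar> \<le> \<delta>"
      using norm_triangle_ineq3[of "fst (co_rotating r v 0) k" "\<i> * cis (\<theta> k)"] z[OF k]
      by (simp add: m_def norm_mult)
    have "\<bar>rho (co_rotating r v 0) k\<bar> = \<bar>m - 1\<bar> * \<bar>m + 1\<bar>"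
      unfolding abs_mult[symmetric] by (simp add: rho_def m_def algebra_simps power2_eq_square)
    also have "\<dots> \<le> \<delta> * 3" using m \<delta> by (intro mult_mono) auto
    finally show ?thesis by simp
  qed
  have "J (co_rotating r v 0) \<le> mean (\<lambda>k. 3 * \<delta> + (\<delta> + 2 * A * \<delta>))"
    unfolding J_def using rh d by (intro mean_mono add_mono) auto
  then show J: "J (co_rotating r v 0) \<le> (4 + 2 * A) * \<delta>" unfolding mean_const by (simp add: algebra_simps)
  have "smooth_center r v 0 - R = mean er + (\<i> / A) * drift (co_rotating r v 0)"
    by (simp add: smooth_center_def ctr)
  also have "norm \<dots> \<le> norm (mean er) + norm (drift (co_rotating r v 0)) / A"
    using norm_triangle_ineq[of "mean er" "(\<i> / A) * drift (co_rotating r v 0)"] A_pos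
    by (simp add: norm_mult norm_divide)
  also have "\<dots> \<le> \<delta> + (4 + 2 * A) * \<delta> / A"
    using mer order_trans[OF norm_drift_le_J J] A_pos by (intro add_mono divide_right_mono) auto
  finally show "norm (smooth_center r v 0 - R) \<le> (1 + (4 + 2 * A) / A) * \<delta>"
    by (simp add: algebra_simps)
qed

lemma velocity_error:
  "norm (v k t - rotating_velocity A \<theta> k t) = norm (fst (co_rotating r v t) k - \<i> * cis (\<theta> k))"
proof -
  have "v k t - rotating_velocity A \<theta> k t = cis (A * t) * (fst (co_rotating r v t) k - \<i> * cis (\<theta> k))"
    by (subst velocity_eq[of v k t r]) (simp add: rotating_velocity_def algebra_simps)
  then show ?thesis by (simp add: norm_mult)
qed

lemma position_error:
  assumes k: "k \<in> {1..n}"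
  shows "norm (r k t - rotating_position A R \<theta> k t) \<le> norm (smooth_center r v t - R)
    + ((1 + real n) * J (co_rotating r v t) + norm (fst (co_rotating r v t) k - \<i> * cis (\<theta> k))) / A"
proof -
  define s where "s = co_rotating r v t"
  have "r k t - rotating_position A R \<theta> k t = (smooth_center r v t - R)
     - (\<i> / A) * (cis (A * t) * (drift s - snd s k + (fst s k - \<i> * cis (\<theta> k))))"
    using A_pos by (subst position_eq[of r k t v])
      (simp add: rotating_position_def s_def scaleR_conv_of_real algebra_simps)
  also have "norm \<dots> \<le> norm (smooth_center r v t - R)
     + norm ((\<i> / A) * (cis (A * t) * (drift s - snd s k + (fst s k - \<i> * cis (\<theta> k)))))"
    by (rule norm_triangle_ineq4)
  also have "norm ((\<i> / A) * (cis (A * t) * (drift s - snd s k + (fst s k - \<i> * cis (\<theta> k)))))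
     = norm (drift s - snd s k + (fst s k - \<i> * cis (\<theta> k))) / A"
    using A_pos by (simp add: norm_mult norm_divide)
  also have "\<dots> \<le> ((1 + real n) * J s + norm (fst s k - \<i> * cis (\<theta> k))) / A"
  proof (intro divide_right_mono)
    have "norm (drift s - snd s k + (fst s k - \<i> * cis (\<theta> k)))
        \<le> norm (drift s) + norm (snd s k) + norm (fst s k - \<i> * cis (\<theta> k))"
      by (rule order_trans[OF norm_triangle_ineq add_right_mono[OF norm_triangle_ineq4]])
    also have "\<dots> \<le> J s + real n * J s + norm (fst s k - \<i> * cis (\<theta> k))"
      by (intro add_mono norm_drift_le_J norm_snd_le_J k) simp
    finally show "norm (drift s - snd s k + (fst s k - \<i> * cis (\<theta> k))) \<le> (1 + real n) * J s + norm (fst s k - \<i> * cis (\<theta> k))"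
      by (simp add: algebra_simps)
  qed (use A_pos in simp)
  finally show ?thesis unfolding s_def by simp
qed

text \<open>The limit is forced to be a rotating state: \<open>rho\<close> tends to 0, so the limits
  \<zeta> are unit vectors, and the drift, which is the mean of the \<open>z\<close>, tends to 0, so
  they are balanced.\<close>

lemma converges_to_rotating:
  assumes J: "((\<lambda>t. J (co_rotating r v t)) \<longlongrightarrow> 0) at_top"
    and z: "\<And>k. k \<in> {1..n} \<Longrightarrow> ((\<lambda>t. fst (co_rotating r v t) k) \<longlongrightarrow> \<zeta> k) at_top"
    and R: "(smooth_center r v \<longlongrightarrow> R) at_top"
  shows "\<exists>\<theta>. balanced_angles n \<theta> \<and> (\<forall>k\<in>{1..n}.
    ((\<lambda>t. r k t - rotating_position A R \<theta> k t) \<longlongrightarrow> 0) at_top \<and>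
    ((\<lambda>t. v k t - rotating_velocity A \<theta> k t) \<longlongrightarrow> 0) at_top)"
proof -
  have unit: "norm (\<zeta> k) = 1" if k: "k \<in> {1..n}" for k
  proof -
    have "((\<lambda>t. rho (co_rotating r v t) k) \<longlongrightarrow> (norm (\<zeta> k))\<^sup>2 - 1) at_top"
      unfolding rho_def by (intro tendsto_intros z k)
    moreover have "((\<lambda>t. rho (co_rotating r v t) k) \<longlongrightarrow> 0) at_top"
    proof (rule Lim_null_comparison)
      show "((\<lambda>t. real n * J (co_rotating r v t)) \<longlongrightarrow> 0) at_top"
        using tendsto_mult[OF tendsto_const J] by simp
      show "\<forall>\<^sub>F t in at_top. norm (rho (co_rotating r v t) k) \<le> real n * J (co_rotating r v t)"
        using rho_le_J[OF k] by simp
    qed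
    ultimately have "(norm (\<zeta> k))\<^sup>2 - 1 = 0" by (rule tendsto_unique[rotated]) simp
    then show ?thesis by (simp add: power2_eq_1_iff) (smt (verit) norm_ge_zero)
  qed
  \<comment> \<open>In the rotating frame a rotating state has velocities
    \<open>\<i> * cis (\<theta> k)\<close>; the factor \<open>- \<i>\<close> undoes the quarter
    turn.\<close>
  define \<theta> where "\<theta> k = Arg (- \<i> * \<zeta> k)" for k
  have cis: "\<i> * cis (\<theta> k) = \<zeta> k" if k: "k \<in> {1..n}" for k
  proof -
    have "cis (\<theta> k) = sgn (- \<i> * \<zeta> k)"
      unfolding \<theta>_def using unit[OF k] by (intro cis_Arg) auto
    then show ?thesis using unit[OF k] by (simp add: sgn_div_norm norm_mult)
  qed
  have "(\<Sum>k=1..n. \<zeta> k) = 0"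
  proof -
    have dr: "((\<lambda>t. drift (co_rotating r v t)) \<longlongrightarrow> 0) at_top"
      by (rule Lim_null_comparison[OF _ J]) (simp add: norm_drift_le_J)
    have "drift (co_rotating r v t) = mean (fst (co_rotating r v t))" for t
      unfolding co_rotating_drift unfolding co_rotating_def fst_conv mean_mult ..
    moreover have "((\<lambda>t. mean (fst (co_rotating r v t))) \<longlongrightarrow> mean \<zeta>) at_top"
      unfolding mean_def by (intro tendsto_intros z)
    ultimately have "((\<lambda>t. drift (co_rotating r v t)) \<longlongrightarrow> mean \<zeta>) at_top" by simp
    then have "mean \<zeta> = 0" by (rule tendsto_unique[OF trivial_limit_at_top_linorder _ dr])
    then show ?thesis using n_pos by (simp add: mean_def)
  qed
  moreover have "(\<Sum>k=1..n. \<zeta> k) = \<i> * (\<Sum>k=1..n. cis (\<theta> k))"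
    unfolding sum_distrib_left by (intro sum.cong) (simp_all add: cis)
  ultimately have bal: "balanced_angles n \<theta>" by (simp add: balanced_angles_def)
  have ze: "((\<lambda>t. norm (fst (co_rotating r v t) k - \<i> * cis (\<theta> k))) \<longlongrightarrow> 0) at_top" if k: "k \<in> {1..n}" for k
    using tendsto_norm_zero[OF tendsto_diff[OF z[OF k] tendsto_const[of "\<zeta> k"], simplified]] by (simp add: cis[OF k])
  have vlim: "((\<lambda>t. v k t - rotating_velocity A \<theta> k t) \<longlongrightarrow> 0) at_top" if k: "k \<in> {1..n}" for k
    by (rule tendsto_norm_zero_cancel) (simp only: velocity_error[of v k _ \<theta> r] ze[OF k])
  have rlim: "((\<lambda>t. r k t - rotating_position A R \<theta> k t) \<longlongrightarrow> 0) at_top" if k: "k \<in> {1..n}" for k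
  proof (rule Lim_null_comparison)
    show "\<forall>\<^sub>F t in at_top. norm (r k t - rotating_position A R \<theta> k t) \<le> norm (smooth_center r v t - R)
      + ((1 + real n) * J (co_rotating r v t) + norm (fst (co_rotating r v t) k - \<i> * cis (\<theta> k))) / A"
      using position_error[OF k] by simp
    have "((\<lambda>t. norm (smooth_center r v t - R)
      + ((1 + real n) * J (co_rotating r v t) + norm (fst (co_rotating r v t) k - \<i> * cis (\<theta> k))) / A)
      \<longlongrightarrow> norm (R - R) + ((1 + real n) * 0 + 0) / A) at_top"
      using A_pos by (intro tendsto_intros R J ze k) simp
    then show "((\<lambda>t. norm (smooth_center r v t - R)
      + ((1 + real n) * J (co_rotating r v t) + norm (fst (co_rotating r v t) k - \<i> * cis (\<theta> k))) / A)
      \<longlongrightarrow> 0) at_top" by simp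
  qed
  show ?thesis by (intro exI[of _ \<theta>] conjI ballI bal rlim vlim)
qed

text \<open>Combines the initial bounds of order \<delta> with displacement bounds of order
  \<open>sqrt \<delta>\<close>, since the fourth root of \<open>L\<close> is at most of order
  \<open>sqrt J\<close>.\<close>

lemma stability:
  assumes \<epsilon>: "\<epsilon> > 0"
  obtains \<delta> where "\<delta> > 0" "\<And>R0 \<theta>0 r v. balanced_angles n \<theta>0 \<Longrightarrow> swarm_solution n A r v \<Longrightarrow>
    (\<forall>k\<in>{1..n}. cmod (r k 0 - rotating_position A R0 \<theta>0 k 0) < \<delta> \<and>
                cmod (v k 0 - rotating_velocity A \<theta>0 k 0) < \<delta>) \<Longrightarrow>
      (\<forall>k\<in>{1..n}. \<forall>t\<ge>0.
          cmod (r k t - rotating_position A R0 \<theta>0 k t) < \<epsilon> \<and>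
          cmod (v k t - rotating_velocity A \<theta>0 k t) < \<epsilon>) \<and>
      (\<exists>(R1::complex) (\<theta>1::nat \<Rightarrow> real). balanced_angles n \<theta>1 \<and>
        (\<forall>k\<in>{1..n}.
          ((\<lambda>t. r k t - rotating_position A R1 \<theta>1 k t) \<longlongrightarrow> 0) at_top \<and>
          ((\<lambda>t. v k t - rotating_velocity A \<theta>1 k t) \<longlongrightarrow> 0) at_top))"
proof (rule trajectory_estimates)
  fix j M :: real
  assume j: "j > 0" and M: "M > 0" and est:
    "\<And>c. trajectory c \<Longrightarrow> J (c 0) < j \<Longrightarrow>
      \<exists>h. (h \<longlongrightarrow> 0) at_top \<and> h 0 \<le> M * sqrt (J (c 0)) \<and> (\<forall>t\<ge>0. J (c t) \<le> M * J (c 0)) \<and>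
        ((\<lambda>t. J (c t)) \<longlongrightarrow> 0) at_top \<and>
        (\<forall>s t. 0 \<le> s \<longrightarrow> s \<le> t \<longrightarrow> (\<forall>k\<in>{1..n}. norm (fst (c t) k - fst (c s) k) \<le> h s)) \<and>
        (\<forall>f f'. (\<forall>t\<ge>0. (f has_vector_derivative f' t) (at t within {0..}) \<and> norm (f' t) \<le> norm (U (c t)) / A)
           \<longrightarrow> (\<forall>s t. 0 \<le> s \<longrightarrow> s \<le> t \<longrightarrow> norm (f t - f s :: complex) \<le> h s))"
  define B where "B = 4 + 2 * A"
  have B: "B > 0" using A_pos by (simp add: B_def)
  define E1 where "E1 = M * sqrt B + 1"
  define E2 where "E2 = M * sqrt B + (1 + B / A) + ((1 + real n) * (M * B) + E1) / A"
  have E1: "E1 > 0" using M B by (simp add: E1_def add_pos_pos)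
  have E2: "E2 > 0" using M B A_pos E1 by (simp add: E2_def add_pos_pos add_nonneg_pos)
  define E where "E = E1 + E2"
  have E: "E1 \<le> E" "E2 \<le> E" "E > 0" using E1 E2 by (simp_all add: E_def)
  \<comment> \<open>All final errors are at most \<open>E * sqrt \<delta>\<close>, which explains
    the square of \<open>\<epsilon> / (2 * E)\<close>. The factors 2 make the inequalities
    strict.\<close>
  define \<delta> where "\<delta> = min 1 (min (j / (2 * B)) ((\<epsilon> / (2 * E))\<^sup>2))"
  have \<delta>: "\<delta> > 0" "\<delta> \<le> 1" using j B E \<epsilon> by (simp_all add: \<delta>_def)
  have B\<delta>: "B * \<delta> < j"
  proof -
    have "B * \<delta> \<le> B * (j / (2 * B))" using B by (intro mult_left_mono) (auto simp: \<delta>_def)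
    also have "\<dots> < j" using B j by simp
    finally show ?thesis .
  qed
  have "\<delta> \<le> (\<epsilon> / (2 * E))\<^sup>2" by (simp add: \<delta>_def)
  then have "sqrt \<delta> \<le> sqrt ((\<epsilon> / (2 * E))\<^sup>2)" by (rule real_sqrt_le_mono)
  then have sq: "sqrt \<delta> \<le> \<epsilon> / (2 * E)" using \<epsilon> E by simp
  have small: "y < \<epsilon>" if "y \<le> F * sqrt \<delta>" "F \<le> E" for y F
  proof -
    have "F * sqrt \<delta> \<le> E * sqrt \<delta>" using that \<delta> by (intro mult_right_mono) auto
    with that(1) have "y \<le> E * sqrt \<delta>" by simp
    also have "\<dots> \<le> E * (\<epsilon> / (2 * E))" using E sq by (intro mult_left_mono) auto
    also have "\<dots> < \<epsilon>" using E \<epsilon> by simp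
    finally show ?thesis .
  qed
  have \<delta>sq: "\<delta> \<le> sqrt \<delta>"
    using \<delta> by (intro real_le_rsqrt) (simp add: power2_eq_square mult_left_le)
  show thesis
  proof (rule that[OF \<delta>(1)])
    fix R0 \<theta>0 r v
    assume bal: "balanced_angles n \<theta>0" and sol: "swarm_solution n A r v"
      and ini: "\<forall>k\<in>{1..n}. cmod (r k 0 - rotating_position A R0 \<theta>0 k 0) < \<delta> \<and>
                cmod (v k 0 - rotating_velocity A \<theta>0 k 0) < \<delta>"
    define c where "c = co_rotating r v"
    note tr = co_rotating_trajectory[OF sol, folded c_def]
    have I1: "J (c 0) \<le> B * \<delta>" and I2: "norm (smooth_center r v 0 - R0) \<le> (1 + B / A) * \<delta>"
      and I3: "\<And>k. k \<in> {1..n} \<Longrightarrow> norm (fst (c 0) k - \<i> * cis (\<theta>0 k)) \<le> \<delta>"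
      using initial_bounds[OF bal \<delta>, of r R0 v] ini unfolding B_def c_def by blast+
    obtain h where h: "(h \<longlongrightarrow> 0) at_top" "h 0 \<le> M * sqrt (J (c 0))" "\<forall>t\<ge>0. J (c t) \<le> M * J (c 0)"
        "((\<lambda>t. J (c t)) \<longlongrightarrow> 0) at_top"
      and hz: "\<forall>s t. 0 \<le> s \<longrightarrow> s \<le> t \<longrightarrow> (\<forall>k\<in>{1..n}. norm (fst (c t) k - fst (c s) k) \<le> h s)"
      and hf: "\<forall>f f'. (\<forall>t\<ge>0. (f has_vector_derivative f' t) (at t within {0..}) \<and> norm (f' t) \<le> norm (U (c t)) / A)
           \<longrightarrow> (\<forall>s t. 0 \<le> s \<longrightarrow> s \<le> t \<longrightarrow> norm (f t - f s :: complex) \<le> h s)"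
      using est[OF tr order.strict_trans1[OF I1 B\<delta>]] by (elim exE conjE) (rule that)
    have hR: "norm (smooth_center r v t - smooth_center r v s) \<le> h s" if st: "0 \<le> s" "s \<le> t" for s t
    proof -
      have sp: "\<forall>t\<ge>0. (smooth_center r v has_vector_derivative (\<i> / A) * (cis (A * t) * U (c t))) (at t within {0..})
          \<and> norm ((\<i> / A) * (cis (A * t) * U (c t))) \<le> norm (U (c t)) / A"
        using smooth_center_deriv[OF sol] A_pos by (simp add: c_def norm_mult norm_divide)
      show ?thesis by (rule hf[THEN spec, THEN spec, THEN mp, OF sp, rule_format, OF st])
    qed
    have h0: "h 0 \<le> M * sqrt B * sqrt \<delta>"
    proof -
      have "sqrt (J (c 0)) \<le> sqrt (B * \<delta>)" using I1 by simp
      then have "M * sqrt (J (c 0)) \<le> M * sqrt (B * \<delta>)" using M by (intro mult_left_mono) auto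
      with h(2) show ?thesis by (simp add: real_sqrt_mult)
    qed
    have Jt: "J (c t) \<le> M * B * sqrt \<delta>" if "t \<ge> 0" for t
    proof -
      have "J (c t) \<le> M * J (c 0)" using h(3) that by blast
      also have "\<dots> \<le> M * (B * \<delta>)" using I1 M by (intro mult_left_mono) auto
      also have "\<dots> \<le> M * (B * sqrt \<delta>)" using \<delta>sq M B by (intro mult_left_mono) auto
      finally show ?thesis by simp
    qed
    have zt: "norm (fst (c t) k - \<i> * cis (\<theta>0 k)) \<le> E1 * sqrt \<delta>" if k: "k \<in> {1..n}" and t: "t \<ge> 0" for k t
    proof -
      have "norm (fst (c t) k - fst (c 0) k) \<le> h 0" using hz k t by blast
      then have "norm (fst (c t) k - \<i> * cis (\<theta>0 k)) \<le> h 0 + \<delta>"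
        using norm_triangle_ineq[of "fst (c t) k - fst (c 0) k" "fst (c 0) k - \<i> * cis (\<theta>0 k)"] I3[OF k] by simp
      then show ?thesis using h0 \<delta>sq by (simp add: E1_def distrib_right)
    qed
    have Rt: "norm (smooth_center r v t - R0) \<le> (M * sqrt B + (1 + B / A)) * sqrt \<delta>" if t: "t \<ge> 0" for t
    proof -
      have "norm (smooth_center r v t - R0) \<le> h 0 + (1 + B / A) * \<delta>"
        using norm_triangle_ineq[of "smooth_center r v t - smooth_center r v 0" "smooth_center r v 0 - R0"]
          I2 hR[of 0 t] t by simp
      also have "(1 + B / A) * \<delta> \<le> (1 + B / A) * sqrt \<delta>"
        using \<delta>sq A_pos B by (intro mult_left_mono) auto
      finally show ?thesis using h0 by (simp add: distrib_right)
    qed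
    have vel: "cmod (v k t - rotating_velocity A \<theta>0 k t) < \<epsilon>" if "k \<in> {1..n}" "t \<ge> 0" for k t
      unfolding velocity_error[of v k t \<theta>0 r] using small[OF zt[OF that] E(1)] by (simp add: c_def)
    have pos: "cmod (r k t - rotating_position A R0 \<theta>0 k t) < \<epsilon>" if k: "k \<in> {1..n}" and t: "t \<ge> 0" for k t
    proof (rule small[OF _ E(2)])
      have "cmod (r k t - rotating_position A R0 \<theta>0 k t) \<le> norm (smooth_center r v t - R0)
        + ((1 + real n) * J (c t) + norm (fst (c t) k - \<i> * cis (\<theta>0 k))) / A"
        unfolding c_def by (rule position_error[OF k])
      also have "\<dots> \<le> (M * sqrt B + (1 + B / A)) * sqrt \<delta>
        + ((1 + real n) * (M * B * sqrt \<delta>) + E1 * sqrt \<delta>) / A"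
        using A_pos by (intro add_mono divide_right_mono mult_left_mono Rt Jt zt k t) auto
      also have "\<dots> = E2 * sqrt \<delta>" by (simp add: E2_def algebra_simps add_divide_distrib)
      finally show "cmod (r k t - rotating_position A R0 \<theta>0 k t) \<le> E2 * sqrt \<delta>" .
    qed
    have "\<exists>\<zeta>. \<forall>k\<in>{1..n}. ((\<lambda>t. fst (c t) k) \<longlongrightarrow> \<zeta> k) at_top"
    proof (rule bchoice, rule ballI)
      fix k assume "k \<in> {1..n}"
      with hz have "norm (fst (c t) k - fst (c s) k) \<le> h s" if "0 \<le> s" "s \<le> t" for s t
        using that by blast
      from tendsto_of_tail_bound[OF this h(1)] show "\<exists>x. ((\<lambda>t. fst (c t) k) \<longlongrightarrow> x) at_top" by metis
    qed
    then obtain \<zeta> where \<zeta>: "\<And>k. k \<in> {1..n} \<Longrightarrow> ((\<lambda>t. fst (c t) k) \<longlongrightarrow> \<zeta> k) at_top" by blast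
    obtain R1 where R1: "(smooth_center r v \<longlongrightarrow> R1) at_top"
      using tendsto_of_tail_bound[OF hR h(1)] by metis
    show "(\<forall>k\<in>{1..n}. \<forall>t\<ge>0.
          cmod (r k t - rotating_position A R0 \<theta>0 k t) < \<epsilon> \<and>
          cmod (v k t - rotating_velocity A \<theta>0 k t) < \<epsilon>) \<and>
      (\<exists>(R1::complex) (\<theta>1::nat \<Rightarrow> real). balanced_angles n \<theta>1 \<and>
        (\<forall>k\<in>{1..n}.
          ((\<lambda>t. r k t - rotating_position A R1 \<theta>1 k t) \<longlongrightarrow> 0) at_top \<and>
          ((\<lambda>t. v k t - rotating_velocity A \<theta>1 k t) \<longlongrightarrow> 0) at_top))"
      using vel pos by (intro conjI ballI allI impI exI[of _ R1] converges_to_rotating[OF h(4)[unfolded c_def], folded c_def, OF \<zeta> R1])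
  qed
qed

end

theorem theorem1p2:
  fixes n :: nat and A :: real
  assumes "n \<ge> 2" and "A > 0"
  shows "\<forall>\<epsilon>>0. \<exists>\<delta>>0. \<forall>(R0::complex) (\<theta>0::nat \<Rightarrow> real)
      (r::nat \<Rightarrow> real \<Rightarrow> complex) (v::nat \<Rightarrow> real \<Rightarrow> complex).
    balanced_angles n \<theta>0 \<longrightarrow>
    swarm_solution n A r v \<longrightarrow>
    (\<forall>k\<in>{1..n}. cmod (r k 0 - rotating_position A R0 \<theta>0 k 0) < \<delta> \<and>
                cmod (v k 0 - rotating_velocity A \<theta>0 k 0) < \<delta>) \<longrightarrow>
      (\<forall>k\<in>{1..n}. \<forall>t\<ge>0.
          cmod (r k t - rotating_position A R0 \<theta>0 k t) < \<epsilon> \<and>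
          cmod (v k t - rotating_velocity A \<theta>0 k t) < \<epsilon>) \<and>
      (\<exists>(R1::complex) (\<theta>1::nat \<Rightarrow> real). balanced_angles n \<theta>1 \<and>
        (\<forall>k\<in>{1..n}.
          ((\<lambda>t. r k t - rotating_position A R1 \<theta>1 k t) \<longlongrightarrow> 0) at_top \<and>
          ((\<lambda>t. v k t - rotating_velocity A \<theta>1 k t) \<longlongrightarrow> 0) at_top))"
proof (intro allI impI)
  fix \<epsilon> :: real assume \<epsilon>: "\<epsilon> > 0"
  interpret swarm n A using assms by unfold_locales auto
  show "\<exists>\<delta>>0. \<forall>(R0::complex) (\<theta>0::nat \<Rightarrow> real)
      (r::nat \<Rightarrow> real \<Rightarrow> complex) (v::nat \<Rightarrow> real \<Rightarrow> complex).
    balanced_angles n \<theta>0 \<longrightarrow>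
    swarm_solution n A r v \<longrightarrow>
    (\<forall>k\<in>{1..n}. cmod (r k 0 - rotating_position A R0 \<theta>0 k 0) < \<delta> \<and>
                cmod (v k 0 - rotating_velocity A \<theta>0 k 0) < \<delta>) \<longrightarrow>
      (\<forall>k\<in>{1..n}. \<forall>t\<ge>0.
          cmod (r k t - rotating_position A R0 \<theta>0 k t) < \<epsilon> \<and>
          cmod (v k t - rotating_velocity A \<theta>0 k t) < \<epsilon>) \<and>
      (\<exists>(R1::complex) (\<theta>1::nat \<Rightarrow> real). balanced_angles n \<theta>1 \<and>
        (\<forall>k\<in>{1..n}.
          ((\<lambda>t. r k t - rotating_position A R1 \<theta>1 k t) \<longlongrightarrow> 0) at_top \<and>
          ((\<lambda>t. v k t - rotating_velocity A \<theta>1 k t) \<longlongrightarrow> 0) at_top))"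
    by (rule stability[OF \<epsilon>]) blast
qed

end
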